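(* For every knot $K\subset S^3$, every integer $t$, and each choice of sign $\pm$, $$\gamma_4(\mathrm{Wh}^{\pm}_t(K))\leq 2.$$
   Context: All knots are in $S^3$ and all embeddings are smooth. For a knot $K$, the non-orientable 4-genus is $\gamma_4(K)=\min\{b_1(F) : F\subset B^4 \text{ a smoothly embedded compact connected non-orientable surface with } \partial F=K\}$, where $b_1$ is the first Betti number. For an integer $t$, $\mathrm{Wh}^{\pm}_t(K)$ denotes the positive ($+$) or negative ($-$) $t$-twisted Whitehead double of $K$: the satellite of $K$ whose pattern in $S^1\times D^2$ is the Whitehead double pattern with a $\pm$ clasp and $t$ full twists, where the longitude of $S^1\times D^2$ is identified with the Seifert framing of $K$. Equivalently, $\mathrm{Wh}^{\pm}_t(K)$ is the boundary of the genus-one Seifert surface obtained by plumbing an annulus with core $K$ and framing $t$ (its two boundary components, oriented in parallel, have linking number $t$) with a Hopf band whose core has framing $-1$ (for $+$) or $+1$ (for $-$). *)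

theory Defs
  imports "HOL-Analysis.Analysis" "HOL-Homology.Homology"
begin

section \<open>Smooth maps between subsets of Euclidean spaces\<close>

text \<open>Only used for open \<open>U\<close>: partial derivatives up to order \<open>n\<close> exist and are continuous.\<close>

primrec C_k_on :: "nat \<Rightarrow> 'a::euclidean_space set \<Rightarrow> ('a \<Rightarrow> 'b::euclidean_space) \<Rightarrow> bool" where
  "C_k_on 0 U f \<longleftrightarrow> continuous_on U f"
| "C_k_on (Suc n) U f \<longleftrightarrow>
     f differentiable_on U \<and> (\<forall>v. C_k_on n U (\<lambda>x. frechet_derivative f (at x) v))"

text \<open>A map on an arbitrary subset is smooth if it locally extends to a smooth map on an open
  subset of the ambient space.\<close>

definition smooth_on :: "'a::euclidean_space set \<Rightarrow> ('a \<Rightarrow> 'b::euclidean_space) \<Rightarrow> bool" where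
  "smooth_on S f \<longleftrightarrow>
     (\<forall>x\<in>S. \<exists>U g. open U \<and> x \<in> U \<and> (\<forall>n. C_k_on n U g) \<and> (\<forall>y\<in>S \<inter> U. g y = f y))"

definition diffeomorphism ::
  "'a::euclidean_space set \<Rightarrow> 'b::euclidean_space set \<Rightarrow> ('a \<Rightarrow> 'b) \<Rightarrow> ('b \<Rightarrow> 'a) \<Rightarrow> bool" where
  "diffeomorphism S T f g \<longleftrightarrow>
     smooth_on S f \<and> smooth_on T g \<and> f ` S = T \<and> g ` T = S \<and>
     (\<forall>x\<in>S. g (f x) = x) \<and> (\<forall>y\<in>T. f (g y) = y)"

section \<open>Smoothly embedded surfaces with boundary\<close>

definition half_plane :: "(real^2) set" where
  "half_plane = {x. 0 \<le> x $ 2}"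

text \<open>A local parametrization \<open>f\<close> of \<open>F\<close> by a relatively open subset \<open>V\<close> of the half plane,
  with inverse \<open>g\<close>.\<close>

definition local_param ::
  "'a::euclidean_space set \<Rightarrow> (real^2) set \<times> (real^2 \<Rightarrow> 'a) \<times> ('a \<Rightarrow> real^2) \<Rightarrow> bool" where
  "local_param F = (\<lambda>(V, f, g).
     openin (top_of_set half_plane) V \<and> openin (top_of_set F) (f ` V) \<and>
     diffeomorphism V (f ` V) f g)"

definition smooth_surface :: "'a::euclidean_space set \<Rightarrow> bool" where
  "smooth_surface F \<longleftrightarrow> (\<forall>p\<in>F. \<exists>V f g. local_param F (V, f, g) \<and> p \<in> f ` V)"

definition surface_boundary :: "'a::euclidean_space set \<Rightarrow> 'a set" where
  "surface_boundary F = {p. \<exists>V f g x. local_param F (V, f, g) \<and> x \<in> V \<and> x $ 2 = 0 \<and> f x = p}"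

text \<open>Positivity of the Jacobian of the transition map \<open>g' \<circ> f\<close>. The derivative is taken within
  a relatively open subset of the half plane, hence is unique also at boundary points.\<close>

definition coherently_oriented ::
  "(real^2) set \<times> (real^2 \<Rightarrow> 'a::euclidean_space) \<times> ('a \<Rightarrow> real^2) \<Rightarrow>
   (real^2) set \<times> (real^2 \<Rightarrow> 'a) \<times> ('a \<Rightarrow> real^2) \<Rightarrow> bool" where
  "coherently_oriented = (\<lambda>(V, f, g) (V', f', g').
     \<forall>x\<in>V. f x \<in> f' ` V' \<longrightarrow>
       (\<exists>L. ((g' \<circ> f) has_derivative L) (at x within {y \<in> V. f y \<in> f' ` V'}) \<and> det (matrix L) > 0))"

definition orientable :: "'a::euclidean_space set \<Rightarrow> bool" where
  "orientable F \<longleftrightarrow>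
     (\<exists>A. (\<forall>c\<in>A. local_param F c) \<and> (\<forall>p\<in>F. \<exists>(V, f, g)\<in>A. p \<in> f ` V) \<and>
          (\<forall>c\<in>A. \<forall>d\<in>A. coherently_oriented c d))"

section \<open>Betti numbers\<close>

definition int_independent :: "('a, 'b) monoid_scheme \<Rightarrow> 'a set \<Rightarrow> bool" where
  "int_independent G S \<longleftrightarrow>
     finite S \<and> S \<subseteq> carrier G \<and>
     (\<forall>c :: 'a \<Rightarrow> int. finprod G (\<lambda>x. x [^]\<^bsub>G\<^esub> c x) S = \<one>\<^bsub>G\<^esub> \<longrightarrow> (\<forall>x\<in>S. c x = 0))"

definition abelian_group_rank :: "('a, 'b) monoid_scheme \<Rightarrow> enat" where
  "abelian_group_rank G = (SUP S\<in>{S. int_independent G S}. enat (card S))"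

definition betti_number :: "nat \<Rightarrow> 'a topology \<Rightarrow> enat" where
  "betti_number p X = abelian_group_rank (homology_group (int p) X)"

section \<open>Knots and the non-orientable 4-genus\<close>

type_synonym R4 = "real^4"

abbreviation S3 :: "R4 set" where "S3 \<equiv> sphere 0 1"
abbreviation B4 :: "R4 set" where "B4 \<equiv> cball 0 1"
abbreviation S1 :: "complex set" where "S1 \<equiv> sphere 0 1"
abbreviation D2 :: "complex set" where "D2 \<equiv> cball 0 1"

definition knot :: "R4 set \<Rightarrow> bool" where
  "knot K \<longleftrightarrow> K \<subseteq> S3 \<and> (\<exists>f g. diffeomorphism S1 K f g)"

text \<open>The infimum in \<^typ>\<open>enat\<close> is a minimum when the set is nonempty, and \<open>\<infinity>\<close> otherwise.\<close>

definition nonorientable_4_genus :: "R4 set \<Rightarrow> enat" where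
  "nonorientable_4_genus K =
     Inf {betti_number 1 (top_of_set F) | F.
            F \<subseteq> B4 \<and> smooth_surface F \<and> compact F \<and> connected F \<and> \<not> orientable F \<and>
            surface_boundary F = K}"

section \<open>Twisted Whitehead doubles\<close>

text \<open>\<open>S\<^sup>1 \<times> D\<^sup>2\<close> is oriented by \<open>(\<theta>, x, y)\<close> at \<open>(cis \<theta>, x + \<i> y)\<close>, and the sphere as the
  boundary of the ball (outward normal first).\<close>

definition orientation_preserving :: "(complex \<times> complex \<Rightarrow> R4) \<Rightarrow> bool" where
  "orientation_preserving \<phi> \<longleftrightarrow>
     (\<forall>\<theta>. \<forall>w\<in>ball 0 1.
        det (vector [\<phi> (cis \<theta>, w),
                     vector_derivative (\<lambda>s. \<phi> (cis s, w)) (at \<theta>),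
                     vector_derivative (\<lambda>s. \<phi> (cis \<theta>, w + of_real s)) (at 0),
                     vector_derivative (\<lambda>s. \<phi> (cis \<theta>, w + \<i> * of_real s)) (at 0)] :: real^4^4) > 0)"

text \<open>An identification of \<open>S\<^sup>1 \<times> D\<^sup>2\<close> with a tubular neighbourhood of \<open>K\<close> realizes the Seifert
  framing if the longitude \<open>S\<^sup>1 \<times> {1}\<close> is null-homologous in the complement of \<open>K\<close>.\<close>

definition seifert_framed_nbhd :: "R4 set \<Rightarrow> (complex \<times> complex \<Rightarrow> R4) \<Rightarrow> bool" where
  "seifert_framed_nbhd K \<phi> \<longleftrightarrow>
     \<phi> ` (S1 \<times> D2) \<subseteq> S3 \<and> (\<exists>\<psi>. diffeomorphism (S1 \<times> D2) (\<phi> ` (S1 \<times> D2)) \<phi> \<psi>) \<and>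
     orientation_preserving \<phi> \<and> \<phi> ` (S1 \<times> {0}) = K \<and>
     trivial_homomorphism (homology_group 1 (top_of_set S1)) (homology_group 1 (top_of_set (S3 - K)))
       (hom_induced 1 (top_of_set S1) {} (top_of_set (S3 - K)) {} (\<lambda>z. \<phi> (z, 1)))"

text \<open>The untwisted Whitehead double pattern. Its projection to the annulus with coordinates
  \<open>(\<theta>, x)\<close> is the ellipse \<open>(4 cos s, sin s / 2)\<close> with \<open>\<theta>\<close> taken modulo \<open>2 \<pi>\<close>. Since
  \<open>\<pi> < 4 < 2 \<pi>\<close>, it consists of two parallel strands whose ends overlap at \<open>\<theta> = \<pi>\<close> in exactly
  two crossings, \<open>cos s = \<plusminus>\<pi>/4\<close>. The height \<open>y = \<epsilon> sin (2 s) / 2\<close> makes these a clasp, both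
  crossings having sign \<open>\<epsilon>\<close> for either orientation of the curve. As the two strands lie flat,
  the curve bounds the untwisted annulus plumbed with a Hopf band of core framing \<open>-\<epsilon>\<close>.\<close>

definition whitehead_pattern :: "real \<Rightarrow> (complex \<times> complex) set" where
  "whitehead_pattern \<epsilon> =
     range (\<lambda>s::real. (cis (4 * cos s), Complex (sin s / 2) (\<epsilon> * sin (2 * s) / 2)))"

text \<open>\<open>t\<close> full right-handed twists: \<open>S\<^sup>1 \<times> {1}\<close> goes to a curve with linking number \<open>t\<close> with the core.\<close>

definition full_twists :: "int \<Rightarrow> complex \<times> complex \<Rightarrow> complex \<times> complex" where
  "full_twists t = (\<lambda>(z, w). (z, z powi t * w))"

text \<open>\<open>W\<close> is a representative of the \<open>t\<close>-twisted Whitehead double of \<open>K\<close>, positive for \<open>\<epsilon> = 1\<close> and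
  negative for \<open>\<epsilon> = -1\<close>.\<close>

definition whitehead_double :: "real \<Rightarrow> int \<Rightarrow> R4 set \<Rightarrow> R4 set \<Rightarrow> bool" where
  "whitehead_double \<epsilon> t K W \<longleftrightarrow>
     (\<exists>\<phi>. seifert_framed_nbhd K \<phi> \<and> W = \<phi> ` full_twists t ` whitehead_pattern \<epsilon>)"

end

theory Submission
  imports Defs
begin

text \<open>Project the Whitehead double pattern to the annulus: two parallel strands whose ends overlap in a
clasp. The long region between the strands is a disc that touches itself at the two crossings of
the clasp. Replacing each crossing by a half-twisted band turns this region into a surface with
boundary the pattern. It is a disc with two half-twisted bands, each running once around the
annulus, so it is non-orientable with first Betti number 2 (a punctured Klein bottle). Twisting
and a tubular neighbourhood of \<open>K\<close> embed the solid torus into the 3-sphere and carry the surface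
to a surface in \<open>S3 \<subseteq> B4\<close> with boundary the Whitehead double, whatever \<open>K\<close>, \<open>t\<close> and the sign are.

A disc with two half-twisted bands is a disc blown up at two points, since blowing up replaces a
point by the circle of lines through it and hence glues in a Moebius band. This gives equations for
the surface. Let \<open>C = blowup_fun\<close>, a map from the closed unit disc to the plane with values \<open>1\<close> on the
unit circle and two zeros. The set \<open>blowup_disc\<close> consists of the pairs \<open>(\<omega>, \<zeta>)\<close> where \<open>\<omega>\<close>, a point of
the unit circle regarded as the projective line, is a line containing \<open>C \<zeta>\<close>. The map
\<open>torus_map \<epsilon>\<close> sends \<open>(\<omega>, \<zeta>)\<close> to \<open>(\<omega> cis (4 \<eta>), \<xi>/2 + \<i> \<epsilon> \<xi> \<eta>)\<close> with \<open>\<zeta> = \<xi> + \<i> \<eta>\<close>. On the boundary,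
where \<open>\<omega> = 1\<close> and \<open>\<zeta> = sin s + \<i> cos s\<close>, this is the parametrization of the pattern.

Four facts remain. The blown-up disc is a smooth surface whose boundary lies over the unit circle
(\<open>smooth_surface_blowup_disc\<close>, \<open>surface_boundary_blowup_disc\<close>): away from the two exceptional circles
it is a graph over the disc, and near them there are the two classical charts of a blow-up, by a
slope and by its reciprocal. It is not orientable (\<open>not_orientable_blowup_disc\<close>), because the
transition between these two charts has a Jacobian of both signs. Its first Betti number is at most
2 (\<open>betti_number_blowup_disc\<close>): cutting it along two arcs leaves a contractible set, and by excision
each band that is glued back adds at most one generator to the first homology
(\<open>homology_group_attach_band\<close>). Finally \<open>torus_map \<epsilon>\<close> is a diffeomorphism onto its image
(\<open>torus_map_diffeomorphism\<close>). The only danger is the vertical diameter of the disc, which is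
squeezed onto the core of the solid torus. The function \<open>C\<close> is chosen so that the first coordinate
of \<open>torus_map \<epsilon>\<close> turns monotonically along this diameter, by less than a full turn.\<close>

section \<open>Calculus of smooth maps\<close>

lemma frechet_derivative_cong_open:
  assumes "open U" "x \<in> U" "\<And>y. y \<in> U \<Longrightarrow> f y = g y"
  shows "frechet_derivative f (at x) = frechet_derivative g (at x)"
proof -
  have "(f has_derivative D) (at x) \<longleftrightarrow> (g has_derivative D) (at x)" for D
    using assms has_derivative_transform_within_open[of f D x UNIV U g]
      has_derivative_transform_within_open[of g D x UNIV U f] by auto
  then show ?thesis unfolding frechet_derivative_def by simp
qed

lemma C_k_on_cong:
  assumes "open U" "\<And>x. x \<in> U \<Longrightarrow> f x = g x" "C_k_on n U f"
  shows "C_k_on n U g"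
  using assms
proof (induction n arbitrary: f g)
  case 0
  then show ?case by (simp cong: continuous_on_cong)
next
  case (Suc n)
  have "frechet_derivative f (at x) = frechet_derivative g (at x)" if "x \<in> U" for x
    using frechet_derivative_cong_open Suc.prems that by blast
  then have "C_k_on n U (\<lambda>x. frechet_derivative g (at x) v)" for v
    using Suc.IH[of "\<lambda>x. frechet_derivative f (at x) v" "\<lambda>x. frechet_derivative g (at x) v"] Suc.prems
    by auto
  moreover have "g differentiable_on U"
    unfolding differentiable_on_def
  proof
    fix x assume x: "x \<in> U"
    then obtain D where "(f has_derivative D) (at x)"
      using Suc.prems(3) by (auto simp: differentiable_on_def differentiable_def at_within_open[OF x Suc.prems(1)])
    then have "(g has_derivative D) (at x)"
      using has_derivative_transform_within_open[OF _ Suc.prems(1) x] Suc.prems(2) by blast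
    then show "g differentiable (at x within U)"
      using differentiableI differentiable_at_withinI by blast
  qed
  ultimately show ?case by simp
qed

lemma C_k_on_SucI:
  assumes "open U" "\<And>x. x \<in> U \<Longrightarrow> (f has_derivative f' x) (at x)" "\<And>v. C_k_on n U (\<lambda>x. f' x v)"
  shows "C_k_on (Suc n) U f"
proof -
  have "f differentiable_on U"
    using assms differentiableI differentiable_at_imp_differentiable_on by blast
  moreover have "C_k_on n U (\<lambda>x. frechet_derivative f (at x) v)" for v
    by (rule C_k_on_cong[OF assms(1) _ assms(3)[of v]]) (use frechet_derivative_at assms(2) in metis)
  ultimately show ?thesis by simp
qed

lemma C_k_on_Suc_derivative:
  assumes "open U" "C_k_on (Suc n) U f" "x \<in> U"
  shows "(f has_derivative frechet_derivative f (at x)) (at x)"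
  using assms by (auto simp: differentiable_on_def at_within_open[OF assms(3,1)] frechet_derivative_works[symmetric])

lemma C_k_on_SucD: "C_k_on (Suc n) U f \<Longrightarrow> C_k_on n U f"
proof (induction n arbitrary: f)
  case 0
  then show ?case by (simp add: differentiable_imp_continuous_on)
next
  case (Suc n)
  then have "C_k_on n U (\<lambda>x. frechet_derivative f (at x) v)" for v
    by (metis C_k_on.simps(2))
  then show ?case using Suc.prems by simp
qed

lemma C_k_on_subset: "C_k_on n U f \<Longrightarrow> V \<subseteq> U \<Longrightarrow> C_k_on n V f"
  by (induction n arbitrary: f) (auto intro: continuous_on_subset differentiable_on_subset)

lemma C_k_on_const: "open U \<Longrightarrow> C_k_on n U (\<lambda>x. c)"
  by (induction n arbitrary: c) (auto simp del: C_k_on.simps(2) intro: C_k_on_SucI[where f' = "\<lambda>x v. 0"])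

lemma C_k_on_bounded_linear:
  assumes "open U" "bounded_linear f"
  shows "C_k_on n U f"
proof (cases n)
  case 0
  then show ?thesis using assms by (simp add: bounded_linear.linear linear_continuous_on)
next
  case (Suc m)
  then show ?thesis using assms
    by (simp del: C_k_on.simps(2), intro C_k_on_SucI[where f' = "\<lambda>x. f"])
      (auto intro: C_k_on_const bounded_linear_imp_has_derivative)
qed

lemma C_k_on_add:
  assumes "open U" "C_k_on n U f" "C_k_on n U g"
  shows "C_k_on n U (\<lambda>x. f x + g x)"
  using assms(2,3)
proof (induction n arbitrary: f g)
  case 0
  then show ?case by (simp add: continuous_on_add)
next
  case (Suc n)
  show ?case
  proof (rule C_k_on_SucI[OF assms(1)])
    show "((\<lambda>x. f x + g x) has_derivative (\<lambda>v. frechet_derivative f (at x) v + frechet_derivative g (at x) v)) (at x)"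
      if "x \<in> U" for x
      using C_k_on_Suc_derivative[OF assms(1) Suc.prems(1) that] C_k_on_Suc_derivative[OF assms(1) Suc.prems(2) that]
      by (rule has_derivative_add)
    show "C_k_on n U (\<lambda>x. frechet_derivative f (at x) v + frechet_derivative g (at x) v)" for v
      using Suc.IH Suc.prems by simp
  qed
qed

lemma C_k_on_bilinear:
  assumes "open U" "bounded_bilinear h" "C_k_on n U f" "C_k_on n U g"
  shows "C_k_on n U (\<lambda>x. h (f x) (g x))"
  using assms(3,4)
proof (induction n arbitrary: f g)
  case 0
  then show ?case using bounded_bilinear.continuous_on[OF assms(2)] by simp
next
  case (Suc n)
  show ?case
  proof (rule C_k_on_SucI[OF assms(1)])
    show "((\<lambda>x. h (f x) (g x)) has_derivative
        (\<lambda>v. h (f x) (frechet_derivative g (at x) v) + h (frechet_derivative f (at x) v) (g x))) (at x)"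
      if "x \<in> U" for x
      using bounded_bilinear.FDERIV[OF assms(2) C_k_on_Suc_derivative[OF assms(1) Suc.prems(1) that]
          C_k_on_Suc_derivative[OF assms(1) Suc.prems(2) that]] .
    show "C_k_on n U (\<lambda>x. h (f x) (frechet_derivative g (at x) v) + h (frechet_derivative f (at x) v) (g x))" for v
      using Suc.IH[of f] Suc.IH[of _ g] C_k_on_SucD[OF Suc.prems(1)] C_k_on_SucD[OF Suc.prems(2)] Suc.prems
      by (intro C_k_on_add assms(1)) auto
  qed
qed

lemma C_k_on_sum:
  assumes "open U" "\<And>i. i \<in> I \<Longrightarrow> C_k_on n U (f i)"
  shows "C_k_on n U (\<lambda>x. \<Sum>i\<in>I. f i x)"
  using assms(2)
  by (induction I rule: infinite_finite_induct) (auto simp: assms(1) C_k_on_const C_k_on_add)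

text \<open>In an orthonormal basis the chain rule expresses the derivative of \<open>g \<circ> f\<close> as a sum of products of
  components of the derivative of \<open>f\<close> with functions \<open>(\<lambda>y. g' y b) \<circ> f\<close>. The latter fall under the
  induction hypothesis, so the order of differentiability can be raised one step at a time.\<close>

lemma C_k_on_compose:
  fixes f :: "'a::euclidean_space \<Rightarrow> 'b::euclidean_space" and g :: "'b \<Rightarrow> 'c::euclidean_space"
  assumes "open U" "open V" "f ` U \<subseteq> V" "C_k_on n U f" "C_k_on n V g"
  shows "C_k_on n U (\<lambda>x. g (f x))"
  using assms(4,5)
proof (induction n arbitrary: g)
  case 0
  then show ?case using continuous_on_compose2[OF _ _ assms(3)] by simp
next
  case (Suc n)
  let ?df = "\<lambda>x. frechet_derivative f (at x)" and ?dg = "\<lambda>y. frechet_derivative g (at y)"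
  have der: "((\<lambda>x. g (f x)) has_derivative (\<lambda>v. ?dg (f x) (?df x v))) (at x)" if "x \<in> U" for x
  proof -
    have "f x \<in> V" using that assms(3) by auto
    then show ?thesis
      using diff_chain_at[OF C_k_on_Suc_derivative[OF assms(1) Suc.prems(1) that]
          C_k_on_Suc_derivative[OF assms(2) Suc.prems(2)]] by (simp add: o_def)
  qed
  have eq: "?dg (f x) (?df x v) = (\<Sum>b\<in>Basis. (?df x v \<bullet> b) *\<^sub>R ?dg (f x) b)" if "x \<in> U" for x v
  proof -
    have "f x \<in> V" using that assms(3) by auto
    then have "linear (?dg (f x))"
      using C_k_on_Suc_derivative[OF assms(2) Suc.prems(2)] has_derivative_bounded_linear bounded_linear.linear by blast
    then show ?thesis
      using linear_sum[of "?dg (f x)" "\<lambda>b. (?df x v \<bullet> b) *\<^sub>R b" Basis]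
      by (simp add: euclidean_representation linear_scale)
  qed
  show ?case
  proof (rule C_k_on_SucI[OF assms(1) der])
    fix v
    have "C_k_on n U (\<lambda>x. (\<Sum>b\<in>Basis. (?df x v \<bullet> b) *\<^sub>R ?dg (f x) b))"
    proof (intro C_k_on_sum assms(1) C_k_on_bilinear[OF assms(1) bounded_bilinear_scaleR])
      fix b :: 'b
      show "C_k_on n U (\<lambda>x. ?df x v \<bullet> b)"
        by (intro C_k_on_bilinear[OF assms(1) bounded_bilinear_inner] C_k_on_const assms(1)) (use Suc.prems in auto)
      show "C_k_on n U (\<lambda>x. ?dg (f x) b)"
        by (rule Suc.IH) (use Suc.prems C_k_on_SucD in auto)
    qed
    then show "C_k_on n U (\<lambda>x. ?dg (f x) (?df x v))"
      by (rule C_k_on_cong[OF assms(1), rotated]) (simp add: eq)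
  qed
qed

text \<open>Differentiability is a local property; this reconciles \<open>smooth_on\<close>, defined by local extensions,
  with \<open>C_k_on\<close> on open sets.\<close>

lemma C_k_on_local:
  assumes "\<And>x. x \<in> U \<Longrightarrow> \<exists>N. open N \<and> x \<in> N \<and> C_k_on n N f"
  shows "C_k_on n U f"
  using assms
proof (induction n arbitrary: f)
  case 0
  have "continuous (at x) f" if "x \<in> U" for x
    using 0[OF that] continuous_on_eq_continuous_at by auto
  then show ?case
    by (simp add: continuous_on_eq_continuous_within continuous_at_imp_continuous_at_within)
next
  case (Suc n)
  have "f differentiable_on U"
    unfolding differentiable_on_def
  proof
    fix x assume "x \<in> U"
    then obtain N where "open N" "x \<in> N" "f differentiable_on N" using Suc.prems by auto
    then show "f differentiable (at x within U)"
      by (metis at_within_open differentiable_at_withinI differentiable_on_def)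
  qed
  moreover have "C_k_on n U (\<lambda>x. frechet_derivative f (at x) v)" for v
    by (rule Suc.IH) (use Suc.prems in auto)
  ultimately show ?case by simp
qed

lemma smooth_on_open_iff:
  assumes "open U"
  shows "smooth_on U f \<longleftrightarrow> (\<forall>n. C_k_on n U f)"
proof
  assume f: "smooth_on U f"
  show "\<forall>n. C_k_on n U f"
  proof
    fix n
    show "C_k_on n U f"
    proof (rule C_k_on_local)
      fix x assume "x \<in> U"
      then obtain N g where N: "open N" "x \<in> N" "\<forall>n. C_k_on n N g" "\<forall>y\<in>U \<inter> N. g y = f y"
        using f unfolding smooth_on_def by meson
      then have "C_k_on n (U \<inter> N) f"
        using assms by (intro C_k_on_cong[of "U \<inter> N" g f]) (auto intro: C_k_on_subset)
      then show "\<exists>N. open N \<and> x \<in> N \<and> C_k_on n N f"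
        using assms N \<open>x \<in> U\<close> by (intro exI[of _ "U \<inter> N"]) auto
    qed
  qed
qed (use assms in \<open>auto simp: smooth_on_def\<close>)

lemma smooth_on_subset: "smooth_on S f \<Longrightarrow> T \<subseteq> S \<Longrightarrow> smooth_on T f"
  unfolding smooth_on_def
proof
  fix x assume S: "\<forall>x\<in>S. \<exists>U g. open U \<and> x \<in> U \<and> (\<forall>n. C_k_on n U g) \<and> (\<forall>y\<in>S \<inter> U. g y = f y)"
    and T: "T \<subseteq> S" "x \<in> T"
  from bspec[OF S subsetD[OF T]] obtain U g
    where "open U" "x \<in> U" "\<forall>n. C_k_on n U g" "\<forall>y\<in>S \<inter> U. g y = f y"
    by (elim exE conjE)
  then show "\<exists>U g. open U \<and> x \<in> U \<and> (\<forall>n. C_k_on n U g) \<and> (\<forall>y\<in>T \<inter> U. g y = f y)"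
    using T by (intro exI[of _ U] exI[of _ g]) auto
qed

lemma smooth_on_cong: "(\<And>x. x \<in> S \<Longrightarrow> f x = g x) \<Longrightarrow> smooth_on S f \<longleftrightarrow> smooth_on S g"
  unfolding smooth_on_def by simp

lemma smooth_on_extend:
  assumes "smooth_on S f" "x \<in> S"
  shows "\<exists>U g. open U \<and> x \<in> U \<and> smooth_on U g \<and> (\<forall>y\<in>S \<inter> U. g y = f y)"
proof -
  from bspec[OF assms(1)[unfolded smooth_on_def] assms(2)] obtain U g
    where "open U" "x \<in> U" "\<forall>n. C_k_on n U g" "\<forall>y\<in>S \<inter> U. g y = f y"
    by (elim exE conjE)
  then show ?thesis using smooth_on_open_iff[of U g] by (intro exI[of _ U] exI[of _ g]) auto
qed

lemma smooth_on_local: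
  assumes "\<And>x. x \<in> S \<Longrightarrow> \<exists>U g. open U \<and> x \<in> U \<and> smooth_on U g \<and> (\<forall>y\<in>S \<inter> U. g y = f y)"
  shows "smooth_on S f"
  unfolding smooth_on_def[of S]
proof
  fix x assume "x \<in> S"
  from assms[OF this] obtain U g
    where "open U" "x \<in> U" "smooth_on U g" "\<forall>y\<in>S \<inter> U. g y = f y" by (elim exE conjE)
  then show "\<exists>U g. open U \<and> x \<in> U \<and> (\<forall>n. C_k_on n U g) \<and> (\<forall>y\<in>S \<inter> U. g y = f y)"
    using smooth_on_open_iff by (intro exI[of _ U] exI[of _ g]) auto
qed

lemma smooth_on_compose:
  fixes f :: "'a::euclidean_space \<Rightarrow> 'b::euclidean_space" and g :: "'b \<Rightarrow> 'c::euclidean_space"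
  assumes "smooth_on T g" "smooth_on S f" "f ` S \<subseteq> T"
  shows "smooth_on S (\<lambda>x. g (f x))"
proof (rule smooth_on_local)
  fix x assume x: "x \<in> S"
  from smooth_on_extend[OF assms(2) x] obtain U f' where U: "open U" "x \<in> U" "smooth_on U f'" "\<forall>y\<in>S \<inter> U. f' y = f y"
    by (elim exE conjE)
  have fx: "f x \<in> T" using x assms(3) by auto
  from smooth_on_extend[OF assms(1) fx] obtain V g' where V: "open V" "f x \<in> V" "smooth_on V g'" "\<forall>y\<in>T \<inter> V. g' y = g y"
    by (elim exE conjE)
  define W where "W = U \<inter> f' -` V"
  have "continuous_on U f'" using U(1,3) smooth_on_open_iff C_k_on.simps(1) by metis
  then have "open W" unfolding W_def using continuous_open_preimage[OF _ U(1) V(1)] by simp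
  moreover have "smooth_on W (\<lambda>x. g' (f' x))"
    unfolding smooth_on_open_iff[OF \<open>open W\<close>]
  proof
    fix n
    have C: "C_k_on n U f'" "C_k_on n V g'"
      using U(1,3) V(1,3) by (simp_all add: smooth_on_open_iff)
    have W: "W \<subseteq> U" "f' ` W \<subseteq> V" by (auto simp: W_def)
    show "C_k_on n W (\<lambda>x. g' (f' x))"
      by (rule C_k_on_compose[OF \<open>open W\<close> V(1) W(2) C_k_on_subset[OF C(1) W(1)] C(2)])
  qed
  ultimately show "\<exists>U h. open U \<and> x \<in> U \<and> smooth_on U h \<and> (\<forall>y\<in>S \<inter> U. h y = g (f y))"
    using U V x assms(3) by (intro exI[of _ W] exI[of _ "\<lambda>x. g' (f' x)"]) (auto simp: W_def)
qed

lemma smooth_on_continuous: "smooth_on S f \<Longrightarrow> continuous_on S f"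
  unfolding continuous_on_eq_continuous_within
proof
  fix x assume f: "smooth_on S f" and x: "x \<in> S"
  from smooth_on_extend[OF f x] obtain U g where U: "open U" "x \<in> U" "smooth_on U g" "\<forall>y\<in>S \<inter> U. g y = f y"
    by (elim exE conjE)
  have "continuous_on U g" using U(1,3) smooth_on_open_iff C_k_on.simps(1) by metis
  then have "continuous (at x within S) g"
    using U continuous_on_eq_continuous_at continuous_at_imp_continuous_at_within by blast
  moreover have "\<forall>\<^sub>F y in at x within S. g y = f y"
    using U by (auto simp: eventually_at_topological intro!: exI[of _ U])
  moreover have "g x = f x" using U x by auto
  ultimately show "continuous (at x within S) f"
    unfolding continuous_within by (simp add: tendsto_cong)
qed

text \<open>Two local extensions can be combined on the intersection of their domains, so any operation that
  preserves finite differentiability on open sets preserves smoothness on arbitrary sets.\<close>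

lemma smooth_on_binary:
  fixes h :: "'b::euclidean_space \<Rightarrow> 'c::euclidean_space \<Rightarrow> 'd::euclidean_space" and S :: "'a::euclidean_space set"
  assumes "smooth_on S f" "smooth_on S g"
    and h: "\<And>(U :: 'a set) n f g. open U \<Longrightarrow> C_k_on n U f \<Longrightarrow> C_k_on n U g \<Longrightarrow> C_k_on n U (\<lambda>x. h (f x) (g x))"
  shows "smooth_on S (\<lambda>x. h (f x) (g x))"
proof (rule smooth_on_local)
  fix x assume x: "x \<in> S"
  from smooth_on_extend[OF assms(1) x] obtain U f' where U: "open U" "x \<in> U" "smooth_on U f'" "\<forall>y\<in>S \<inter> U. f' y = f y"
    by (elim exE conjE)
  from smooth_on_extend[OF assms(2) x] obtain V g' where V: "open V" "x \<in> V" "smooth_on V g'" "\<forall>y\<in>S \<inter> V. g' y = g y"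
    by (elim exE conjE)
  have "smooth_on (U \<inter> V) (\<lambda>x. h (f' x) (g' x))"
    unfolding smooth_on_open_iff[OF open_Int[OF U(1) V(1)]]
  proof
    fix n
    have C: "C_k_on n U f'" "C_k_on n V g'"
      using U(1,3) V(1,3) by (simp_all add: smooth_on_open_iff)
    show "C_k_on n (U \<inter> V) (\<lambda>x. h (f' x) (g' x))"
      by (rule h[OF open_Int[OF U(1) V(1)] C_k_on_subset[OF C(1)] C_k_on_subset[OF C(2)]]) simp_all
  qed
  then show "\<exists>U k. open U \<and> x \<in> U \<and> smooth_on U k \<and> (\<forall>y\<in>S \<inter> U. k y = h (f y) (g y))"
    using U V by (intro exI[of _ "U \<inter> V"] exI[of _ "\<lambda>x. h (f' x) (g' x)"]) auto
qed

lemma smooth_on_bounded_linear: "bounded_linear f \<Longrightarrow> smooth_on S f"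
  by (rule smooth_on_subset[of UNIV]) (auto simp: smooth_on_open_iff C_k_on_bounded_linear)

lemma smooth_on_const: "smooth_on S (\<lambda>x. c)"
  by (rule smooth_on_subset[of UNIV]) (auto simp: smooth_on_open_iff C_k_on_const)

lemma smooth_on_linear_compose:
  "bounded_linear L \<Longrightarrow> smooth_on S f \<Longrightarrow> smooth_on S (\<lambda>x. L (f x))"
  by (rule smooth_on_compose[of UNIV]) (auto intro: smooth_on_bounded_linear)

lemma smooth_on_bilinear:
  fixes h :: "'b::euclidean_space \<Rightarrow> 'c::euclidean_space \<Rightarrow> 'd::euclidean_space"
  shows "bounded_bilinear h \<Longrightarrow> smooth_on S f \<Longrightarrow> smooth_on S g \<Longrightarrow> smooth_on S (\<lambda>x. h (f x) (g x))"
  by (rule smooth_on_binary) (auto intro: C_k_on_bilinear)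

lemma smooth_on_add: "smooth_on S f \<Longrightarrow> smooth_on S g \<Longrightarrow> smooth_on S (\<lambda>x. f x + g x)"
  by (rule smooth_on_binary) (auto intro: C_k_on_add)

lemma smooth_on_minus: "smooth_on S f \<Longrightarrow> smooth_on S (\<lambda>x. - f x)"
  by (rule smooth_on_linear_compose[OF bounded_linear_minus[OF bounded_linear_ident]])

lemma smooth_on_diff: "smooth_on S f \<Longrightarrow> smooth_on S g \<Longrightarrow> smooth_on S (\<lambda>x. f x - g x)"
  using smooth_on_add[of S f "\<lambda>x. - g x"] smooth_on_minus[of S g] by simp

lemma smooth_on_Pair:
  assumes "smooth_on S f" "smooth_on S g"
  shows "smooth_on S (\<lambda>x. (f x, g x))"
proof -
  have "bounded_linear (\<lambda>x. (x, 0))" "bounded_linear (\<lambda>x. (0, x))"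
    by (auto intro: bounded_linear_Pair bounded_linear_ident bounded_linear_zero)
  then have "smooth_on S (\<lambda>x. (f x, 0) + (0, g x))"
    by (intro smooth_on_add) (auto intro: smooth_on_linear_compose assms)
  then show ?thesis by simp
qed

lemma smooth_on_mult:
  fixes f g :: "'a::euclidean_space \<Rightarrow> 'b::{euclidean_space, real_normed_algebra}"
  shows "smooth_on S f \<Longrightarrow> smooth_on S g \<Longrightarrow> smooth_on S (\<lambda>x. f x * g x)"
  by (rule smooth_on_bilinear[OF bounded_bilinear_mult])

lemma smooth_on_scaleR: "smooth_on S f \<Longrightarrow> smooth_on S g \<Longrightarrow> smooth_on S (\<lambda>x. f x *\<^sub>R g x)"
  by (rule smooth_on_bilinear[OF bounded_bilinear_scaleR])

lemma smooth_on_power: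
  fixes f :: "'a::euclidean_space \<Rightarrow> 'b::{euclidean_space, real_normed_algebra_1}"
  shows "smooth_on S f \<Longrightarrow> smooth_on S (\<lambda>x. f x ^ n)"
  by (induction n) (auto intro: smooth_on_const smooth_on_mult)

lemmas smooth_on_id = smooth_on_bounded_linear[OF bounded_linear_ident]
lemmas smooth_on_fst = smooth_on_linear_compose[OF bounded_linear_fst]
lemmas smooth_on_snd = smooth_on_linear_compose[OF bounded_linear_snd]
lemmas smooth_on_Re = smooth_on_linear_compose[OF bounded_linear_Re]
lemmas smooth_on_Im = smooth_on_linear_compose[OF bounded_linear_Im]
lemmas smooth_on_cnj = smooth_on_linear_compose[OF bounded_linear_cnj]
lemmas smooth_on_of_real = smooth_on_linear_compose[OF bounded_linear_of_real]
lemmas smooth_on_nth = smooth_on_linear_compose[OF bounded_linear_vec_nth]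

lemma C_k_on_real_SucI:
  fixes f :: "real \<Rightarrow> real"
  assumes "open U" "\<And>x. x \<in> U \<Longrightarrow> (f has_real_derivative f' x) (at x)" "C_k_on n U f'"
  shows "C_k_on (Suc n) U f"
  by (rule C_k_on_SucI[OF assms(1)], rule has_field_derivative_imp_has_derivative[OF assms(2)])
    (auto intro!: C_k_on_bilinear[OF assms(1) bounded_bilinear_mult] assms C_k_on_const)

lemma smooth_on_real_inverse: "smooth_on (- {0}) (inverse :: real \<Rightarrow> real)"
proof -
  have op: "open (- {0::real})" by auto
  have "C_k_on n (- {0}) (inverse :: real \<Rightarrow> real)" for n
  proof (induction n)
    case 0
    then show ?case by (auto intro!: continuous_intros)
  next
    case (Suc n)
    show ?case
    proof (rule C_k_on_real_SucI[OF op])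
      show "(inverse has_real_derivative (-1) * (inverse x * inverse x)) (at x)" if "x \<in> - {0}" for x :: real
        using DERIV_inverse[of x UNIV] that by (simp add: power2_eq_square)
    qed (intro C_k_on_bilinear[OF op bounded_bilinear_mult] Suc C_k_on_const op)
  qed
  then show ?thesis using smooth_on_open_iff[OF op] by blast
qed

lemma smooth_on_real_sqrt: "smooth_on {0<..} sqrt"
proof -
  have op: "open {0::real<..}" by auto
  have "C_k_on n {0<..} sqrt" for n
  proof (induction n)
    case 0
    then show ?case by (auto intro!: continuous_intros)
  next
    case (Suc n)
    show ?case
    proof (rule C_k_on_real_SucI[OF op])
      show "(sqrt has_real_derivative inverse (sqrt x) * (1 / 2)) (at x)" if "x \<in> {0<..}" for x
        using DERIV_real_sqrt[of x] that by simp
      have "C_k_on n {0<..} (\<lambda>x. inverse (sqrt x))"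
        by (rule C_k_on_compose[OF op _ _ Suc, of "- {0}"])
          (use smooth_on_real_inverse smooth_on_open_iff[of "- {0::real}"] in auto)
      then show "C_k_on n {0<..} (\<lambda>x. inverse (sqrt x) * (1 / 2))"
        by (intro C_k_on_bilinear[OF op bounded_bilinear_mult] C_k_on_const op)
    qed
  qed
  then show ?thesis using smooth_on_open_iff[OF op] by blast
qed

lemma C_k_on_sin_cos: "C_k_on n UNIV (sin :: real \<Rightarrow> real) \<and> C_k_on n UNIV (cos :: real \<Rightarrow> real)"
proof (induction n)
  case 0
  then show ?case by (auto intro!: continuous_intros)
next
  case (Suc n)
  then have "C_k_on n UNIV (\<lambda>x::real. (-1) * sin x)"
    by (intro C_k_on_bilinear[OF open_UNIV bounded_bilinear_mult] C_k_on_const) auto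
  with Suc show ?case
    by (auto simp del: C_k_on.simps(2) intro: C_k_on_real_SucI[where f' = cos] C_k_on_real_SucI[where f' = "\<lambda>x. (-1) * sin x"]
        intro!: derivative_eq_intros)
qed

lemma smooth_on_inverse:
  "smooth_on S f \<Longrightarrow> (\<And>x. x \<in> S \<Longrightarrow> f x \<noteq> 0) \<Longrightarrow> smooth_on S (\<lambda>x. inverse (f x :: real))"
  by (rule smooth_on_compose[OF smooth_on_real_inverse]) auto

lemma smooth_on_divide:
  "smooth_on S f \<Longrightarrow> smooth_on S g \<Longrightarrow> (\<And>x. x \<in> S \<Longrightarrow> g x \<noteq> 0) \<Longrightarrow> smooth_on S (\<lambda>x. f x / g x :: real)"
  unfolding divide_inverse by (intro smooth_on_mult smooth_on_inverse)

lemma smooth_on_sqrt: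
  "smooth_on S f \<Longrightarrow> (\<And>x. x \<in> S \<Longrightarrow> f x > 0) \<Longrightarrow> smooth_on S (\<lambda>x. sqrt (f x))"
  by (rule smooth_on_compose[OF smooth_on_real_sqrt]) auto

lemma smooth_on_sin: "smooth_on S f \<Longrightarrow> smooth_on S (\<lambda>x. sin (f x :: real))"
  and smooth_on_cos: "smooth_on S f \<Longrightarrow> smooth_on S (\<lambda>x. cos (f x :: real))"
  by (rule smooth_on_compose[of UNIV]; simp add: smooth_on_open_iff C_k_on_sin_cos)+

lemma smooth_on_Complex:
  assumes "smooth_on S f" "smooth_on S g"
  shows "smooth_on S (\<lambda>x. Complex (f x) (g x))"
  unfolding Complex_eq by (intro smooth_on_add smooth_on_mult smooth_on_of_real smooth_on_const assms)

lemma smooth_on_cis: "smooth_on S f \<Longrightarrow> smooth_on S (\<lambda>x. cis (f x))"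
  unfolding cis.code by (intro smooth_on_Complex smooth_on_sin smooth_on_cos)

lemma smooth_on_vector2:
  assumes "smooth_on S f" "smooth_on S g"
  shows "smooth_on S (\<lambda>x. vector [f x, g x] :: real^2)"
proof -
  have eq: "vector [a, b] = a *\<^sub>R axis 1 1 + b *\<^sub>R (axis 2 1 :: real^2)" for a b :: real
    by (simp add: vec_eq_iff forall_2 axis_def)
  show ?thesis unfolding eq
    by (intro smooth_on_add smooth_on_scaleR smooth_on_const assms)
qed

lemmas smooth_on_intros = smooth_on_const smooth_on_add smooth_on_minus smooth_on_diff smooth_on_Pair
  smooth_on_mult smooth_on_scaleR smooth_on_power smooth_on_id smooth_on_fst smooth_on_snd smooth_on_Re smooth_on_Im
  smooth_on_cnj smooth_on_of_real smooth_on_nth smooth_on_inverse smooth_on_divide smooth_on_sqrt smooth_on_sin smooth_on_cos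
  smooth_on_Complex smooth_on_cis smooth_on_vector2

lemma smooth_on_imp_has_derivative:
  assumes "open U" "smooth_on U f" "x \<in> U"
  shows "(f has_derivative frechet_derivative f (at x)) (at x)"
  using assms smooth_on_open_iff C_k_on_Suc_derivative by metis

lemma smooth_on_frechet_derivative:
  assumes "open U" "smooth_on U f"
  shows "smooth_on U (\<lambda>x. frechet_derivative f (at x) v)"
  unfolding smooth_on_open_iff[OF assms(1)]
proof
  fix n
  have "C_k_on (Suc n) U f" using assms smooth_on_open_iff by blast
  then show "C_k_on n U (\<lambda>x. frechet_derivative f (at x) v)" by simp
qed

text \<open>The inverse function theorem for \<open>(x, y) \<mapsto> (x, T (x, y))\<close>, with a smooth inverse: the coordinate
  \<open>y\<close> is locally a smooth function \<open>h\<close> of \<open>x\<close> and \<open>T\<close>.\<close>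

lemma smooth_on_implicit_coordinate:
  fixes T :: "real \<times> real \<Rightarrow> real"
  assumes U: "open U" "smooth_on U T" "p \<in> U" and nz: "frechet_derivative T (at p) (0, 1) \<noteq> 0"
  obtains N V h where "open N" "p \<in> N" "N \<subseteq> U" "open V" "smooth_on V h"
    "\<And>q. q \<in> N \<Longrightarrow> (fst q, T q) \<in> V \<and> h (fst q, T q) = snd q"
proof -
  define \<Psi> where "\<Psi> q = (fst q, T q)" for q
  define a where "a q = frechet_derivative T (at q) (1, 0)" for q
  define b where "b q = frechet_derivative T (at q) (0, 1)" for q
  have sab: "smooth_on U a" "smooth_on U b"
    unfolding a_def b_def by (rule smooth_on_frechet_derivative[OF U(1,2)])+
  have dT: "(T has_derivative (\<lambda>v. fst v * a q + snd v * b q)) (at q)" if "q \<in> U" for q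
  proof -
    note d = smooth_on_imp_has_derivative[OF U(1,2) that]
    have "frechet_derivative T (at q) v = fst v * a q + snd v * b q" for v
    proof -
      have "v = fst v *\<^sub>R (1, 0) + snd v *\<^sub>R (0, 1)" by (simp add: prod_eq_iff)
      then show ?thesis
        using linear_add[OF has_derivative_linear[OF d]] linear_scale[OF has_derivative_linear[OF d]]
        unfolding a_def b_def by (metis real_scaleR_def)
    qed
    then have "frechet_derivative T (at q) = (\<lambda>v. fst v * a q + snd v * b q)" by auto
    then show ?thesis using d by simp
  qed
  define D where "D q v = (fst v, fst v * a q + snd v * b q)" for q v
  have blD: "bounded_linear (D q)" for q
    unfolding D_def by (intro bounded_linear_Pair bounded_linear_add bounded_linear_fst
        bounded_linear_mult_const bounded_linear_snd)
  have d\<Psi>: "(\<Psi> has_derivative D q) (at q)" if "q \<in> U" for q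
    unfolding \<Psi>_def D_def
    by (intro has_derivative_Pair bounded_linear_imp_has_derivative bounded_linear_fst dT that)
  define f' where "f' q = Blinfun (D q)" for q
  have f': "blinfun_apply (f' q) = D q" for q
    unfolding f'_def by (rule bounded_linear_Blinfun_apply[OF blD])
  have cf: "continuous_on U f'"
  proof (rule continuous_on_blinfun_componentwise)
    fix i :: "real \<times> real"
    show "continuous_on U (\<lambda>q. blinfun_apply (f' q) i)"
      unfolding f' D_def using sab[THEN smooth_on_continuous] by (intro continuous_intros)
  qed
  define E where "E v = (fst v, (snd v - fst v * a p) / b p)" for v
  have blE: "bounded_linear E"
    unfolding E_def by (intro bounded_linear_Pair bounded_linear_sub bounded_linear_fst
        bounded_linear_mult_const bounded_linear_snd bounded_linear_divide[THEN bounded_linear_compose])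
  have E: "blinfun_apply (Blinfun E) = E" by (rule bounded_linear_Blinfun_apply[OF blE])
  have "Blinfun E o\<^sub>L f' p = id_blinfun"
    by (rule blinfun_eqI) (use nz in \<open>auto simp: E f' E_def D_def b_def prod_eq_iff\<close>)
  moreover have "\<And>x. x \<in> U \<Longrightarrow> (\<Psi> has_derivative blinfun_apply (f' x)) (at x)"
    using d\<Psi> by (simp add: f')
  ultimately obtain N V g g' where N: "open N" "N \<subseteq> U" "p \<in> N" "open V" "homeomorphism N V \<Psi> g"
    and g: "\<And>y. y \<in> V \<Longrightarrow> (g has_derivative (g' y)) (at y)"
      "\<And>y. y \<in> V \<Longrightarrow> g' y = inv_into UNIV (blinfun_apply (f' (g y)))"
      "\<And>y. y \<in> V \<Longrightarrow> bij (blinfun_apply (f' (g y)))"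
    using inverse_function_theorem[OF U(1) _ cf U(3), of \<Psi> "Blinfun E"] by metis
  have gN: "g y \<in> N" "\<Psi> (g y) = y" if "y \<in> V" for y
    using N(5) that by (auto simp: homeomorphism_def)
  then have fg: "fst (g y) = fst y" if "y \<in> V" for y
    using that unfolding \<Psi>_def by (metis fst_conv)
  have bg: "b (g y) \<noteq> 0" if "y \<in> V" for y
  proof
    assume "b (g y) = 0"
    then have "D (g y) (0, 1) = D (g y) (0, 0)" by (simp add: D_def)
    then show False using g(3)[OF that] unfolding f' by (metis bij_pointE prod.inject zero_neq_one)
  qed
  define h where "h = snd \<circ> g"
  have dh: "(h has_derivative (\<lambda>v. (snd v - fst v * a (g y)) / b (g y))) (at y)" if "y \<in> V" for y
  proof -
    have "g' y = (\<lambda>v. (fst v, (snd v - fst v * a (g y)) / b (g y)))"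
      unfolding g(2)[OF that] f'
    proof (rule inv_equality)
      show "(fst (D (g y) x), (snd (D (g y) x) - fst (D (g y) x) * a (g y)) / b (g y)) = x" for x
        using bg[OF that] by (simp add: D_def prod_eq_iff)
      show "D (g y) (fst x, (snd x - fst x * a (g y)) / b (g y)) = x" for x
        using bg[OF that] by (simp add: D_def prod_eq_iff)
    qed
    then show ?thesis using has_derivative_snd[OF g(1)[OF that]] by (simp add: h_def o_def)
  qed
  have gh: "g y = (fst y, h y)" if "y \<in> V" for y using fg[OF that] by (simp add: h_def prod_eq_iff)
  \<comment> \<open>Bootstrapping: the derivative of \<open>h\<close> is a smooth expression in \<open>h\<close> itself.\<close>
  have Ch: "C_k_on n V h" for n
  proof (induction n)
    case 0
    then show ?case using dh N(4) by (auto simp: continuous_on_eq_continuous_at intro: has_derivative_continuous)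
  next
    case (Suc n)
    show ?case
    proof (rule C_k_on_SucI[OF N(4) dh])
      fix v :: "real \<times> real"
      have "smooth_on (N \<inter> b -` (- {0})) (\<lambda>q. (snd v - fst v * a q) / b q)"
        by (intro smooth_on_intros smooth_on_subset[OF sab(1)] smooth_on_subset[OF sab(2)]) (use N(2) in auto)
      moreover have oN: "open (N \<inter> b -` (- {0}))"
        by (rule continuous_open_preimage[OF _ N(1)])
          (use smooth_on_continuous[OF sab(2)] N(2) continuous_on_subset in auto)
      ultimately have C1: "C_k_on n (N \<inter> b -` (- {0})) (\<lambda>q. (snd v - fst v * a q) / b q)"
        using smooth_on_open_iff by blast
      have bl: "bounded_linear (\<lambda>x::real. (x, 0::real))" "bounded_linear (\<lambda>x::real. (0::real, x))"
        by (auto intro: bounded_linear_Pair bounded_linear_ident bounded_linear_zero)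
      have "C_k_on n V (\<lambda>y. (fst y, 0::real))"
        by (rule C_k_on_bounded_linear[OF N(4)]) (intro bounded_linear_Pair bounded_linear_fst bounded_linear_zero)
      moreover have "C_k_on n V (\<lambda>y. (0::real, h y))"
        using C_k_on_compose[where g = "\<lambda>x. (0, x)", OF N(4) open_UNIV subset_UNIV Suc C_k_on_bounded_linear[OF open_UNIV bl(2)]] .
      ultimately have "C_k_on n V (\<lambda>y. (fst y, 0) + (0, h y))" by (rule C_k_on_add[OF N(4)])
      then have C2: "C_k_on n V g"
        using C_k_on_cong[OF N(4), of "\<lambda>y. (fst y, 0) + (0, h y)" g n] gh by simp
      show "C_k_on n V (\<lambda>y. (snd v - fst v * a (g y)) / b (g y))"
        by (rule C_k_on_compose[OF N(4) oN _ C2 C1]) (use gN bg in auto)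
    qed
  qed
  show ?thesis
  proof (rule that[OF N(1,3,2,4)])
    show "smooth_on V h" using Ch smooth_on_open_iff[OF N(4)] by blast
    show "(fst q, T q) \<in> V \<and> h (fst q, T q) = snd q" if "q \<in> N" for q
      using N(5) that by (auto simp: homeomorphism_def \<Psi>_def h_def)
  qed
qed

section \<open>Surfaces with boundary\<close>

lemma local_param_iff:
  "local_param F (V, f, g) \<longleftrightarrow> openin (top_of_set half_plane) V \<and> openin (top_of_set F) (f ` V) \<and>
     diffeomorphism V (f ` V) f g"
  by (simp add: local_param_def)

text \<open>Openness of the domain and of the image is checked through the open sets \<open>A\<close> and \<open>U\<close> of the ambient
  spaces, which is convenient for charts given by explicit formulas in both directions.\<close>

lemma local_paramI:
  assumes "open A" "V = half_plane \<inter> A" "open U"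
    and fV: "\<And>x. x \<in> V \<Longrightarrow> f x \<in> F \<inter> U \<and> g (f x) = x"
    and gU: "\<And>p. p \<in> F \<inter> U \<Longrightarrow> g p \<in> V \<and> f (g p) = p"
    and "smooth_on V f" "smooth_on (F \<inter> U) g"
  shows "local_param F (V, f, g)" "f ` V = F \<inter> U"
proof -
  show im: "f ` V = F \<inter> U"
  proof
    show "f ` V \<subseteq> F \<inter> U" using fV by blast
    show "F \<inter> U \<subseteq> f ` V"
    proof
      fix p assume "p \<in> F \<inter> U"
      then have "f (g p) = p" "g p \<in> V" using gU by auto
      then show "p \<in> f ` V" by (metis imageI)
    qed
  qed
  have "g ` (F \<inter> U) = V"
  proof
    show "g ` (F \<inter> U) \<subseteq> V" using gU by blast
    show "V \<subseteq> g ` (F \<inter> U)"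
    proof
      fix x assume "x \<in> V"
      then have "g (f x) = x" "f x \<in> F \<inter> U" using fV by auto
      then show "x \<in> g ` (F \<inter> U)" by (metis imageI)
    qed
  qed
  then have "diffeomorphism V (f ` V) f g"
    using assms im unfolding diffeomorphism_def by simp
  moreover have "openin (top_of_set half_plane) V" "openin (top_of_set F) (f ` V)"
    using assms im by (auto simp: openin_open)
  ultimately show "local_param F (V, f, g)" by (simp add: local_param_iff)
qed

lemma vector2_eq_iff: "(vector [a, b] :: real^2) = x \<longleftrightarrow> a = x $ 1 \<and> b = x $ 2"
  by (auto simp: vec_eq_iff forall_2)

lemma diffeomorphism_sym: "diffeomorphism S T f g \<Longrightarrow> diffeomorphism T S g f"
  by (auto simp: diffeomorphism_def)

lemma diffeomorphism_homeomorphism: "diffeomorphism S T f g \<Longrightarrow> homeomorphism S T f g"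
  unfolding diffeomorphism_def homeomorphism_def by (simp add: smooth_on_continuous)

lemma diffeomorphism_compose:
  assumes "diffeomorphism S T f g" "diffeomorphism T W f' g'"
  shows "diffeomorphism S W (f' \<circ> f) (g \<circ> g')"
proof -
  have a: "smooth_on S f" "smooth_on T g" "f ` S = T" "g ` T = S" "\<And>x. x \<in> S \<Longrightarrow> g (f x) = x" "\<And>y. y \<in> T \<Longrightarrow> f (g y) = y"
    and b: "smooth_on T f'" "smooth_on W g'" "f' ` T = W" "g' ` W = T" "\<And>x. x \<in> T \<Longrightarrow> g' (f' x) = x"
      "\<And>y. y \<in> W \<Longrightarrow> f' (g' y) = y"
    using assms by (auto simp: diffeomorphism_def)
  have "smooth_on S (f' \<circ> f)" "smooth_on W (g \<circ> g')"
    unfolding o_def by (rule smooth_on_compose[OF b(1) a(1)], use a in simp)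
      (rule smooth_on_compose[OF a(2) b(2)], use b in simp)
  moreover have "(f' \<circ> f) ` S = W" "(g \<circ> g') ` W = S" using a(3,4) b(3,4) by (metis image_comp)+
  moreover have "g (g' (f' (f x))) = x" if "x \<in> S" for x using a(3,5) b(5) that by auto
  moreover have "f' (f (g (g' y))) = y" if "y \<in> W" for y using b(4,6) a(6) that by auto
  ultimately show ?thesis by (simp add: diffeomorphism_def)
qed

lemma diffeomorphism_restrict:
  assumes "diffeomorphism S T f g" "S' \<subseteq> S"
  shows "diffeomorphism S' (f ` S') f g"
proof -
  have a: "smooth_on S f" "smooth_on T g" "f ` S = T" "\<And>x. x \<in> S \<Longrightarrow> g (f x) = x"
    using assms(1) by (auto simp: diffeomorphism_def)
  have "smooth_on S' f" "smooth_on (f ` S') g"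
    using smooth_on_subset[OF a(1) assms(2)] smooth_on_subset[OF a(2), of "f ` S'"] a(3) assms(2) by auto
  moreover have "g ` f ` S' = S'" using a(4) assms(2) by force
  ultimately show ?thesis using a(4) assms(2) by (auto simp: diffeomorphism_def)
qed

lemma local_param_restrict:
  assumes c: "local_param F (V, f, g)" and F': "openin (top_of_set F) F'"
  shows "local_param F' (V \<inter> f -` F', f, g)"
proof -
  have V: "openin (top_of_set half_plane) V" "openin (top_of_set F) (f ` V)" "diffeomorphism V (f ` V) f g"
    using c by (auto simp: local_param_iff)
  have F'F: "F' \<subseteq> F" using F' openin_imp_subset by blast
  have "f ` V \<subseteq> F" using V(2) openin_imp_subset by blast
  moreover have "continuous_on V f" using V(3) by (simp add: diffeomorphism_def smooth_on_continuous)
  ultimately have "openin (top_of_set V) (V \<inter> f -` F')"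
    using F' continuous_openin_preimage[of V f F F'] by (auto simp: image_subset_iff_funcset)
  then have "openin (top_of_set half_plane) (V \<inter> f -` F')" using V(1) openin_trans by blast
  moreover have "f ` (V \<inter> f -` F') = f ` V \<inter> F'" by auto
  then have "openin (top_of_set F') (f ` (V \<inter> f -` F'))"
    using openin_Int[OF V(2) F'] F'F by (metis Int_lower2 openin_subset_trans)
  moreover have "diffeomorphism (V \<inter> f -` F') (f ` (V \<inter> f -` F')) f g"
    by (rule diffeomorphism_restrict[OF V(3)]) auto
  ultimately show ?thesis by (simp add: local_param_iff)
qed

lemma local_param_of_openin:
  "local_param F' (V, f, g) \<Longrightarrow> openin (top_of_set F) F' \<Longrightarrow> local_param F (V, f, g)"
  by (auto simp: local_param_iff intro: openin_trans)

lemma local_param_diffeomorphism: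
  assumes "diffeomorphism F F' h k" "local_param F (V, f, g)"
  shows "local_param F' (V, h \<circ> f, g \<circ> k)"
proof -
  have V: "openin (top_of_set half_plane) V" "openin (top_of_set F) (f ` V)" "diffeomorphism V (f ` V) f g"
    using assms(2) by (auto simp: local_param_iff)
  have "f ` V \<subseteq> F" using V(2) openin_imp_subset by blast
  then have "diffeomorphism V ((h \<circ> f) ` V) (h \<circ> f) (g \<circ> k)"
    using diffeomorphism_compose[OF V(3) diffeomorphism_restrict[OF assms(1)]] by (simp add: image_comp)
  moreover have "openin (top_of_set F') (h ` f ` V)"
    using diffeomorphism_homeomorphism[OF assms(1)] V(2) homeomorphism_imp_open_map by blast
  ultimately show ?thesis using V(1) by (simp add: local_param_iff image_comp)
qed

lemma smooth_surface_diffeomorphism: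
  assumes "diffeomorphism F F' h k" "smooth_surface F"
  shows "smooth_surface F'"
  unfolding smooth_surface_def
proof
  fix p assume "p \<in> F'"
  then have k: "k p \<in> F" "h (k p) = p" using assms(1) by (auto simp: diffeomorphism_def)
  then obtain V f g where c: "local_param F (V, f, g)" "k p \<in> f ` V"
    using assms(2) unfolding smooth_surface_def by blast
  then have "p \<in> (h \<circ> f) ` V" using k by force
  then show "\<exists>V f g. local_param F' (V, f, g) \<and> p \<in> f ` V"
    using local_param_diffeomorphism[OF assms(1) c(1)] by blast
qed

lemma surface_boundary_diffeomorphism_subset:
  assumes "diffeomorphism F F' h k"
  shows "h ` surface_boundary F \<subseteq> surface_boundary F'"
proof
  fix p assume "p \<in> h ` surface_boundary F"
  then obtain V f g x where "local_param F (V, f, g)" "x \<in> V" "x $ 2 = 0" "p = (h \<circ> f) x"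
    unfolding surface_boundary_def by auto
  then show "p \<in> surface_boundary F'"
    unfolding surface_boundary_def using local_param_diffeomorphism[OF assms] by blast
qed

lemma surface_boundary_subset: "surface_boundary F \<subseteq> F"
  by (auto simp: surface_boundary_def local_param_iff dest: openin_imp_subset)

lemma surface_boundary_diffeomorphism:
  assumes "diffeomorphism F F' h k"
  shows "surface_boundary F' = h ` surface_boundary F"
proof
  show "surface_boundary F' \<subseteq> h ` surface_boundary F"
  proof
    fix p assume p: "p \<in> surface_boundary F'"
    then have "k p \<in> surface_boundary F"
      using surface_boundary_diffeomorphism_subset[OF diffeomorphism_sym[OF assms]] by auto
    moreover have "p \<in> F'" using p surface_boundary_subset by blast
    then have "h (k p) = p" using assms by (simp add: diffeomorphism_def)
    ultimately show "p \<in> h ` surface_boundary F" by force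
  qed
qed (rule surface_boundary_diffeomorphism_subset[OF assms])

lemma surface_boundary_openin:
  assumes "openin (top_of_set F) F'"
  shows "surface_boundary F' = F' \<inter> surface_boundary F"
proof
  show "surface_boundary F' \<subseteq> F' \<inter> surface_boundary F"
    using surface_boundary_subset local_param_of_openin[OF _ assms] unfolding surface_boundary_def by blast
  show "F' \<inter> surface_boundary F \<subseteq> surface_boundary F'"
  proof
    fix p assume "p \<in> F' \<inter> surface_boundary F"
    then obtain V f g x where c: "local_param F (V, f, g)" "x \<in> V" "x $ 2 = 0" "f x = p" "p \<in> F'"
      unfolding surface_boundary_def by auto
    then have "x \<in> V \<inter> f -` F'" by auto
    then show "p \<in> surface_boundary F'"
      using local_param_restrict[OF c(1) assms] c unfolding surface_boundary_def by blast
  qed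
qed

text \<open>Near a point of the open half plane, a transition map is continuous and injective on an open subset
  of the plane. By invariance of domain its image is open, so it cannot contain a point on the edge of
  the half plane that contains the image.\<close>

lemma local_param_boundary_unique:
  assumes c: "local_param F (V, f, g)" "x \<in> V" and d: "local_param F (V', f', g')" "x' \<in> V'"
    and eq: "f x = f' x'" "x' $ 2 = 0"
  shows "x $ 2 = 0"
proof (rule ccontr)
  assume x2: "x $ 2 \<noteq> 0"
  have V: "openin (top_of_set half_plane) V" "openin (top_of_set F) (f ` V)" "diffeomorphism V (f ` V) f g"
    using c by (auto simp: local_param_iff)
  have V': "openin (top_of_set half_plane) V'" "openin (top_of_set F) (f' ` V')" "diffeomorphism V' (f' ` V') f' g'"
    using d by (auto simp: local_param_iff)
  \<comment> \<open>Cutting away the edge makes the domain of the transition map open in the plane.\<close>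
  define N where "N = V \<inter> f -` (f' ` V') \<inter> {y. y $ 2 > 0}"
  have "f ` V \<subseteq> F" using V(2) openin_imp_subset by blast
  moreover have cf: "continuous_on V f" using V(3) by (simp add: diffeomorphism_def smooth_on_continuous)
  ultimately have "openin (top_of_set V) (V \<inter> f -` (f' ` V'))"
    using V'(2) continuous_openin_preimage[of V f F "f' ` V'"] by (auto simp: image_subset_iff_funcset)
  then have "openin (top_of_set half_plane) (V \<inter> f -` (f' ` V'))" using V(1) openin_trans by blast
  then obtain O1 where O1: "open O1" "V \<inter> f -` (f' ` V') = half_plane \<inter> O1" unfolding openin_open by metis
  have "N = O1 \<inter> {y. y $ 2 > 0}" unfolding N_def O1(2) half_plane_def by auto
  moreover have "open {y::real^2. y $ 2 > 0}" by (simp add: open_halfspace_component_gt_cart)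
  ultimately have oN: "open N" using O1(1) by auto
  have fN: "f ` N \<subseteq> f' ` V'" "N \<subseteq> V" by (auto simp: N_def)
  have "continuous_on (f ` N) g'"
    by (rule continuous_on_subset[OF homeomorphism_cont2[OF diffeomorphism_homeomorphism[OF V'(3)]] fN(1)])
  then have "continuous_on N (\<lambda>y. g' (f y))"
    using continuous_on_compose2[of "f ` N" g' N f] cf fN continuous_on_subset by blast
  moreover have "inj_on (\<lambda>y. g' (f y)) N"
  proof (rule inj_onI)
    fix y z assume "y \<in> N" "z \<in> N" "g' (f y) = g' (f z)"
    moreover have "f' (g' (f y)) = f y" "f' (g' (f z)) = f z"
      using homeomorphism_apply2[OF diffeomorphism_homeomorphism[OF V'(3)]] fN(1) \<open>y \<in> N\<close> \<open>z \<in> N\<close> by blast+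
    moreover have "g (f y) = y" "g (f z) = z"
      using homeomorphism_apply1[OF diffeomorphism_homeomorphism[OF V(3)]] fN(2) \<open>y \<in> N\<close> \<open>z \<in> N\<close> by blast+
    ultimately show "y = z" by metis
  qed
  ultimately have op: "open ((\<lambda>y. g' (f y)) ` N)" using invariance_of_domain oN by blast
  have "g' ` f' ` V' \<subseteq> half_plane"
    using homeomorphism_image2[OF diffeomorphism_homeomorphism[OF V'(3)]] openin_imp_subset[OF V'(1)] by simp
  then have sub: "(\<lambda>y. g' (f y)) ` N \<subseteq> half_plane" using fN by blast
  have "x \<in> half_plane" using c(2) V(1) openin_imp_subset by blast
  then have "x \<in> N" using x2 c(2) d(2) eq by (auto simp: N_def half_plane_def)
  moreover have "g' (f x) = x'" using V'(3) d(2) eq by (auto simp: diffeomorphism_def)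
  ultimately have "x' \<in> interior half_plane" using op sub interior_maximal by (metis image_eqI subset_iff)
  moreover have "interior half_plane = {y. y $ 2 > 0}"
  proof -
    have "half_plane = {y. y $ 2 \<ge> 0}" by (simp add: half_plane_def)
    also have "\<dots> = {y. axis 2 1 \<bullet> y \<ge> 0}" by (simp add: inner_axis' cart_eq_inner_axis inner_commute)
    finally show ?thesis
      using interior_halfspace_ge[of "axis 2 1 :: real^2" 0] by (simp add: inner_axis' axis_eq_0_iff)
  qed
  ultimately show False using eq(2) by simp
qed

lemma surface_boundary_local_param:
  assumes "local_param F (V, f, g)" "x \<in> V"
  shows "f x \<in> surface_boundary F \<longleftrightarrow> x $ 2 = 0"
proof
  assume "f x \<in> surface_boundary F"
  then obtain V' f' g' x' where "local_param F (V', f', g')" "x' \<in> V'" "x' $ 2 = 0" "f' x' = f x"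
    unfolding surface_boundary_def by blast
  then show "x $ 2 = 0" using local_param_boundary_unique[OF assms] by metis
qed (use assms in \<open>auto simp: surface_boundary_def\<close>)

section \<open>Orientability\<close>

lemma coherently_orientedD:
  assumes "coherently_oriented (V, f, g) (V', f', g')" "x \<in> V" "f x \<in> f' ` V'"
  shows "\<exists>L. ((g' \<circ> f) has_derivative L) (at x within {y \<in> V. f y \<in> f' ` V'}) \<and> det (matrix L) > 0"
  using assms by (simp add: coherently_oriented_def)

text \<open>Charts transported by a diffeomorphism have the same transition maps.\<close>

lemma orientable_diffeomorphism:
  assumes "diffeomorphism F F' h k" "orientable F"
  shows "orientable F'"
proof -
  obtain A where A: "\<forall>c\<in>A. local_param F c" "\<forall>p\<in>F. \<exists>(V, f, g)\<in>A. p \<in> f ` V"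
    "\<forall>c\<in>A. \<forall>d\<in>A. coherently_oriented c d"
    using assms(2) unfolding orientable_def by blast
  define push :: "(real^2) set \<times> (real^2 \<Rightarrow> 'a) \<times> ('a \<Rightarrow> real^2) \<Rightarrow> (real^2) set \<times> (real^2 \<Rightarrow> 'b) \<times> ('b \<Rightarrow> real^2)"
    where "push = (\<lambda>(V, f, g). (V, h \<circ> f, g \<circ> k))"
  have kh: "k (h p) = p" if "p \<in> F" for p using assms(1) that by (auto simp: diffeomorphism_def)
  show ?thesis unfolding orientable_def
  proof (intro exI[of _ "push ` A"] conjI ballI)
    fix c assume "c \<in> push ` A"
    then show "local_param F' c"
      using A(1) local_param_diffeomorphism[OF assms(1)] by (auto simp: push_def split: prod.splits)
  next
    fix p assume "p \<in> F'"
    then have p: "k p \<in> F" "h (k p) = p" using assms(1) by (auto simp: diffeomorphism_def)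
    from bspec[OF A(2) p(1)] obtain a where "a \<in> A" "case a of (V, f, g) \<Rightarrow> k p \<in> f ` V" by (elim bexE)
    then obtain V f g where "(V, f, g) \<in> A" "k p \<in> f ` V" by (cases a) auto
    then have "push (V, f, g) \<in> push ` A" "p \<in> (h \<circ> f) ` V" using p by (auto simp: image_iff)
    moreover have "push (V, f, g) = (V, h \<circ> f, g \<circ> k)" by (simp add: push_def)
    ultimately show "\<exists>(V, f, g)\<in>push ` A. p \<in> f ` V" by (intro bexI[of _ "push (V, f, g)"]) auto
  next
    fix c d assume "c \<in> push ` A" "d \<in> push ` A"
    then obtain V f g V' f' g' where cd: "(V, f, g) \<in> A" "(V', f', g') \<in> A"
      "c = (V, h \<circ> f, g \<circ> k)" "d = (V', h \<circ> f', g' \<circ> k)" unfolding push_def by auto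
    have "local_param F (V, f, g)" "local_param F (V', f', g')" using A(1) cd(1,2) by auto
    then have fF: "f ` V \<subseteq> F" "f' ` V' \<subseteq> F" unfolding local_param_iff by (blast dest: openin_imp_subset)+
    have eq: "h (f y) \<in> (h \<circ> f') ` V' \<longleftrightarrow> f y \<in> f' ` V'" if "y \<in> V" for y
    proof
      assume "h (f y) \<in> (h \<circ> f') ` V'"
      then obtain y' where y': "y' \<in> V'" "h (f y) = h (f' y')" by auto
      have "f y \<in> F" "f' y' \<in> F" using fF that y'(1) by auto
      then have "f y = f' y'" using kh y'(2) by metis
      then show "f y \<in> f' ` V'" using y'(1) by auto
    qed auto
    have coh: "\<exists>L. ((g' \<circ> f) has_derivative L) (at x within {y \<in> V. f y \<in> f' ` V'}) \<and> det (matrix L) > 0"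
      if "x \<in> V" "f x \<in> f' ` V'" for x
      by (rule coherently_orientedD[OF bspec[OF bspec[OF A(3) cd(1)] cd(2)] that])
    show "coherently_oriented c d"
      unfolding cd coherently_oriented_def prod.case
    proof (intro ballI impI)
      fix x assume x: "x \<in> V" "(h \<circ> f) x \<in> (h \<circ> f') ` V'"
      then obtain L where L: "((g' \<circ> f) has_derivative L) (at x within {y \<in> V. f y \<in> f' ` V'})" "det (matrix L) > 0"
        using coh[OF x(1)] eq[OF x(1)] by auto
      have "{y \<in> V. (h \<circ> f) y \<in> (h \<circ> f') ` V'} = {y \<in> V. f y \<in> f' ` V'}" using eq by auto
      moreover have "((g' \<circ> k \<circ> (h \<circ> f)) has_derivative L) (at x within {y \<in> V. f y \<in> f' ` V'})"
        by (rule has_derivative_transform[OF _ _ L(1)]) (use x eq fF kh in auto)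
      ultimately show "\<exists>L. ((g' \<circ> k \<circ> (h \<circ> f)) has_derivative L) (at x within {y \<in> V. (h \<circ> f) y \<in> (h \<circ> f') ` V'}) \<and>
          det (matrix L) > 0"
        using L(2) by auto
    qed
  qed
qed

definition transition_det :: "(real^2 \<Rightarrow> 'a::euclidean_space) \<Rightarrow> ('a \<Rightarrow> real^2) \<Rightarrow> real^2 \<Rightarrow> real" where
  "transition_det f g x = det (matrix (frechet_derivative (g \<circ> f) (at x)))"

text \<open>The chart \<open>d\<close> may have boundary points, so the opposite transition map is defined on a subset of the
  half plane only. A smooth extension of it is still a left inverse of the transition map \<open>g' \<circ> f\<close>,
  which forces the Jacobian of \<open>g' \<circ> f\<close> to be nonzero.\<close>

lemma transition_smooth:
  assumes c: "local_param F (V, f, g)" "open V" and d: "local_param F (V', f', g')"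
  defines "N \<equiv> V \<inter> f -` (f' ` V')"
  shows "open N" "smooth_on N (g' \<circ> f)"
    "\<And>x. x \<in> N \<Longrightarrow> ((g' \<circ> f) has_derivative frechet_derivative (g' \<circ> f) (at x)) (at x)"
    "continuous_on N (transition_det f g')"
    "\<And>x. x \<in> N \<Longrightarrow> transition_det f g' x \<noteq> 0"
proof -
  have V: "openin (top_of_set F) (f ` V)" "diffeomorphism V (f ` V) f g"
    using c by (auto simp: local_param_iff)
  have V': "openin (top_of_set F) (f' ` V')" "diffeomorphism V' (f' ` V') f' g'"
    using d by (auto simp: local_param_iff)
  have "f ` V \<subseteq> F" using V(1) openin_imp_subset by blast
  moreover have cf: "continuous_on V f" using V(2) by (simp add: diffeomorphism_def smooth_on_continuous)
  ultimately have "openin (top_of_set V) N"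
    using V'(1) continuous_openin_preimage[of V f F "f' ` V'"] by (auto simp: image_subset_iff_funcset N_def)
  then show oN: "open N" using c(2) openin_open_trans by blast
  have fN: "f ` N \<subseteq> f' ` V'" "N \<subseteq> V" by (auto simp: N_def)
  have smf: "smooth_on N f" using V(2) fN smooth_on_subset by (auto simp: diffeomorphism_def)
  show sm: "smooth_on N (g' \<circ> f)"
    unfolding o_def by (rule smooth_on_compose[OF _ smf fN(1)]) (use V'(2) in \<open>auto simp: diffeomorphism_def\<close>)
  then have C1: "C_k_on (Suc 0) N (g' \<circ> f)" using smooth_on_open_iff[OF oN] by blast
  show der: "((g' \<circ> f) has_derivative frechet_derivative (g' \<circ> f) (at x)) (at x)" if "x \<in> N" for x
    using C_k_on_Suc_derivative[OF oN C1 that] .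
  have "continuous_on N (\<lambda>x. frechet_derivative (g' \<circ> f) (at x) v)" for v
    using C1 by simp
  then show "continuous_on N (transition_det f g')"
    unfolding transition_det_def det_2 matrix_def by (auto intro!: continuous_intros)
  show "transition_det f g' x \<noteq> 0" if x: "x \<in> N" for x
  proof -
    define S where "S = V' \<inter> f' -` (f ` V)"
    have "smooth_on S (\<lambda>y. g (f' y))"
    proof (rule smooth_on_compose[of "f ` V"])
      have "smooth_on V' f'" using V'(2) by (simp add: diffeomorphism_def)
      then show "smooth_on S f'" by (rule smooth_on_subset) (auto simp: S_def)
      show "smooth_on (f ` V) g" using V(2) by (simp add: diffeomorphism_def)
    qed (auto simp: S_def)
    note smS = this
    have xS: "g' (f y) \<in> S" "g (f' (g' (f y))) = y" if "y \<in> N" for y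
    proof -
      have fy: "f y \<in> f' ` V'" "y \<in> V" using fN that by auto
      then have "f' (g' (f y)) = f y" "g' (f y) \<in> V'"
        using V'(2) unfolding diffeomorphism_def by blast+
      moreover have "g (f y) = y" using V(2) fy unfolding diffeomorphism_def by blast
      ultimately show "g' (f y) \<in> S" "g (f' (g' (f y))) = y" using fy by (auto simp: S_def)
    qed
    note smooth_on_extend[OF smS xS(1)[OF x]]
    then obtain U k where U: "open U" "g' (f x) \<in> U" "smooth_on U k" "\<forall>y\<in>S \<inter> U. k y = g (f' y)"
      by (elim exE conjE)
    have dk: "(k has_derivative frechet_derivative k (at ((g' \<circ> f) x))) (at ((g' \<circ> f) x))"
      using smooth_on_imp_has_derivative[OF U(1,3)] U(2) by simp
    define M where "M = N \<inter> (g' \<circ> f) -` U"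
    have "open M" unfolding M_def
      using continuous_open_preimage[OF smooth_on_continuous[OF sm] oN U(1)] .
    have "(k \<circ> (g' \<circ> f) has_derivative frechet_derivative k (at ((g' \<circ> f) x)) \<circ> frechet_derivative (g' \<circ> f) (at x)) (at x)"
      by (rule diff_chain_at[OF der[OF x] dk])
    then have "((\<lambda>y. y) has_derivative frechet_derivative k (at ((g' \<circ> f) x)) \<circ> frechet_derivative (g' \<circ> f) (at x)) (at x)"
      by (rule has_derivative_transform_within_open[OF _ \<open>open M\<close>])
        (use x U xS in \<open>auto simp: M_def\<close>)
    then have "frechet_derivative k (at ((g' \<circ> f) x)) \<circ> frechet_derivative (g' \<circ> f) (at x) = (\<lambda>y. y)"
      using has_derivative_unique has_derivative_ident by blast
    then have "matrix (frechet_derivative k (at ((g' \<circ> f) x))) ** matrix (frechet_derivative (g' \<circ> f) (at x)) = mat 1"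
      using matrix_compose[of "frechet_derivative (g' \<circ> f) (at x)" "frechet_derivative k (at ((g' \<circ> f) x))"]
        has_derivative_linear[OF dk] has_derivative_linear[OF der[OF x]]
      by (simp add: matrix_id_mat_1[unfolded id_def])
    then have "det (matrix (frechet_derivative k (at ((g' \<circ> f) x)))) * transition_det f g' x = 1"
      unfolding transition_det_def by (metis det_I det_mul)
    then show ?thesis by auto
  qed
qed

text \<open>The factor \<open>L\<close> is a derivative within a set because that is what coherence of an atlas provides at
  boundary points.\<close>

lemma transition_det_chain:
  assumes "((g1 \<circ> f) has_derivative D) (at x)" "open N" "x \<in> N"
    and "((g2 \<circ> f1) has_derivative L) (at (g1 (f x)) within S)" "(g1 \<circ> f) ` N \<subseteq> S"
    and "\<And>y. y \<in> N \<Longrightarrow> f1 (g1 (f y)) = f y"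
  shows "transition_det f g2 x = det (matrix L) * det (matrix D)"
proof -
  have "(g2 \<circ> f1 \<circ> (g1 \<circ> f) has_derivative L \<circ> D) (at x within N)"
    by (rule diff_chain_within[OF has_derivative_at_withinI[OF assms(1)]])
      (use assms(4,5) has_derivative_subset in auto)
  then have "(g2 \<circ> f1 \<circ> (g1 \<circ> f) has_derivative L \<circ> D) (at x)"
    by (simp add: at_within_open[OF assms(3,2)])
  then have "(g2 \<circ> f has_derivative L \<circ> D) (at x)"
    by (rule has_derivative_transform_within_open[OF _ assms(2,3)]) (use assms(6) in auto)
  then have "frechet_derivative (g2 \<circ> f) (at x) = L \<circ> D" using frechet_derivative_at by metis
  then show ?thesis
    unfolding transition_det_def
    by (simp add: det_mul matrix_compose[OF has_derivative_linear[OF assms(1)] has_derivative_linear[OF assms(4)]])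
qed

text \<open>Compare a chart with a connected open domain to a coherent atlas. The sign of the Jacobian at a point
  does not depend on the atlas chart, by coherence, and it is locally constant, so each such chart
  has one global sign. The transition between two such charts would then have a Jacobian of
  constant sign.\<close>

lemma not_orientable_if_transition_changes_sign:
  assumes c: "local_param F (V, f, g)" "open V" "connected V"
    and d: "local_param F (V', f', g')" "open V'" "connected V'"
    and x: "x \<in> V" "f x \<in> f' ` V'" "((g' \<circ> f) has_derivative L) (at x)" "det (matrix L) > 0"
    and y: "y \<in> V" "f y \<in> f' ` V'" "((g' \<circ> f) has_derivative M) (at y)" "det (matrix M) < 0"
  shows "\<not> orientable F"
proof
  assume "orientable F"
  then obtain A where A: "\<forall>c\<in>A. local_param F c" "\<forall>p\<in>F. \<exists>(V, f, g)\<in>A. p \<in> f ` V"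
    "\<forall>c\<in>A. \<forall>d\<in>A. coherently_oriented c d"
    unfolding orientable_def by blast
  have cover: "\<exists>V f g. (V, f, g) \<in> A \<and> p \<in> f ` V" if "p \<in> F" for p
  proof -
    from bspec[OF A(2) that] obtain a where "a \<in> A" "case a of (V, f, g) \<Rightarrow> p \<in> f ` V" by (elim bexE)
    then show ?thesis by (cases a) auto
  qed
  have agree: "sgn (transition_det e g1 z) = sgn (transition_det e g2 z)"
    if e: "local_param F (W, e, h)" "open W" "z \<in> W"
      and a: "(V1, f1, g1) \<in> A" "(V2, f2, g2) \<in> A" "e z \<in> f1 ` V1" "e z \<in> f2 ` V2" for W e h z V1 f1 g1 V2 f2 g2
  proof -
    have lp: "local_param F (V1, f1, g1)" "local_param F (V2, f2, g2)" using A(1) a by auto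
    define N where "N = (W \<inter> e -` (f1 ` V1)) \<inter> (W \<inter> e -` (f2 ` V2))"
    note t1 = transition_smooth[OF e(1,2) lp(1)] and t2 = transition_smooth[OF e(1,2) lp(2)]
    have df: "diffeomorphism V1 (f1 ` V1) f1 g1" using lp by (auto simp: local_param_iff)
    have g1: "f1 (g1 p) = p" "g1 p \<in> V1" if "p \<in> f1 ` V1" for p
      using that df by (auto simp: diffeomorphism_def)
    obtain L where L: "((g2 \<circ> f1) has_derivative L) (at (g1 (e z)) within {y \<in> V1. f1 y \<in> f2 ` V2})" "det (matrix L) > 0"
      using coherently_orientedD[OF bspec[OF bspec[OF A(3) a(1)] a(2)], of "g1 (e z)"] g1[OF a(3)] a(4) by auto
    have "transition_det e g2 z = det (matrix L) * det (matrix (frechet_derivative (g1 \<circ> e) (at z)))"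
    proof (rule transition_det_chain[OF t1(3) _ _ L(1)])
      show "z \<in> W \<inter> e -` f1 ` V1" using e a by auto
      show "open N" using t1(1) t2(1) by (auto simp: N_def)
      show "z \<in> N" using e a by (auto simp: N_def)
      show "(g1 \<circ> e) ` N \<subseteq> {y \<in> V1. f1 y \<in> f2 ` V2}"
      proof (rule image_subsetI)
        fix w assume "w \<in> N"
        then have "e w \<in> f1 ` V1" "e w \<in> f2 ` V2" by (auto simp: N_def)
        then show "(g1 \<circ> e) w \<in> {y \<in> V1. f1 y \<in> f2 ` V2}" using g1[of "e w"] by simp
      qed
      show "f1 (g1 (e y)) = e y" if "y \<in> N" for y using g1 that by (auto simp: N_def)
    qed
    then show ?thesis using L(2) by (simp add: transition_det_def sgn_mult)
  qed
  have const: "\<exists>s. \<forall>z\<in>W. \<forall>(V1, f1, g1)\<in>A. e z \<in> f1 ` V1 \<longrightarrow> sgn (transition_det e g1 z) = s"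
    if e: "local_param F (W, e, h)" "open W" "connected W" for W e h
  proof -
    define s where "s z = (THE s. \<forall>(V1, f1, g1)\<in>A. e z \<in> f1 ` V1 \<longrightarrow> sgn (transition_det e g1 z) = s)" for z
    have s: "sgn (transition_det e g1 z) = s z" if "z \<in> W" "(V1, f1, g1) \<in> A" "e z \<in> f1 ` V1" for z V1 f1 g1
    proof -
      have "s z = sgn (transition_det e g1 z)"
        unfolding s_def
      proof (rule the_equality)
        show "\<forall>(V2, f2, g2)\<in>A. e z \<in> f2 ` V2 \<longrightarrow> sgn (transition_det e g2 z) = sgn (transition_det e g1 z)"
          using agree[OF e(1,2) that(1) _ that(2) _ that(3)] by auto
      qed (use that in auto)
      then show ?thesis by simp
    qed
    have "s constant_on W"
    proof (rule locally_constant_imp_constant[OF e(3)])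
      fix z assume z: "z \<in> W"
      have "e ` W \<subseteq> F" using e(1) by (auto simp: local_param_iff dest: openin_imp_subset)
      then obtain V1 f1 g1 where a: "(V1, f1, g1) \<in> A" "e z \<in> f1 ` V1" using cover[of "e z"] z by blast
      then have lp: "local_param F (V1, f1, g1)" using A by auto
      note t = transition_smooth[OF e(1,2) lp]
      define N where "N = W \<inter> e -` (f1 ` V1)"
      define t0 where "t0 = transition_det e g1"
      have zN: "z \<in> N" using z a by (auto simp: N_def)
      have "isCont t0 z"
        using t(1,4) zN unfolding N_def t0_def by (simp add: continuous_on_eq_continuous_at)
      moreover have "t0 z \<noteq> 0" using t(5) zN unfolding N_def t0_def by blast
      ultimately have "\<forall>\<^sub>F w in at z. sgn (t0 w) = sgn (t0 z)"
      proof (cases "t0 z > 0")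
        case True
        then have "\<forall>\<^sub>F w in at z. t0 w > 0" using \<open>isCont t0 z\<close> by (auto simp: isCont_def dest: order_tendstoD)
        then show ?thesis using True by (auto elim!: eventually_mono)
      next
        case False
        then have "t0 z < 0" using \<open>t0 z \<noteq> 0\<close> by auto
        moreover then have "\<forall>\<^sub>F w in at z. t0 w < 0" using \<open>isCont t0 z\<close> by (auto simp: isCont_def dest: order_tendstoD)
        ultimately show ?thesis by (auto elim!: eventually_mono)
      qed
      then obtain U where U: "open U" "z \<in> U" "\<And>w. w \<in> U \<Longrightarrow> sgn (t0 w) = sgn (t0 z)"
        unfolding eventually_at_topological by (metis UNIV_I)
      have "openin (top_of_set W) (N \<inter> U)"
        using t(1) U(1) unfolding N_def by (auto intro!: open_openin_trans open_subset)
      moreover have "s w = s z" if "w \<in> N \<inter> U" for w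
        using s[OF _ a(1)] U(3) that a(2) z by (simp add: N_def t0_def) (metis U(3) t0_def)
      ultimately show "\<exists>T. openin (top_of_set W) T \<and> z \<in> T \<and> (\<forall>x\<in>T. s x = s z)"
        using zN U(2) by blast
    qed
    then obtain r where r: "\<And>z. z \<in> W \<Longrightarrow> s z = r" unfolding constant_on_def by metis
    show ?thesis
    proof (intro exI[of _ r] ballI)
      fix z a assume "z \<in> W" "a \<in> A"
      then show "case a of (V1, f1, g1) \<Rightarrow> e z \<in> f1 ` V1 \<longrightarrow> sgn (transition_det e g1 z) = r"
        using s[of z] r[of z] by (cases a) auto
    qed
  qed
  obtain s where s: "\<And>z V1 f1 g1. z \<in> V \<Longrightarrow> (V1, f1, g1) \<in> A \<Longrightarrow> f z \<in> f1 ` V1 \<Longrightarrow> sgn (transition_det f g1 z) = s"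
  proof -
    from const[OF c] obtain s
      where s: "\<forall>z\<in>V. \<forall>(V1, f1, g1)\<in>A. f z \<in> f1 ` V1 \<longrightarrow> sgn (transition_det f g1 z) = s" ..
    have "sgn (transition_det f g1 z) = s" if "z \<in> V" "(V1, f1, g1) \<in> A" "f z \<in> f1 ` V1" for z V1 f1 g1
      using bspec[OF bspec[OF s that(1)] that(2)] that(3) by simp
    then show ?thesis using that by blast
  qed
  obtain s' where s': "\<And>z V1 f1 g1. z \<in> V' \<Longrightarrow> (V1, f1, g1) \<in> A \<Longrightarrow> f' z \<in> f1 ` V1 \<Longrightarrow> sgn (transition_det f' g1 z) = s'"
  proof -
    from const[OF d] obtain s
      where s: "\<forall>z\<in>V'. \<forall>(V1, f1, g1)\<in>A. f' z \<in> f1 ` V1 \<longrightarrow> sgn (transition_det f' g1 z) = s" ..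
    have "sgn (transition_det f' g1 z) = s" if "z \<in> V'" "(V1, f1, g1) \<in> A" "f' z \<in> f1 ` V1" for z V1 f1 g1
      using bspec[OF bspec[OF s that(1)] that(2)] that(3) by simp
    then show ?thesis using that by blast
  qed
  have rel: "s = s' * sgn (det (matrix D)) \<and> s' \<noteq> 0"
    if z: "z \<in> V" "f z \<in> f' ` V'" "((g' \<circ> f) has_derivative D) (at z)" for z D
  proof -
    have "diffeomorphism V' (f' ` V') f' g'" using d by (auto simp: local_param_iff)
    then have g': "f' (g' p) = p" "g' p \<in> V'" if "p \<in> f' ` V'" for p
      using that by (auto simp: diffeomorphism_def)
    have "f ` V \<subseteq> F" using c(1) by (auto simp: local_param_iff dest: openin_imp_subset)
    then obtain V1 f1 g1 where a: "(V1, f1, g1) \<in> A" "f z \<in> f1 ` V1" using cover[of "f z"] z by blast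
    then have lp: "local_param F (V1, f1, g1)" using A by auto
    note t = transition_smooth[OF c(1,2) d(1)] and t1 = transition_smooth[OF c(1,2) lp]
      and t' = transition_smooth[OF d(1,2) lp]
    have gz: "g' (f z) \<in> V' \<inter> f' -` f1 ` V1" using g'[OF z(2)] a by auto
    have "transition_det f g1 z = det (matrix (frechet_derivative (g1 \<circ> f') (at (g' (f z))))) * det (matrix D)"
    proof (rule transition_det_chain[OF z(3)])
      show "(g1 \<circ> f' has_derivative frechet_derivative (g1 \<circ> f') (at (g' (f z)))) (at (g' (f z)) within UNIV)"
        using t'(3)[OF gz] by simp
      show "open ((V \<inter> f -` f' ` V') \<inter> (V \<inter> f -` f1 ` V1))" using t(1) t1(1) by auto
    qed (use z a g' in auto)
    then have "s = sgn (transition_det f' g1 (g' (f z))) * sgn (det (matrix D))"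
      using s[OF z(1) a] by (simp add: transition_det_def sgn_mult)
    moreover have "sgn (transition_det f' g1 (g' (f z))) = s'" using s'[OF _ a(1)] gz by auto
    moreover have "transition_det f' g1 (g' (f z)) \<noteq> 0" using t'(5)[OF gz] .
    ultimately show ?thesis by (metis sgn_zero_iff)
  qed
  show False using rel[OF x(1-3)] rel[OF y(1-3)] x(4) y(4) by auto
qed

section \<open>First homology of a space with bands attached\<close>

text \<open>Three vectors in the integer plane satisfy a nontrivial integer relation, with the components of the
  cross product of the rows as coefficients.\<close>

lemma (in comm_group) abelian_group_rank_le_two:
  assumes gh: "g \<in> carrier G" "h \<in> carrier G"
    and gen: "\<And>x. x \<in> carrier G \<Longrightarrow> \<exists>(k::int) (l::int). x = g [^] k \<otimes> h [^] l"
  shows "abelian_group_rank G \<le> 2"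
  unfolding abelian_group_rank_def
proof (rule SUP_least)
  fix S assume "S \<in> {S. int_independent G S}"
  then have S: "finite S" "S \<subseteq> carrier G"
    and ind: "\<And>c :: 'a \<Rightarrow> int. finprod G (\<lambda>x. x [^] c x) S = \<one> \<Longrightarrow> \<forall>x\<in>S. c x = 0"
    by (auto simp: int_independent_def)
  have "card S \<le> 2"
  proof (rule ccontr)
    assume "\<not> card S \<le> 2"
    then obtain T where "T \<subseteq> S" "card T = 3"
      by (metis not_less_eq_eq numeral_2_eq_2 numeral_3_eq_3 obtain_subset_with_card_n)
    then obtain a b c where abc: "a \<in> S" "b \<in> S" "c \<in> S" "a \<noteq> b" "b \<noteq> c" "a \<noteq> c"
      by (auto simp: card_3_iff)
    then have carr: "a \<in> carrier G" "b \<in> carrier G" "c \<in> carrier G" using S by auto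
    obtain k1 l1 k2 l2 k3 l3 :: int where
      e: "a = g [^] k1 \<otimes> h [^] l1" "b = g [^] k2 \<otimes> h [^] l2" "c = g [^] k3 \<otimes> h [^] l3"
      using gen carr by metis
    have relation: "p = 0 \<and> q = 0 \<and> r = 0"
      if pqr: "p * k1 + q * k2 + r * k3 = 0" "p * l1 + q * l2 + r * l3 = 0" for p q r :: int
    proof -
      define d where "d x = (if x = a then p else if x = b then q else if x = c then r else 0)" for x
      have Seq: "S = insert a (insert b (insert c (S - {a, b, c})))" using abc by auto
      have rest: "finprod G (\<lambda>x. x [^] d x) (S - {a, b, c}) = \<one>"
        using S by (intro finprod_one_eqI) (auto simp: d_def)
      have mem: "(\<lambda>x. x [^] d x) \<in> S \<rightarrow> carrier G" using S by auto
      have "finprod G (\<lambda>x. x [^] d x) S = a [^] p \<otimes> (b [^] q \<otimes> (c [^] r \<otimes> \<one>))"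
        apply (subst Seq)
        using S abc carr mem rest
        by (subst finprod_insert; (force simp: d_def)?)+
      also have "\<dots> = g [^] (p * k1 + q * k2 + r * k3) \<otimes> h [^] (p * l1 + q * l2 + r * l3)"
        using gh by (simp add: e int_pow_mult_distrib[OF m_comm] int_pow_pow int_pow_mult m_ac mult.commute)
      also have "\<dots> = \<one>" using pqr gh by simp
      finally have "\<forall>x\<in>S. d x = 0" by (rule ind)
      then have "d a = 0" "d b = 0" "d c = 0" using abc by auto
      then show ?thesis using abc by (auto simp: d_def)
    qed
    \<comment> \<open>The cross product is orthogonal to both rows, hence zero, so the three vectors are parallel. Then the first two satisfy obvious relations.\<close>
    have "k2 * l3 - k3 * l2 = 0 \<and> k3 * l1 - k1 * l3 = 0 \<and> k1 * l2 - k2 * l1 = 0"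
      by (rule relation) (auto simp: algebra_simps)
    then have "k2 = 0 \<and> - k1 = 0 \<and> (0::int) = 0" "l2 = 0 \<and> - l1 = 0 \<and> (0::int) = 0"
      by (intro relation; simp add: algebra_simps)+
    then have "(1::int) = 0 \<and> (0::int) = 0 \<and> (0::int) = 0" by (intro relation) auto
    then show False by simp
  qed
  then show "enat (card S) \<le> 2" by (metis enat_ord_simps(1) numeral_eq_enat)
qed

text \<open>The image of \<open>h\<close> is a subgroup of a cyclic group, hence cyclic; \<open>x0\<close> is chosen over a generator of
  the image.\<close>

lemma (in group_hom) hom_to_cyclic:
  assumes g: "g \<in> carrier H" and cyc: "\<And>y. y \<in> carrier H \<Longrightarrow> \<exists>n::int. y = g [^]\<^bsub>H\<^esub> n"
  shows "\<exists>x0\<in>carrier G. \<forall>x\<in>carrier G. \<exists>k::int. x \<otimes> x0 [^] k \<in> kernel G H h"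
proof (cases "\<exists>d::nat. d > 0 \<and> (\<exists>x\<in>carrier G. h x = g [^]\<^bsub>H\<^esub> int d)")
  case False
  have "h x = \<one>\<^bsub>H\<^esub>" if x: "x \<in> carrier G" for x
  proof -
    from cyc[OF hom_closed[OF x]] obtain n where n: "h x = g [^]\<^bsub>H\<^esub> (n::int)" ..
    have not_pos: "\<not> m > 0" if "z \<in> carrier G" "h z = g [^]\<^bsub>H\<^esub> m" for z and m :: int
    proof
      assume "m > 0"
      then have "m = int (nat m)" "nat m > 0" by auto
      then show False using False that by metis
    qed
    have "h (inv x) = g [^]\<^bsub>H\<^esub> (- n)" using x g n by (simp add: H.int_pow_neg)
    then have "\<not> n < 0" using not_pos[of "inv x" "- n"] x by simp
    moreover have "\<not> n > 0" using not_pos[OF x n] .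
    ultimately have "n = 0" by simp
    then show ?thesis using n by simp
  qed
  then show ?thesis by (intro bexI[of _ \<one>]) (auto simp: kernel_def)
next
  case True
  define P where "P d \<longleftrightarrow> d > 0 \<and> (\<exists>x\<in>carrier G. h x = g [^]\<^bsub>H\<^esub> int d)" for d :: nat
  \<comment> \<open>The least positive exponent in the image divides all the others.\<close>
  define d where "d = (LEAST d. P d)"
  have "\<exists>d. P d" using True unfolding P_def .
  then have "P d" unfolding d_def by (rule LeastI_ex)
  have least: "d \<le> e" if "P e" for e unfolding d_def using that by (rule Least_le)
  from \<open>P d\<close> obtain x0 where x0: "x0 \<in> carrier G" "h x0 = g [^]\<^bsub>H\<^esub> int d" and d: "d > 0" by (auto simp: P_def)
  show ?thesis
  proof (intro bexI[OF _ x0(1)] ballI)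
    fix x assume x: "x \<in> carrier G"
    from cyc[OF hom_closed[OF x]] obtain n where n: "h x = g [^]\<^bsub>H\<^esub> (n::int)" ..
    define y where "y = x \<otimes> x0 [^] (- (n div int d))"
    have y: "y \<in> carrier G" using x x0 by (simp add: y_def)
    have "h y = g [^]\<^bsub>H\<^esub> n \<otimes>\<^bsub>H\<^esub> (g [^]\<^bsub>H\<^esub> int d) [^]\<^bsub>H\<^esub> (- (n div int d))"
      using x x0 n by (simp add: y_def hom_int_pow)
    also have "\<dots> = g [^]\<^bsub>H\<^esub> (n + int d * (- (n div int d)))"
      using g by (simp only: H.int_pow_pow H.int_pow_mult)
    also have "n + int d * (- (n div int d)) = n mod int d"
      by (simp add: minus_mult_div_eq_mod)
    finally have hy: "h y = g [^]\<^bsub>H\<^esub> (n mod int d)" .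
    have "n mod int d = 0"
    proof (rule ccontr)
      assume nz: "n mod int d \<noteq> 0"
      moreover have "n mod int d \<ge> 0" using d by simp
      ultimately have pos: "n mod int d > 0" by linarith
      have "h y = g [^]\<^bsub>H\<^esub> int (nat (n mod int d))" using hy pos by simp
      then have "P (nat (n mod int d))" unfolding P_def using pos y by (intro conjI bexI[of _ y]) simp_all
      then have "int d \<le> n mod int d" using least[of "nat (n mod int d)"] pos by linarith
      moreover have "n mod int d < int d" by (rule pos_mod_bound) (use d in simp)
      ultimately show False by linarith
    qed
    then have "h y = \<one>\<^bsub>H\<^esub>" using hy by simp
    then show "\<exists>k::int. x \<otimes> x0 [^] k \<in> kernel G H h" using y by (auto simp: kernel_def y_def)
  qed
qed

definition point_class :: "'a topology \<Rightarrow> 'a \<Rightarrow> 'a chain set" where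
  "point_class X a = homologous_rel_set 0 X {} (frag_of (restrict (\<lambda>_. a) (standard_simplex 0)))"

lemma point_class_relcycle:
  "a \<in> topspace X \<Longrightarrow> singular_relcycle 0 X {} (frag_of (restrict (\<lambda>_. a) (standard_simplex 0)))"
  by (simp add: chain_boundary_def singular_chain_of singular_cycle singular_simplex_def)

lemma point_class_carrier: "a \<in> topspace X \<Longrightarrow> point_class X a \<in> carrier (homology_group 0 X)"
  unfolding point_class_def carrier_relative_homology_group_0
  by (rule imageI, rule CollectI, rule point_class_relcycle)

lemma hom_induced_point_class:
  assumes "continuous_map X Y f" "a \<in> topspace X"
  shows "hom_induced 0 X {} Y {} f (point_class X a) = point_class Y (f a)"
proof -
  have "simplex_map 0 f (restrict (\<lambda>_. a) (standard_simplex 0)) = restrict (\<lambda>_. f a) (standard_simplex 0)"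
    by (auto simp: simplex_map_def)
  then show ?thesis
    using hom_induced_chain_map[OF assms(1) _ point_class_relcycle[OF assms(2)], of "{}"]
    by (simp add: point_class_def chain_map_of)
qed

lemma zeroth_homology_point_class:
  assumes "path_connected_space X" "a \<in> topspace X"
  shows "pow (homology_group 0 X) (point_class X a) \<in> iso integer_group (homology_group 0 X)"
  unfolding point_class_def
  by (rule iso_integer_zeroth_homology_group[OF assms(1)]) (simp add: singular_simplex_def assms(2))

text \<open>The zeroth homology is generated by the classes of the points \<open>a\<close> and \<open>b\<close>. The augmentation sends
  both to a generator of an infinite cyclic group, so its kernel consists of the powers of the
  difference of the two classes.\<close>

lemma reduced_homology_group_two_components:
  assumes C: "openin X C1" "openin X C2" "disjnt C1 C2" "C1 \<union> C2 = topspace X"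
    "path_connectedin X C1" "path_connectedin X C2" "a \<in> C1" "b \<in> C2"
  shows "\<exists>g\<in>carrier (reduced_homology_group 0 X). \<forall>x\<in>carrier (reduced_homology_group 0 X).
           \<exists>n::int. x = g [^]\<^bsub>reduced_homology_group 0 X\<^esub> n"
proof -
  let ?H = "homology_group 0 X" and ?P = "discrete_topology {()}"
  let ?e = "hom_induced 0 X {} ?P {} (\<lambda>x. ())"
  let ?i1 = "hom_induced 0 (subtopology X C1) {} X {} id" and ?i2 = "hom_induced 0 (subtopology X C2) {} X {} id"
  interpret H: comm_group ?H by (rule abelian_homology_group)
  interpret P: comm_group "homology_group 0 ?P" by (rule abelian_homology_group)
  have top: "a \<in> topspace X" "b \<in> topspace X" using C by auto
  have cont: "continuous_map X ?P (\<lambda>x. ())" by auto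
  interpret e: group_hom ?H "homology_group 0 ?P" ?e
    by (simp add: group_hom_def group_hom_axioms_def hom_induced_empty_hom)
  define \<alpha> where "\<alpha> = point_class X a"
  define \<beta> where "\<beta> = point_class X b"
  define \<gamma> where "\<gamma> = point_class ?P ()"
  have carr: "\<alpha> \<in> carrier ?H" "\<beta> \<in> carrier ?H" "\<gamma> \<in> carrier (homology_group 0 ?P)"
    using top by (auto simp: \<alpha>_def \<beta>_def \<gamma>_def point_class_carrier)
  have e: "?e \<alpha> = \<gamma>" "?e \<beta> = \<gamma>"
    unfolding \<alpha>_def \<beta>_def \<gamma>_def using hom_induced_point_class[OF cont] top by auto
  have span: "\<exists>(k::int) (l::int). x = \<alpha> [^]\<^bsub>?H\<^esub> k \<otimes>\<^bsub>?H\<^esub> \<beta> [^]\<^bsub>?H\<^esub> l" if x: "x \<in> carrier ?H" for x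
  proof -
    have comp: "\<exists>k::int. hom_induced 0 (subtopology X D) {} X {} id u = point_class X d [^]\<^bsub>?H\<^esub> k"
      if u: "u \<in> carrier (homology_group 0 (subtopology X D))" and D: "path_connectedin X D" "d \<in> D" for u D d
    proof -
      let ?HD = "homology_group 0 (subtopology X D)"
      have sub: "D \<subseteq> topspace X" "path_connected_space (subtopology X D)" using D by (auto simp: path_connectedin_def)
      then have d: "d \<in> topspace (subtopology X D)" using D by auto
      obtain k :: int where k: "u = point_class (subtopology X D) d [^]\<^bsub>?HD\<^esub> k"
        using zeroth_homology_point_class[OF sub(2) d] u by (auto simp: iso_def bij_betw_def)
      interpret i: group_hom ?HD ?H "hom_induced 0 (subtopology X D) {} X {} id"
        by (simp add: group_hom_def group_hom_axioms_def hom_induced_empty_hom)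
      have "hom_induced 0 (subtopology X D) {} X {} id (point_class (subtopology X D) d) = point_class X d"
        using hom_induced_point_class[of "subtopology X D" X id, OF _ d] by (simp add: continuous_map_from_subtopology)
      then show ?thesis using k point_class_carrier[OF d] i.hom_int_pow by metis
    qed
    have "x \<in> (\<lambda>(u, v). ?i1 u \<otimes>\<^bsub>?H\<^esub> ?i2 v) ` (carrier (homology_group 0 (subtopology X C1)) \<times>
        carrier (homology_group 0 (subtopology X C2)))"
      using homology_additivity_explicit[OF C(1-4), of 0] x by (auto simp: iso_def bij_betw_def DirProd_def)
    then obtain u v where "u \<in> carrier (homology_group 0 (subtopology X C1))"
      "v \<in> carrier (homology_group 0 (subtopology X C2))" "x = ?i1 u \<otimes>\<^bsub>?H\<^esub> ?i2 v" by auto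
    then show ?thesis using comp C(5-8) unfolding \<alpha>_def \<beta>_def by metis
  qed
  define g where "g = \<alpha> \<otimes>\<^bsub>?H\<^esub> inv\<^bsub>?H\<^esub> \<beta>"
  let ?R = "reduced_homology_group 0 X"
  have kerR: "carrier ?R = kernel ?H (homology_group 0 ?P) ?e" by (rule carrier_reduced_homology_group)
  have gR: "g \<in> carrier ?R" using carr e by (simp add: kerR kernel_def g_def)
  have powR: "g [^]\<^bsub>?R\<^esub> (n::int) = g [^]\<^bsub>?H\<^esub> n" for n
    using gR carr unfolding reduced_homology_group_def
    by (intro H.int_pow_subgroup_generated) (auto simp: kerR)
  show ?thesis
  proof (intro bexI[OF _ gR] ballI)
    fix x assume "x \<in> carrier ?R"
    then have x: "x \<in> carrier ?H" "?e x = \<one>\<^bsub>homology_group 0 ?P\<^esub>" by (auto simp: kerR kernel_def)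
    then obtain k l :: int where kl: "x = \<alpha> [^]\<^bsub>?H\<^esub> k \<otimes>\<^bsub>?H\<^esub> \<beta> [^]\<^bsub>?H\<^esub> l" using span[OF x(1)] by (elim exE)
    have "?e x = \<gamma> [^]\<^bsub>homology_group 0 ?P\<^esub> k \<otimes>\<^bsub>homology_group 0 ?P\<^esub> \<gamma> [^]\<^bsub>homology_group 0 ?P\<^esub> l"
      using carr by (simp add: kl e.hom_int_pow e)
    then have "\<gamma> [^]\<^bsub>homology_group 0 ?P\<^esub> (k + l) = \<gamma> [^]\<^bsub>homology_group 0 ?P\<^esub> (0::int)"
      using x(2) carr by (simp add: P.int_pow_mult)
    moreover have "inj_on (pow (homology_group 0 ?P) \<gamma>) (UNIV :: int set)"
    proof -
      have "path_connected_space ?P"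
        by (metis path_connectedin_singleton path_connectedin_topspace topspace_discrete_topology UNIV_unit insertI1)
      then show ?thesis
        using zeroth_homology_point_class[of ?P "()"] by (auto simp: \<gamma>_def iso_def bij_betw_def)
    qed
    ultimately have "k + l = 0" by (metis injD)
    then have "l = - k" by simp
    then have "x = g [^]\<^bsub>?H\<^esub> k"
      using carr by (simp add: kl g_def H.int_pow_mult_distrib[OF H.m_comm] H.int_pow_inv H.int_pow_neg)
    then show "\<exists>n::int. x = g [^]\<^bsub>?R\<^esub> n" using powR by metis
  qed
qed

text \<open>By the exact sequence of the pair, the first homology of \<open>X\<close> modulo the image of that of \<open>U\<close> embeds
  into the first homology of \<open>(X, U)\<close>. Excision replaces this pair by \<open>(V, U \<inter> V)\<close>, and as \<open>V\<close> is
  contractible, the boundary map identifies the relative group with the reduced zeroth homology of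
  \<open>U \<inter> V\<close>, which is cyclic.\<close>

lemma homology_group_attach_band:
  assumes UV: "openin X U" "openin X V" "U \<union> V = topspace X" and V: "contractible_space (subtopology X V)"
    and C: "openin X C1" "openin X C2" "disjnt C1 C2" "C1 \<union> C2 = U \<inter> V"
      "path_connectedin X C1" "path_connectedin X C2" "a \<in> C1" "b \<in> C2"
  shows "\<exists>g\<in>carrier (homology_group 1 X). \<forall>x\<in>carrier (homology_group 1 X).
    \<exists>k::int. \<exists>u\<in>carrier (homology_group 1 (subtopology X U)).
      x = hom_induced 1 (subtopology X U) {} X {} id u \<otimes>\<^bsub>homology_group 1 X\<^esub> g [^]\<^bsub>homology_group 1 X\<^esub> k"
proof -
  let ?G = "homology_group 1 X" and ?XU = "relative_homology_group 1 X U"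
  let ?Y = "subtopology X V"
  let ?VU = "relative_homology_group 1 ?Y (U \<inter> V)" and ?R = "reduced_homology_group 0 (subtopology ?Y (U \<inter> V))"
  interpret G: comm_group ?G by (rule abelian_homology_group)
  have sub: "U \<subseteq> topspace X" "V \<subseteq> topspace X" using UV by (auto dest: openin_subset)
  \<comment> \<open>The set to be excised.\<close>
  define Z where "Z = topspace X - V"
  have "closedin X Z" using UV by (auto simp: Z_def)
  then have "X closure_of Z \<subseteq> X interior_of U"
    using UV by (auto simp: closure_of_closedin interior_of_openin Z_def)
  note homology_excision_axiom[OF this sub(1), of 1]
  moreover have "topspace X - Z = V" "U - Z = U \<inter> V" using sub by (auto simp: Z_def)
  ultimately have exc: "hom_induced 1 ?Y (U \<inter> V) X U id \<in> iso ?VU ?XU" by simp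
  have gr: "group ?XU" "group ?VU" "group ?R" by simp_all
  define ex where "ex = inv_into (carrier ?VU) (hom_induced 1 ?Y (U \<inter> V) X U id)"
  have ex: "ex \<in> iso ?XU ?VU" unfolding ex_def by (rule group.iso_set_sym[OF gr(2) exc])
  have "topspace ?Y \<inter> (U \<inter> V) \<noteq> {}" using C sub by auto
  from iso_relative_homology_of_contractible[OF V this, of 1]
  have bd: "hom_boundary 1 ?Y (U \<inter> V) \<in> iso ?VU ?R" by simp
  define \<psi> where "\<psi> = hom_boundary 1 ?Y (U \<inter> V) \<circ> ex"
  have \<psi>: "\<psi> \<in> iso ?XU ?R" unfolding \<psi>_def by (rule iso_set_trans[OF ex bd])
  let ?j = "hom_induced 1 X {} X U id"
  have ex3: "exact_seq ([?XU, ?G, homology_group 1 (subtopology X U)],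
       [?j, hom_induced 1 (subtopology X U) {} X {} id])" by (rule homology_exactness_axiom_3)
  then have ker: "hom_induced 1 (subtopology X U) {} X {} id ` carrier (homology_group 1 (subtopology X U)) = kernel ?G ?XU ?j"
    by simp
  have jhom: "?j \<in> hom ?G ?XU" by (simp add: hom_induced_hom)
  have hom: "\<psi> \<circ> ?j \<in> hom ?G ?R" using jhom \<psi> by (auto simp: iso_def intro: hom_compose)
  interpret f: group_hom ?G ?R "\<psi> \<circ> ?j"
    using gr hom by (simp add: group_hom_def group_hom_axioms_def)
  have ker2: "kernel ?G ?R (\<psi> \<circ> ?j) \<subseteq> kernel ?G ?XU ?j"
  proof
    fix x assume "x \<in> kernel ?G ?R (\<psi> \<circ> ?j)"
    then have x: "x \<in> carrier ?G" "\<psi> (?j x) = \<one>\<^bsub>?R\<^esub>" by (auto simp: kernel_def)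
    have "\<psi> \<in> hom ?XU ?R" using \<psi> by (simp add: iso_def)
    then have "\<psi> \<one>\<^bsub>?XU\<^esub> = \<one>\<^bsub>?R\<^esub>" using gr hom_one by blast
    moreover have "?j x \<in> carrier ?XU" using jhom x(1) by (auto simp: hom_def)
    moreover have "inj_on \<psi> (carrier ?XU)" using \<psi> by (auto simp: iso_def bij_betw_def)
    ultimately have "?j x = \<one>\<^bsub>?XU\<^esub>" using x(2) gr by (metis inj_onD group.is_monoid monoid.one_closed)
    then show "x \<in> kernel ?G ?XU ?j" using x by (simp add: kernel_def)
  qed
  have subUV: "subtopology ?Y (U \<inter> V) = subtopology X (U \<inter> V)" by (simp add: subtopology_subtopology Int_absorb1)
  have "\<exists>g\<in>carrier ?R. \<forall>x\<in>carrier ?R. \<exists>n::int. x = g [^]\<^bsub>?R\<^esub> n"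
    unfolding subUV
  proof (rule reduced_homology_group_two_components[OF _ _ C(3) _ _ _ C(7,8)])
    show "openin (subtopology X (U \<inter> V)) C1" "openin (subtopology X (U \<inter> V)) C2"
      using C by (auto simp: openin_subtopology_alt intro!: image_eqI)
    show "C1 \<union> C2 = topspace (subtopology X (U \<inter> V))" using C sub by auto
    show "path_connectedin (subtopology X (U \<inter> V)) C1" "path_connectedin (subtopology X (U \<inter> V)) C2"
      using C by (auto simp: path_connectedin_subtopology)
  qed
  then obtain r where r: "r \<in> carrier ?R" "\<forall>x\<in>carrier ?R. \<exists>n::int. x = r [^]\<^bsub>?R\<^esub> n" by (elim bexE)
  have "\<exists>g\<in>carrier ?G. \<forall>x\<in>carrier ?G. \<exists>k::int. x \<otimes>\<^bsub>?G\<^esub> g [^]\<^bsub>?G\<^esub> k \<in> kernel ?G ?R (\<psi> \<circ> ?j)"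
    by (rule f.hom_to_cyclic[OF r(1)]) (rule bspec[OF r(2)])
  then obtain g where g: "g \<in> carrier ?G"
    "\<forall>x\<in>carrier ?G. \<exists>k::int. x \<otimes>\<^bsub>?G\<^esub> g [^]\<^bsub>?G\<^esub> k \<in> kernel ?G ?R (\<psi> \<circ> ?j)" by (elim bexE)
  show ?thesis
  proof (intro bexI[OF _ g(1)] ballI)
    fix x assume x: "x \<in> carrier ?G"
    from bspec[OF g(2) x] obtain k :: int where "x \<otimes>\<^bsub>?G\<^esub> g [^]\<^bsub>?G\<^esub> k \<in> kernel ?G ?R (\<psi> \<circ> ?j)" ..
    then have "x \<otimes>\<^bsub>?G\<^esub> g [^]\<^bsub>?G\<^esub> k \<in>
        hom_induced 1 (subtopology X U) {} X {} id ` carrier (homology_group 1 (subtopology X U))"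
      unfolding ker by (rule subsetD[OF ker2])
    then obtain u where u: "u \<in> carrier (homology_group 1 (subtopology X U))"
      "x \<otimes>\<^bsub>?G\<^esub> g [^]\<^bsub>?G\<^esub> k = hom_induced 1 (subtopology X U) {} X {} id u" by (elim imageE)
    have "x = (x \<otimes>\<^bsub>?G\<^esub> g [^]\<^bsub>?G\<^esub> k) \<otimes>\<^bsub>?G\<^esub> g [^]\<^bsub>?G\<^esub> (- k)"
      using x g(1) by (simp add: G.m_assoc flip: G.int_pow_mult)
    then show "\<exists>k::int. \<exists>u\<in>carrier (homology_group 1 (subtopology X U)).
      x = hom_induced 1 (subtopology X U) {} X {} id u \<otimes>\<^bsub>?G\<^esub> g [^]\<^bsub>?G\<^esub> k"
      unfolding u(2) by (intro exI[of _ "- k"] bexI[OF _ u(1)])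
  qed
qed

text \<open>Two bands attached to a contractible set: the first homology is generated by two elements.\<close>

lemma betti_number_two_bands:
  assumes hom: "Y homeomorphic_space X"
    and UV: "openin X U" "openin X V" "U \<union> V = topspace X" "contractible_space (subtopology X V)"
    and C: "openin X C1" "openin X C2" "disjnt C1 C2" "C1 \<union> C2 = U \<inter> V"
      "path_connectedin X C1" "path_connectedin X C2" "a \<in> C1" "b \<in> C2"
    and UV': "openin X U'" "openin X V'" "U' \<union> V' = U" "contractible_space (subtopology X V')"
      "contractible_space (subtopology X U')"
    and C': "openin X C1'" "openin X C2'" "disjnt C1' C2'" "C1' \<union> C2' = U' \<inter> V'"
      "path_connectedin X C1'" "path_connectedin X C2'" "a' \<in> C1'" "b' \<in> C2'"
  shows "betti_number 1 Y \<le> 2"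
proof -
  let ?G = "homology_group 1 X" and ?GU = "homology_group 1 (subtopology X U)"
    and ?GY = "homology_group 1 Y"
  let ?i = "hom_induced 1 (subtopology X U) {} X {} id"
    and ?i' = "hom_induced 1 (subtopology X U') {} (subtopology X U) {} id"
  interpret G: comm_group ?G by (rule abelian_homology_group)
  interpret GU: comm_group ?GU by (rule abelian_homology_group)
  interpret GY: comm_group ?GY by (rule abelian_homology_group)
  interpret i: group_hom ?GU ?G ?i
    by (simp add: group_hom_def group_hom_axioms_def hom_induced_empty_hom)
  from homology_group_attach_band[OF UV C] obtain g where g: "g \<in> carrier ?G"
    "\<forall>x\<in>carrier ?G. \<exists>k::int. \<exists>u\<in>carrier ?GU. x = ?i u \<otimes>\<^bsub>?G\<^esub> g [^]\<^bsub>?G\<^esub> k" ..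
  have sub: "U \<subseteq> topspace X" "U' \<subseteq> U" "V' \<subseteq> U" using UV(1) UV'(3) by (auto dest: openin_subset)
  have sUU: "subtopology (subtopology X U) U' = subtopology X U'" "subtopology (subtopology X U) V' = subtopology X V'"
    using sub by (auto simp: subtopology_subtopology Int_absorb1)
  have opn: "openin (subtopology X U) W" if "openin X W" "W \<subseteq> U" for W
    using that by (metis openin_subtopology_Int2 Int_absorb1)
  have "\<exists>g\<in>carrier ?GU. \<forall>x\<in>carrier ?GU. \<exists>k::int. \<exists>u\<in>carrier (homology_group 1 (subtopology X U')).
      x = ?i' u \<otimes>\<^bsub>?GU\<^esub> g [^]\<^bsub>?GU\<^esub> k"
    unfolding sUU(1)[symmetric]
  proof (rule homology_group_attach_band[OF _ _ _ _ _ _ C'(3,4) _ _ C'(7,8)])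
    show "contractible_space (subtopology (subtopology X U) V')" unfolding sUU by (rule UV'(4))
    show "openin (subtopology X U) U'" "openin (subtopology X U) V'" using opn UV' sub by auto
    have CU: "C1' \<subseteq> U" "C2' \<subseteq> U" using C'(4) sub by auto
    then show "openin (subtopology X U) C1'" "openin (subtopology X U) C2'"
      "path_connectedin (subtopology X U) C1'" "path_connectedin (subtopology X U) C2'"
      using opn C' by (auto simp: path_connectedin_subtopology)
    show "U' \<union> V' = topspace (subtopology X U)" using UV'(3) sub by auto
  qed
  then obtain h where h: "h \<in> carrier ?GU" "\<forall>x\<in>carrier ?GU. \<exists>k::int. \<exists>u\<in>carrier (homology_group 1 (subtopology X U')).
      x = ?i' u \<otimes>\<^bsub>?GU\<^esub> h [^]\<^bsub>?GU\<^esub> k" by (elim bexE)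
  have "trivial_group (homology_group 1 (subtopology X U'))"
    using trivial_reduced_homology_group_contractible_space[OF UV'(5), of 1] by (simp add: un_reduced_homology_group)
  then have triv: "u = \<one>\<^bsub>homology_group 1 (subtopology X U')\<^esub>" if "u \<in> carrier (homology_group 1 (subtopology X U'))" for u
    using that by (auto simp: trivial_group_def)
  have i'1: "?i' \<one>\<^bsub>homology_group 1 (subtopology X U')\<^esub> = \<one>\<^bsub>?GU\<^esub>"
    by (rule hom_one[OF hom_induced_empty_hom]) simp_all
  have gen: "\<exists>(k::int) (l::int). x = g [^]\<^bsub>?G\<^esub> k \<otimes>\<^bsub>?G\<^esub> ?i h [^]\<^bsub>?G\<^esub> l" if x: "x \<in> carrier ?G" for x
  proof -
    from bspec[OF g(2) x] obtain k :: int and u where u: "u \<in> carrier ?GU" "x = ?i u \<otimes>\<^bsub>?G\<^esub> g [^]\<^bsub>?G\<^esub> k"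
      by (elim exE bexE)
    from bspec[OF h(2) u(1)] obtain l :: int and v where v: "v \<in> carrier (homology_group 1 (subtopology X U'))"
      "u = ?i' v \<otimes>\<^bsub>?GU\<^esub> h [^]\<^bsub>?GU\<^esub> l" by (elim exE bexE)
    have "u = h [^]\<^bsub>?GU\<^esub> l" using v h(1) triv[OF v(1)] i'1 by simp
    then have "x = g [^]\<^bsub>?G\<^esub> k \<otimes>\<^bsub>?G\<^esub> ?i h [^]\<^bsub>?G\<^esub> l"
      using u(2) g(1) h(1) by (simp add: i.hom_int_pow G.m_comm)
    then show ?thesis by (intro exI)
  qed
  have "?G \<cong> ?GY"
    by (rule homeomorphic_space_imp_isomorphic_homology_groups[OF iffD1[OF homeomorphic_space_sym hom]])
  then obtain f where f: "f \<in> iso ?G ?GY" by (auto simp: is_iso_def)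
  then interpret f: group_hom ?G ?GY f
    by (simp add: group_hom_def group_hom_axioms_def iso_def)
  show ?thesis unfolding betti_number_def of_nat_1
  proof (rule GY.abelian_group_rank_le_two)
    show "f g \<in> carrier ?GY" "f (?i h) \<in> carrier ?GY" using g(1) h(1) by auto
    fix y assume "y \<in> carrier ?GY"
    then obtain x where x: "x \<in> carrier ?G" "y = f x" using f by (auto simp: iso_def bij_betw_def)
    from gen[OF x(1)] obtain k l :: int where "x = g [^]\<^bsub>?G\<^esub> k \<otimes>\<^bsub>?G\<^esub> ?i h [^]\<^bsub>?G\<^esub> l" by (elim exE)
    then have "y = f g [^]\<^bsub>?GY\<^esub> k \<otimes>\<^bsub>?GY\<^esub> f (?i h) [^]\<^bsub>?GY\<^esub> l"
      using x(2) g(1) h(1) by (simp add: f.hom_int_pow)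
    then show "\<exists>(k::int) (l::int). y = f g [^]\<^bsub>?GY\<^esub> k \<otimes>\<^bsub>?GY\<^esub> f (?i h) [^]\<^bsub>?GY\<^esub> l" by (intro exI)
  qed
qed

section \<open>The disc\<close>

lemma norm_le_1_iff_Re_Im: "cmod z \<le> 1 \<longleftrightarrow> (Re z)\<^sup>2 + (Im z)\<^sup>2 \<le> 1"
  by (simp add: cmod_def real_sqrt_le_1_iff)

lemma norm_eq_1_iff_Re_Im: "cmod z = 1 \<longleftrightarrow> (Re z)\<^sup>2 + (Im z)\<^sup>2 = 1"
  by (simp add: cmod_def real_sqrt_eq_1_iff)

text \<open>A defining function of the unit circle, positive inside and zero on the circle. It replaces the
  distance to the boundary as a coordinate because it is polynomial.\<close>

definition bdist :: "complex \<Rightarrow> real" where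
  "bdist \<zeta> = 1 - (Re \<zeta>)\<^sup>2 - (Im \<zeta>)\<^sup>2"

lemma bdist_mult_unit: "cmod u = 1 \<Longrightarrow> bdist (u * \<zeta>) = bdist \<zeta>"
  by (metis (no_types, lifting) bdist_def cmod_power2 diff_diff_eq mult_1 norm_mult)

lemma cball_iff_bdist: "\<zeta> \<in> cball 0 1 \<longleftrightarrow> bdist \<zeta> \<ge> 0"
  by (auto simp: bdist_def norm_le_1_iff_Re_Im)

lemma smooth_on_bdist: "smooth_on S f \<Longrightarrow> smooth_on S (\<lambda>x. bdist (f x))"
  unfolding bdist_def by (intro smooth_on_intros)

text \<open>The half disc centred at \<open>u\<close>, with \<open>bdist\<close> as second coordinate, so that the unit circle corresponds
  to the edge of the half plane.\<close>

lemma disc_boundary_chart: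
  assumes u: "cmod u = 1"
  defines "V \<equiv> {x :: real^2. 0 \<le> x $ 2 \<and> (x $ 1)\<^sup>2 + x $ 2 < 1}"
    and "f \<equiv> (\<lambda>x :: real^2. u * Complex (sqrt (1 - (x $ 1)\<^sup>2 - x $ 2)) (x $ 1))"
    and "g \<equiv> (\<lambda>\<zeta>. vector [Im (cnj u * \<zeta>), bdist \<zeta>] :: real^2)"
  shows "local_param (cball 0 1) (V, f, g)" "f ` V = cball 0 1 \<inter> {\<zeta>. Re (cnj u * \<zeta>) > 0}"
proof -
  have uu: "cnj u * (u * z) = z" "u * (cnj u * z) = z" for z
  proof -
    have "cnj u * u = 1" using u complex_norm_square[of u] by (simp add: mult.commute)
    then show "cnj u * (u * z) = z" "u * (cnj u * z) = z"
      by (simp_all add: mult.assoc[symmetric] mult.commute[of u])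
  qed
  have A: "open {x :: real^2. (x $ 1)\<^sup>2 + x $ 2 < 1}" "open {\<zeta>. Re (cnj u * \<zeta>) > 0}"
    by (intro open_Collect_less continuous_intros)+
  have V: "V = half_plane \<inter> {x :: real^2. (x $ 1)\<^sup>2 + x $ 2 < 1}"
    by (auto simp: V_def half_plane_def)
  have fV: "f x \<in> cball 0 1 \<inter> {\<zeta>. Re (cnj u * \<zeta>) > 0} \<and> g (f x) = x" if "x \<in> V" for x
  proof -
    have pos: "1 - (x $ 1)\<^sup>2 - x $ 2 > 0" "x $ 2 \<ge> 0" using that by (auto simp: V_def)
    have "bdist (f x) = x $ 2" unfolding f_def bdist_mult_unit[OF u] using pos by (simp add: bdist_def)
    moreover have eq: "cnj u * f x = Complex (sqrt (1 - (x $ 1)\<^sup>2 - x $ 2)) (x $ 1)" by (simp only: f_def uu)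
    ultimately have "g (f x) = x" unfolding g_def vector2_eq_iff eq by simp
    moreover have "Re (cnj u * f x) > 0" unfolding eq using pos by simp
    ultimately show ?thesis using pos \<open>bdist (f x) = x $ 2\<close> unfolding cball_iff_bdist Int_iff mem_Collect_eq
      by (intro conjI) simp_all
  qed
  have gU: "g p \<in> V \<and> f (g p) = p" if p: "p \<in> cball 0 1 \<inter> {\<zeta>. Re (cnj u * \<zeta>) > 0}" for p
  proof -
    define z where "z = cnj u * p"
    have p_eq: "p = u * z" by (simp only: z_def uu)
    have z: "Re z > 0" "bdist z \<ge> 0" "bdist p = bdist z"
      using p bdist_mult_unit[OF u, of z] unfolding p_eq[symmetric] cball_iff_bdist Int_iff by (auto simp: z_def)
    have "(Re z)\<^sup>2 > 0" using z by simp
    then have "1 - (Im z)\<^sup>2 - bdist z > 0" "sqrt (1 - (Im z)\<^sup>2 - bdist z) = Re z" using z by (auto simp: bdist_def)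
    then have "f (g p) = u * Complex (Re z) (Im z)"
      by (simp only: f_def g_def vector_2 z_def[symmetric] z(3))
    moreover have "g p \<in> V" using \<open>1 - (Im z)\<^sup>2 - bdist z > 0\<close> z(2)
      unfolding V_def g_def mem_Collect_eq vector_2 z_def[symmetric] z(3) by simp
    ultimately show ?thesis using p_eq by (simp only: complex_surj)
  qed
  have "smooth_on V f" unfolding f_def by (intro smooth_on_intros) (auto simp: V_def)
  moreover have "smooth_on (cball 0 1 \<inter> {\<zeta>. Re (cnj u * \<zeta>) > 0}) g"
    unfolding g_def by (intro smooth_on_intros smooth_on_bdist)
  ultimately show "local_param (cball 0 1) (V, f, g)" "f ` V = cball 0 1 \<inter> {\<zeta>. Re (cnj u * \<zeta>) > 0}"
    using local_paramI[OF A(1) V A(2) fV gU] by blast+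
qed

text \<open>The shift by 2 moves the open unit disc into the open half plane.\<close>

lemma disc_interior_chart:
  defines "V \<equiv> {x :: real^2. (x $ 1)\<^sup>2 + (x $ 2 - 2)\<^sup>2 < 1}"
    and "f \<equiv> (\<lambda>x :: real^2. Complex (x $ 1) (x $ 2 - 2))"
    and "g \<equiv> (\<lambda>\<zeta>. vector [Re \<zeta>, Im \<zeta> + 2] :: real^2)"
  shows "local_param (cball 0 1) (V, f, g)" "f ` V = cball 0 1 \<inter> {\<zeta>. bdist \<zeta> > 0}"
proof -
  have A: "open {x :: real^2. (x $ 1)\<^sup>2 + (x $ 2 - 2)\<^sup>2 < 1}" "open {\<zeta>. bdist \<zeta> > 0}"
    unfolding bdist_def by (intro open_Collect_less continuous_intros)+
  have "x $ 2 \<ge> 0" if "(x $ 1)\<^sup>2 + (x $ 2 - 2)\<^sup>2 < 1" for x :: "real^2"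
  proof -
    have "(x $ 2 - 2)\<^sup>2 < 1" using that zero_le_power2[of "x $ 1"] by linarith
    then have "\<bar>x $ 2 - 2\<bar> < 1" by (simp add: abs_square_less_1)
    then show ?thesis by simp
  qed
  then have V: "V = half_plane \<inter> {x :: real^2. (x $ 1)\<^sup>2 + (x $ 2 - 2)\<^sup>2 < 1}"
    by (auto simp: V_def half_plane_def)
  have fV: "f x \<in> cball 0 1 \<inter> {\<zeta>. bdist \<zeta> > 0} \<and> g (f x) = x" if "x \<in> V" for x
    using that unfolding cball_iff_bdist Int_iff by (auto simp: f_def g_def V_def bdist_def vector2_eq_iff)
  have gU: "g p \<in> V \<and> f (g p) = p" if "p \<in> cball 0 1 \<inter> {\<zeta>. bdist \<zeta> > 0}" for p
    using that by (auto simp: f_def g_def V_def bdist_def)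
  have "smooth_on V f" unfolding f_def by (intro smooth_on_intros)
  moreover have "smooth_on (cball 0 1 \<inter> {\<zeta>. bdist \<zeta> > 0}) g" unfolding g_def by (intro smooth_on_intros)
  ultimately show "local_param (cball 0 1) (V, f, g)" "f ` V = cball 0 1 \<inter> {\<zeta>. bdist \<zeta> > 0}"
    using local_paramI[OF A(1) V A(2) fV gU] by blast+
qed

lemma disc_nonzero_chart:
  assumes "\<zeta> \<in> cball 0 1" "\<zeta> \<noteq> 0"
  obtains V f g x where "local_param (cball 0 1) (V, f, g)" "x \<in> V" "f x = \<zeta>" "x $ 2 = bdist \<zeta>"
proof -
  define u where "u = sgn \<zeta>"
  have u: "cmod u = 1" using assms by (simp add: u_def norm_sgn)
  have "cnj u * \<zeta> = inverse (cmod \<zeta>) *\<^sub>R complex_of_real ((cmod \<zeta>)\<^sup>2)"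
    by (simp only: u_def sgn_div_norm complex_norm_square) (simp add: mult.commute)
  then have "cnj u * \<zeta> = of_real (cmod \<zeta>)"
    using assms by (simp add: scaleR_conv_of_real power2_eq_square)
  then have "Re (cnj u * \<zeta>) > 0" using assms(2) by (metis Re_complex_of_real zero_less_norm_iff)
  then have "\<zeta> \<in> cball 0 1 \<inter> {\<zeta>. Re (cnj u * \<zeta>) > 0}" using assms by blast
  then obtain x :: "real^2" where x: "0 \<le> x $ 2" "(x $ 1)\<^sup>2 + x $ 2 < 1"
    "\<zeta> = u * Complex (sqrt (1 - (x $ 1)\<^sup>2 - x $ 2)) (x $ 1)"
    unfolding disc_boundary_chart(2)[OF u, symmetric] by auto
  have "bdist \<zeta> = x $ 2" unfolding x(3) bdist_mult_unit[OF u] using x(1,2) by (simp add: bdist_def)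
  show ?thesis
  proof (rule that[OF disc_boundary_chart(1)[OF u]])
    show "x \<in> {x. 0 \<le> x $ 2 \<and> (x $ 1)\<^sup>2 + x $ 2 < 1}" using x(1,2) by simp
  qed (use x(3) \<open>bdist \<zeta> = x $ 2\<close> in simp_all)
qed

lemma smooth_surface_disc: "smooth_surface (cball 0 1 :: complex set)"
  unfolding smooth_surface_def
proof
  fix \<zeta> :: complex assume z: "\<zeta> \<in> cball 0 1"
  show "\<exists>V f g. local_param (cball 0 1) (V, f, g) \<and> \<zeta> \<in> f ` V"
  proof (cases "\<zeta> = 0")
    case True
    then have "\<zeta> \<in> cball 0 1 \<inter> {\<zeta>. bdist \<zeta> > 0}" by (simp add: bdist_def)
    then show ?thesis unfolding disc_interior_chart(2)[symmetric] using disc_interior_chart(1) by blast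
  next
    case False
    then obtain V f g x where "local_param (cball 0 1) (V, f, g)" "x \<in> V" "f x = \<zeta>"
      using disc_nonzero_chart[OF z] by metis
    then show ?thesis by blast
  qed
qed

lemma surface_boundary_disc: "surface_boundary (cball 0 1 :: complex set) = {\<zeta>. bdist \<zeta> = 0}"
proof (rule Set.set_eqI)
  fix \<zeta> :: complex
  show "\<zeta> \<in> surface_boundary (cball 0 1) \<longleftrightarrow> \<zeta> \<in> {\<zeta>. bdist \<zeta> = 0}"
  proof (cases "\<zeta> \<in> cball 0 1")
    case False
    then show ?thesis using surface_boundary_subset[of "cball 0 1 :: complex set"] cball_iff_bdist by force
  next
    case z: True
    show ?thesis
    proof (cases "\<zeta> = 0")
      case True
      then have "\<zeta> \<in> cball 0 1 \<inter> {\<zeta>. bdist \<zeta> > 0}" by (simp add: bdist_def)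
      then obtain x :: "real^2" where x: "(x $ 1)\<^sup>2 + (x $ 2 - 2)\<^sup>2 < 1" "\<zeta> = Complex (x $ 1) (x $ 2 - 2)"
        unfolding disc_interior_chart(2)[symmetric] by auto
      then have "x $ 2 = 2" using True by (simp add: complex_eq_iff)
      then have "\<zeta> \<notin> surface_boundary (cball 0 1)"
        using surface_boundary_local_param[OF disc_interior_chart(1), of x] x by auto
      then show ?thesis using True by (simp add: bdist_def)
    next
      case False
      then obtain V f g x where "local_param (cball 0 1) (V, f, g)" "x \<in> V" "f x = \<zeta>" "x $ 2 = bdist \<zeta>"
        using disc_nonzero_chart[OF z] by metis
      then show ?thesis using surface_boundary_local_param[of _ V f g x] by auto
    qed
  qed
qed

section \<open>The disc blown up at two points\<close>

text \<open>The coordinate on the projective line that doubles angles: the real line through \<open>d\<close> is represented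
  by the unit complex number \<open>d / cnj d\<close>. The formula extends the definition by \<open>0\<close> at \<open>d = 0\<close>.\<close>

definition line_of :: "complex \<Rightarrow> complex" where
  "line_of d = inverse ((Re d)\<^sup>2 + (Im d)\<^sup>2) *\<^sub>R d\<^sup>2"

lemma sum_squares_Re_Im_pos: "d \<noteq> 0 \<Longrightarrow> (Re d)\<^sup>2 + (Im d)\<^sup>2 > 0"
  by (simp add: cmod_power2[symmetric])

lemma Re_line_of: "d \<noteq> 0 \<Longrightarrow> Re (line_of d) = ((Re d)\<^sup>2 - (Im d)\<^sup>2) / ((Re d)\<^sup>2 + (Im d)\<^sup>2)"
  and Im_line_of: "Im (line_of d) = 2 * Re d * Im d / ((Re d)\<^sup>2 + (Im d)\<^sup>2)"
  by (simp_all add: line_of_def divide_inverse power2_eq_square)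

lemma one_plus_Re_line_of: "d \<noteq> 0 \<Longrightarrow> 1 + Re (line_of d) = 2 * (Re d)\<^sup>2 / ((Re d)\<^sup>2 + (Im d)\<^sup>2)"
  and one_minus_Re_line_of: "d \<noteq> 0 \<Longrightarrow> 1 - Re (line_of d) = 2 * (Im d)\<^sup>2 / ((Re d)\<^sup>2 + (Im d)\<^sup>2)"
proof -
  assume d: "d \<noteq> 0"
  have one: "1 = ((Re d)\<^sup>2 + (Im d)\<^sup>2) / ((Re d)\<^sup>2 + (Im d)\<^sup>2)"
    using divide_self[OF less_imp_neq[OF sum_squares_Re_Im_pos[OF d], symmetric]] by simp
  show "1 + Re (line_of d) = 2 * (Re d)\<^sup>2 / ((Re d)\<^sup>2 + (Im d)\<^sup>2)"
    unfolding Re_line_of[OF d] by (subst one) (simp only: add_divide_distrib[symmetric], simp)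
  show "1 - Re (line_of d) = 2 * (Im d)\<^sup>2 / ((Re d)\<^sup>2 + (Im d)\<^sup>2)"
    unfolding Re_line_of[OF d] by (subst one) (simp only: diff_divide_distrib[symmetric], simp)
qed

lemma Re_less_1_of_unit: "(Re \<omega>)\<^sup>2 + (Im \<omega>)\<^sup>2 = 1 \<Longrightarrow> \<omega> \<noteq> 1 \<Longrightarrow> Re \<omega> < 1"
proof -
  assume unit: "(Re \<omega>)\<^sup>2 + (Im \<omega>)\<^sup>2 = 1" and ne: "\<omega> \<noteq> 1"
  have "(Re \<omega>)\<^sup>2 \<le> 1" using unit zero_le_power2[of "Im \<omega>"] by linarith
  then have "Re \<omega> \<le> 1" using abs_square_le_1[of "Re \<omega>"] by linarith
  moreover have "Re \<omega> \<noteq> 1"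
  proof
    assume "Re \<omega> = 1"
    then have "Im \<omega> = 0" using unit by simp
    then show False using ne \<open>Re \<omega> = 1\<close> by (simp add: complex_eq_iff)
  qed
  ultimately show ?thesis by simp
qed

lemma Re_greater_minus_1_of_unit: "(Re \<omega>)\<^sup>2 + (Im \<omega>)\<^sup>2 = 1 \<Longrightarrow> \<omega> \<noteq> - 1 \<Longrightarrow> - 1 < Re \<omega>"
  using Re_less_1_of_unit[of "- \<omega>"] by (metis add.inverse_inverse minus_complex.simps neg_less_iff_less power2_minus uminus_complex.simps)

lemma line_of_mult_cnj: "line_of d * cnj d = d"
proof (cases "d = 0")
  case False
  have "d\<^sup>2 * cnj d = d * (d * cnj d)" by (simp add: power2_eq_square)
  also have "\<dots> = ((Re d)\<^sup>2 + (Im d)\<^sup>2) *\<^sub>R d" unfolding complex_mult_cnj by (simp only: scaleR_conv_of_real mult.commute)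
  finally show ?thesis using left_inverse[OF less_imp_neq[OF sum_squares_Re_Im_pos[OF False], symmetric]]
    by (simp add: line_of_def)
qed (simp add: line_of_def)

lemma norm_line_of: "d \<noteq> 0 \<Longrightarrow> cmod (line_of d) = 1"
  by (metis line_of_mult_cnj complex_mod_cnj mult_cancel_right1 norm_eq_zero norm_mult)

lemma line_of_unique: "d \<noteq> 0 \<Longrightarrow> w * cnj d = d \<Longrightarrow> line_of d = w"
  by (metis line_of_mult_cnj complex_cnj_zero_iff mult_right_cancel)

lemma smooth_on_line_of:
  "smooth_on S f \<Longrightarrow> (\<And>x. x \<in> S \<Longrightarrow> f x \<noteq> 0) \<Longrightarrow> smooth_on S (\<lambda>x. line_of (f x))"
proof -
  assume f: "smooth_on S f" and nz: "\<And>x. x \<in> S \<Longrightarrow> f x \<noteq> 0"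
  have "(Re (f x))\<^sup>2 + (Im (f x))\<^sup>2 \<noteq> 0" if "x \<in> S" for x
    using sum_squares_Re_Im_pos[OF nz[OF that]] by linarith
  then show ?thesis unfolding line_of_def by (intro smooth_on_intros f)
qed

text \<open>Equal to \<open>1\<close> on the unit circle, with simple zeros at \<open>\<plusminus> 1 / sqrt 3\<close>. The factor \<open>3 / 2\<close> is chosen
  so that the sum of squares in the proof of \<open>half_angle_tan_axis_derivative\<close> appears.\<close>

definition blowup_fun :: "complex \<Rightarrow> complex" where
  "blowup_fun \<zeta> = Complex (1 - 3 / 2 * bdist \<zeta>) (3 / 2 * bdist \<zeta> * Im \<zeta>)"

text \<open>The equation says that \<open>blowup_fun \<zeta>\<close> lies on the line represented by \<open>\<omega>\<close>. It determines \<open>\<omega>\<close> unless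
  \<open>blowup_fun \<zeta> = 0\<close>; over the two zeros the point \<open>\<omega>\<close> runs through an exceptional circle.\<close>

definition blowup_disc :: "(complex \<times> complex) set" where
  "blowup_disc = {(\<omega>, \<zeta>). cmod \<omega> = 1 \<and> bdist \<zeta> \<ge> 0 \<and> blowup_fun \<zeta> = \<omega> * cnj (blowup_fun \<zeta>)}"

lemma smooth_on_blowup_fun: "smooth_on S f \<Longrightarrow> smooth_on S (\<lambda>x. blowup_fun (f x))"
  unfolding blowup_fun_def by (intro smooth_on_intros smooth_on_bdist)

lemma blowup_fun_eq_0_iff: "blowup_fun \<zeta> = 0 \<longleftrightarrow> Im \<zeta> = 0 \<and> (Re \<zeta>)\<^sup>2 = 1 / 3"
  by (auto simp: blowup_fun_def complex_eq_iff bdist_def)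

lemma blowup_disc_line_of_iff:
  assumes "d \<noteq> 0"
  shows "(line_of d, \<zeta>) \<in> blowup_disc \<longleftrightarrow>
    bdist \<zeta> \<ge> 0 \<and> Re (blowup_fun \<zeta>) * Im d = Im (blowup_fun \<zeta>) * Re d"
proof -
  let ?C = "blowup_fun \<zeta>"
  have "?C = line_of d * cnj ?C \<longleftrightarrow> ?C * cnj d = line_of d * cnj ?C * cnj d" using assms by simp
  also have "\<dots> \<longleftrightarrow> ?C * cnj d = d * cnj ?C"
    by (metis line_of_mult_cnj mult.assoc mult.commute)
  also have "\<dots> \<longleftrightarrow> Re ?C * Im d = Im ?C * Re d" by (auto simp: complex_eq_iff algebra_simps)
  finally show ?thesis using norm_line_of[OF assms] by (auto simp: blowup_disc_def)
qed

lemma centred_bdist_identity: "x = k + 1 / 3 \<Longrightarrow> 1 - 3 / 2 * (1 - x - e) = 3 / 2 * (k + e :: real)"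
  by (simp add: field_simps)

text \<open>The first two equations are the real and imaginary part of the defining equation, divided by \<open>3 / 2\<close>.
  They express collinearity with the line \<open>\<omega>\<close> without division.\<close>

lemma blowup_disc_relations:
  assumes "(\<omega>, \<zeta>) \<in> blowup_disc"
  shows "Im \<omega> * ((Re \<zeta>)\<^sup>2 + (Im \<zeta>)\<^sup>2 - 1 / 3) = (1 + Re \<omega>) * (bdist \<zeta> * Im \<zeta>)"
    "(1 - Re \<omega>) * ((Re \<zeta>)\<^sup>2 + (Im \<zeta>)\<^sup>2 - 1 / 3) = Im \<omega> * (bdist \<zeta> * Im \<zeta>)"
    "(Re \<omega>)\<^sup>2 + (Im \<omega>)\<^sup>2 = 1" "bdist \<zeta> \<ge> 0" "bdist \<zeta> = 0 \<Longrightarrow> \<omega> = 1"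
proof -
  have C: "blowup_fun \<zeta> = \<omega> * cnj (blowup_fun \<zeta>)" "cmod \<omega> = 1" "bdist \<zeta> \<ge> 0"
    using assms by (auto simp: blowup_disc_def)
  define a where "a = 1 - 3 / 2 * bdist \<zeta>"
  define b where "b = 3 / 2 * bdist \<zeta> * Im \<zeta>"
  have ab: "a = Re \<omega> * a + Im \<omega> * b" "b = Im \<omega> * a - Re \<omega> * b"
  proof -
    have "Complex a b = \<omega> * cnj (Complex a b)" using C(1) unfolding blowup_fun_def a_def b_def .
    then show "a = Re \<omega> * a + Im \<omega> * b" "b = Im \<omega> * a - Re \<omega> * b" by (simp_all add: complex_eq_iff)
  qed
  define X where "X = (Re \<zeta>)\<^sup>2 + (Im \<zeta>)\<^sup>2 - 1 / 3"
  define Y where "Y = bdist \<zeta> * Im \<zeta>"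
  have aX: "a = 3 / 2 * X" 
    unfolding a_def bdist_def X_def by (subst centred_bdist_identity[where k = "(Re \<zeta>)\<^sup>2 - 1 / 3"]) (simp_all add: algebra_simps)
  have bY: "b = 3 / 2 * Y" by (simp add: b_def Y_def)
  have "Im \<omega> * X = (1 + Re \<omega>) * Y" using ab(2) unfolding aX bY by (simp add: algebra_simps)
  then show "Im \<omega> * ((Re \<zeta>)\<^sup>2 + (Im \<zeta>)\<^sup>2 - 1 / 3) = (1 + Re \<omega>) * (bdist \<zeta> * Im \<zeta>)"
    unfolding X_def Y_def .
  have "(1 - Re \<omega>) * X = Im \<omega> * Y" using ab(1) unfolding aX bY by (simp add: algebra_simps)
  then show "(1 - Re \<omega>) * ((Re \<zeta>)\<^sup>2 + (Im \<zeta>)\<^sup>2 - 1 / 3) = Im \<omega> * (bdist \<zeta> * Im \<zeta>)"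
    unfolding X_def Y_def .
  show "(Re \<omega>)\<^sup>2 + (Im \<omega>)\<^sup>2 = 1" "bdist \<zeta> \<ge> 0" using C by (auto simp: norm_eq_1_iff_Re_Im)
  show "\<omega> = 1" if "bdist \<zeta> = 0" using C(1) that by (simp add: blowup_fun_def complex_eq_iff)
qed

definition regular_disc :: "complex set" where
  "regular_disc = {\<zeta> \<in> cball 0 1. blowup_fun \<zeta> \<noteq> 0}"

definition regular_blowup :: "(complex \<times> complex) set" where
  "regular_blowup = {p \<in> blowup_disc. blowup_fun (snd p) \<noteq> 0}"

lemma continuous_on_blowup_fun: "continuous_on S blowup_fun"
  using smooth_on_continuous[OF smooth_on_blowup_fun[OF smooth_on_id]] .

lemma openin_regular_disc: "openin (top_of_set (cball 0 1)) regular_disc"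
proof -
  have "regular_disc = cball 0 1 \<inter> blowup_fun -` (- {0})" by (auto simp: regular_disc_def)
  then show ?thesis
    using continuous_openin_preimage_gen[OF continuous_on_blowup_fun open_Compl[OF closed_singleton]] by metis
qed

lemma openin_regular_blowup: "openin (top_of_set blowup_disc) regular_blowup"
proof -
  have "regular_blowup = blowup_disc \<inter> (\<lambda>p. blowup_fun (snd p)) -` (- {0})" by (auto simp: regular_blowup_def)
  moreover have "continuous_on blowup_disc (\<lambda>p. blowup_fun (snd p))"
    by (rule smooth_on_continuous[OF smooth_on_blowup_fun]) (intro smooth_on_intros)
  ultimately show ?thesis
    using continuous_openin_preimage_gen[OF _ open_Compl[OF closed_singleton]] by metis
qed

text \<open>Away from the exceptional circles the blown-up disc is the graph of a smooth function.\<close>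

lemma regular_blowup_diffeomorphism:
  "diffeomorphism regular_disc regular_blowup (\<lambda>\<zeta>. (line_of (blowup_fun \<zeta>), \<zeta>)) snd"
proof -
  have 1: "(line_of (blowup_fun \<zeta>), \<zeta>) \<in> regular_blowup" if "\<zeta> \<in> regular_disc" for \<zeta>
  proof -
    have "\<zeta> \<in> cball 0 1" "blowup_fun \<zeta> \<noteq> 0" using that unfolding regular_disc_def by blast+
    then show ?thesis unfolding regular_blowup_def cball_iff_bdist by (simp add: blowup_disc_line_of_iff)
  qed
  have 2: "snd p \<in> regular_disc \<and> line_of (blowup_fun (snd p)) = fst p" if "p \<in> regular_blowup" for p
  proof -
    have p: "blowup_fun (snd p) \<noteq> 0" "bdist (snd p) \<ge> 0" "fst p * cnj (blowup_fun (snd p)) = blowup_fun (snd p)"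
      using that by (auto simp: regular_blowup_def blowup_disc_def)
    then have "snd p \<in> cball 0 1" unfolding cball_iff_bdist by blast
    then show ?thesis using p line_of_unique unfolding regular_disc_def by blast
  qed
  have sm: "smooth_on regular_disc (\<lambda>\<zeta>. (line_of (blowup_fun \<zeta>), \<zeta>))"
    by (intro smooth_on_intros smooth_on_line_of smooth_on_blowup_fun) (auto simp: regular_disc_def)
  have "(\<lambda>\<zeta>. (line_of (blowup_fun \<zeta>), \<zeta>)) ` regular_disc = regular_blowup"
  proof
    show "regular_blowup \<subseteq> (\<lambda>\<zeta>. (line_of (blowup_fun \<zeta>), \<zeta>)) ` regular_disc"
    proof
      fix p assume "p \<in> regular_blowup"
      from 2[OF this] show "p \<in> (\<lambda>\<zeta>. (line_of (blowup_fun \<zeta>), \<zeta>)) ` regular_disc"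
        by (intro image_eqI[of _ _ "snd p"]) (auto simp: prod_eq_iff)
    qed
  qed (use 1 in blast)
  moreover have "snd ` regular_blowup = regular_disc" using 1 2 by force
  moreover have "smooth_on regular_blowup snd" by (rule smooth_on_bounded_linear[OF bounded_linear_snd])
  ultimately show ?thesis using sm 2 unfolding diffeomorphism_def by auto
qed

section \<open>Charts near the exceptional circles\<close>

text \<open>The curves \<open>Im \<zeta> = m (\<xi>\<^sup>2 - 1 / 3)\<close> with \<open>m\<close> real pass through both zeros of \<open>blowup_fun\<close> with
  slopes proportional to \<open>m\<close>.\<close>

definition slope_point :: "real \<Rightarrow> real \<Rightarrow> complex" where
  "slope_point m \<xi> = Complex \<xi> (m * (\<xi>\<^sup>2 - 1 / 3))"

text \<open>Along the curve with parameter \<open>m\<close> the value of \<open>blowup_fun\<close> is a multiple of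
  \<open>(1 + m Im \<zeta>, bdist \<zeta> m)\<close>. This direction is nonzero also at the zeros of \<open>blowup_fun\<close>, so it
  parametrizes the exceptional circles, except for one point of each.\<close>

definition slope_chart :: "real \<Rightarrow> real \<Rightarrow> complex \<times> complex" where
  "slope_chart m \<xi> = (line_of (Complex (1 + m * Im (slope_point m \<xi>)) (bdist (slope_point m \<xi>) * m)), slope_point m \<xi>)"

text \<open>The denominator in the formula \<open>m = Im \<omega> / slope_denom (\<omega>, \<zeta>)\<close> for the inverse of \<open>slope_chart\<close>.\<close>

definition slope_denom :: "complex \<times> complex \<Rightarrow> real" where
  "slope_denom p = bdist (snd p) * (1 + Re (fst p)) - Im (snd p) * Im (fst p)"

lemma slope_chart_direction_nonzero:
  assumes "bdist (slope_point m \<xi>) \<ge> 0"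
  shows "Complex (1 + m * Im (slope_point m \<xi>)) (bdist (slope_point m \<xi>) * m) \<noteq> 0"
proof
  assume "Complex (1 + m * Im (slope_point m \<xi>)) (bdist (slope_point m \<xi>) * m) = 0"
  then have 1: "m * (m * (\<xi>\<^sup>2 - 1 / 3)) = - 1" and 2: "bdist (slope_point m \<xi>) * m = 0"
    by (auto simp: complex_eq_iff slope_point_def)
  then have "m \<noteq> 0" by auto
  then have "\<xi>\<^sup>2 + (m * (\<xi>\<^sup>2 - 1 / 3))\<^sup>2 = 1" using 2 by (simp add: bdist_def slope_point_def)
  moreover have "(m * (\<xi>\<^sup>2 - 1 / 3))\<^sup>2 = m * (m * (\<xi>\<^sup>2 - 1 / 3)) * (\<xi>\<^sup>2 - 1 / 3)"
    by (simp only: power2_eq_square mult.assoc mult.commute mult.left_commute)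
  then have "(m * (\<xi>\<^sup>2 - 1 / 3))\<^sup>2 = - (\<xi>\<^sup>2 - 1 / 3)" unfolding 1 by simp
  ultimately show False by simp
qed

lemma slope_chart_mem: "bdist (slope_point m \<xi>) \<ge> 0 \<Longrightarrow> slope_chart m \<xi> \<in> blowup_disc"
proof -
  assume q: "bdist (slope_point m \<xi>) \<ge> 0"
  define k where "k = \<xi>\<^sup>2 - 1 / 3"
  define q where "q = bdist (slope_point m \<xi>)"
  have sp: "slope_point m \<xi> = Complex \<xi> (m * k)" by (simp add: slope_point_def k_def)
  have "1 - 3 / 2 * q = 3 / 2 * (k + (m * k)\<^sup>2)"
    unfolding q_def sp bdist_def by (simp only: complex.sel) (rule centred_bdist_identity, simp add: k_def)
  then have "(1 - 3 / 2 * q) * (q * m) = 3 / 2 * q * (m * k) * (1 + m * (m * k))"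
    by (simp only:) (simp add: power2_eq_square algebra_simps)
  then have "Re (blowup_fun (slope_point m \<xi>)) * (q * m) =
      Im (blowup_fun (slope_point m \<xi>)) * (1 + m * Im (slope_point m \<xi>))"
    by (simp add: blowup_fun_def q_def[symmetric]) (simp add: sp)
  then show ?thesis
    unfolding slope_chart_def blowup_disc_line_of_iff[OF slope_chart_direction_nonzero[OF q]]
    using q by (simp add: q_def)
qed

lemma line_of_scaleR: "c \<noteq> 0 \<Longrightarrow> line_of (c *\<^sub>R d) = line_of d"
proof (cases "d = 0")
  case False
  assume "c \<noteq> 0"
  then show ?thesis using False by (intro line_of_unique) (auto simp: line_of_mult_cnj)
qed simp

lemma line_of_one_plus: "cmod \<omega> = 1 \<Longrightarrow> \<omega> \<noteq> - 1 \<Longrightarrow> line_of (1 + \<omega>) = \<omega>"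
  using complex_norm_square[of \<omega>] by (intro line_of_unique) (auto simp: algebra_simps add_eq_0_iff)

lemma line_of_one_minus: "cmod \<omega> = 1 \<Longrightarrow> \<omega> \<noteq> 1 \<Longrightarrow> line_of (\<i> * (1 - \<omega>)) = \<omega>"
  using complex_norm_square[of \<omega>] by (intro line_of_unique) (auto simp: algebra_simps)

text \<open>With \<open>m = Im \<omega> / slope_denom (\<omega>, \<zeta>)\<close> the direction in \<open>slope_chart\<close> is a multiple of \<open>1 + \<omega>\<close>, which
  bisects the angle between \<open>1\<close> and \<open>\<omega>\<close> and hence represents \<open>\<omega>\<close>.\<close>

lemma slope_chart_inverse:
  assumes p: "(\<omega>, \<zeta>) \<in> blowup_disc" and d: "slope_denom (\<omega>, \<zeta>) \<noteq> 0" "\<omega> \<noteq> - 1" "bdist \<zeta> \<noteq> 0"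
  shows "slope_chart (Im \<omega> / slope_denom (\<omega>, \<zeta>)) (Re \<zeta>) = (\<omega>, \<zeta>)"
proof -
  note r = blowup_disc_relations[OF p]
  define D where "D = slope_denom (\<omega>, \<zeta>)"
  define m where "m = Im \<omega> / D"
  have D: "D \<noteq> 0" "D = bdist \<zeta> * (1 + Re \<omega>) - Im \<zeta> * Im \<omega>" using d by (auto simp: D_def slope_denom_def)
  have "Im \<omega> * ((Re \<zeta>)\<^sup>2 - 1 / 3) = D * Im \<zeta>"
    using r(1) unfolding D(2) by (simp add: power2_eq_square algebra_simps)
  then have "m * ((Re \<zeta>)\<^sup>2 - 1 / 3) = Im \<zeta>" using D(1) by (simp add: m_def field_simps)
  then have sp: "slope_point m (Re \<zeta>) = \<zeta>" by (simp add: slope_point_def complex_eq_iff)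
  have "D *\<^sub>R Complex (1 + m * Im \<zeta>) (bdist \<zeta> * m) = bdist \<zeta> *\<^sub>R (1 + \<omega>)"
    using D by (auto simp: complex_eq_iff m_def field_simps)
  then have "line_of (Complex (1 + m * Im \<zeta>) (bdist \<zeta> * m)) = line_of (1 + \<omega>)"
    by (metis line_of_scaleR D(1) d(3))
  also have "\<dots> = \<omega>" using p d by (intro line_of_one_plus) (auto simp: blowup_disc_def)
  finally show ?thesis by (simp add: slope_chart_def sp m_def[symmetric] D_def[symmetric])
qed

lemma slope_denom_chart:
  assumes "bdist (slope_point m \<xi>) > 0"
  shows "Im (fst (slope_chart m \<xi>)) = m * slope_denom (slope_chart m \<xi>)"
    "slope_denom (slope_chart m \<xi>) * ((1 + m * Im (slope_point m \<xi>))\<^sup>2 + (bdist (slope_point m \<xi>) * m)\<^sup>2) =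
      2 * bdist (slope_point m \<xi>) * (1 + m * Im (slope_point m \<xi>))"
    "(1 + Re (fst (slope_chart m \<xi>))) * ((1 + m * Im (slope_point m \<xi>))\<^sup>2 + (bdist (slope_point m \<xi>) * m)\<^sup>2) =
      2 * (1 + m * Im (slope_point m \<xi>))\<^sup>2"
proof -
  define q where "q = bdist (slope_point m \<xi>)"
  define \<eta> where "\<eta> = Im (slope_point m \<xi>)"
  define a where "a = 1 + m * \<eta>"
  define b where "b = q * m"
  have nz: "Complex a b \<noteq> 0"
    using slope_chart_direction_nonzero[of m \<xi>] assms by (simp add: q_def \<eta>_def a_def b_def)
  then have N: "a\<^sup>2 + b\<^sup>2 > 0" using sum_squares_Re_Im_pos[OF nz] by simp
  have w: "Im (fst (slope_chart m \<xi>)) = 2 * a * b / (a\<^sup>2 + b\<^sup>2)"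
    using Im_line_of[of "Complex a b"]
    by (simp add: slope_chart_def q_def[symmetric] \<eta>_def[symmetric] a_def[symmetric] b_def[symmetric])
  have s: "snd (slope_chart m \<xi>) = slope_point m \<xi>" by (simp add: slope_chart_def)
  have one: "1 + Re (fst (slope_chart m \<xi>)) = 2 * a\<^sup>2 / (a\<^sup>2 + b\<^sup>2)"
    using one_plus_Re_line_of[OF nz]
    by (simp add: slope_chart_def q_def[symmetric] \<eta>_def[symmetric] a_def[symmetric] b_def[symmetric])
  then show "(1 + Re (fst (slope_chart m \<xi>))) * ((1 + m * Im (slope_point m \<xi>))\<^sup>2 + (bdist (slope_point m \<xi>) * m)\<^sup>2) =
      2 * (1 + m * Im (slope_point m \<xi>))\<^sup>2"
    using N unfolding q_def[symmetric] \<eta>_def[symmetric] a_def[symmetric] b_def[symmetric] by simp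
  have "slope_denom (slope_chart m \<xi>) = q * (2 * a\<^sup>2 / (a\<^sup>2 + b\<^sup>2)) - \<eta> * (2 * a * b / (a\<^sup>2 + b\<^sup>2))"
    unfolding slope_denom_def one s w by (simp add: q_def \<eta>_def)
  also have "\<dots> = 2 * a * (q * a - \<eta> * b) / (a\<^sup>2 + b\<^sup>2)"
  proof -
    have "2 * a * (q * a - \<eta> * b) = q * (2 * a\<^sup>2) - \<eta> * (2 * a * b)" by (simp add: power2_eq_square algebra_simps)
    then show ?thesis by (simp only: times_divide_eq_right diff_divide_distrib[symmetric])
  qed
  also have "q * a - \<eta> * b = q" by (simp add: a_def b_def algebra_simps)
  finally have sd: "slope_denom (slope_chart m \<xi>) = 2 * a * q / (a\<^sup>2 + b\<^sup>2)" .
  then show "slope_denom (slope_chart m \<xi>) * ((1 + m * Im (slope_point m \<xi>))\<^sup>2 + (bdist (slope_point m \<xi>) * m)\<^sup>2) =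
      2 * bdist (slope_point m \<xi>) * (1 + m * Im (slope_point m \<xi>))"
    using N unfolding q_def[symmetric] \<eta>_def[symmetric] a_def[symmetric] b_def[symmetric] by simp
  show "Im (fst (slope_chart m \<xi>)) = m * slope_denom (slope_chart m \<xi>)"
    unfolding sd w by (simp add: b_def mult.commute mult.left_commute)
qed

lemma slope_point_bounds:
  assumes "\<bar>m\<bar> < 3" "\<bar>\<xi>\<^sup>2 - 1 / 3\<bar> < 1 / 9"
  shows "bdist (slope_point m \<xi>) > 0" "1 + m * Im (slope_point m \<xi>) > 0"
proof -
  define k where "k = \<xi>\<^sup>2 - 1 / 3"
  have k: "\<bar>k\<bar> < 1 / 9" "\<xi>\<^sup>2 < 4 / 9" using assms(2) abs_ge_self[of "\<xi>\<^sup>2 - 1 / 3"] unfolding k_def by linarith+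
  have mk: "\<bar>m * k\<bar> < 1 / 3"
    using mult_strict_mono'[OF assms(1) k(1)] by (simp add: abs_mult)
  have "\<bar>m * k\<bar>\<^sup>2 < (1 / 3)\<^sup>2" by (rule power_strict_mono[OF mk]) auto
  then have "(m * k)\<^sup>2 < 1 / 9" by (simp add: power2_eq_square)
  then show "bdist (slope_point m \<xi>) > 0" using k(2) by (simp add: bdist_def slope_point_def k_def[symmetric])
  have "\<bar>m * (m * k)\<bar> < 3 * (1 / 3)"
    unfolding abs_mult[of m "m * k"] using mult_strict_mono'[OF assms(1) mk] by simp
  then show "1 + m * Im (slope_point m \<xi>) > 0" by (simp add: slope_point_def k_def[symmetric] abs_less_iff)
qed

text \<open>A rectangle small enough for the points \<open>slope_point m \<xi>\<close> to stay inside the disc, and large enough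
  for the images of this chart and of the chart on \<open>strip_domain\<close> to cover the right exceptional circle.\<close>

definition slope_domain :: "(real^2) set" where
  "slope_domain = {x. \<bar>x $ 1\<bar> < 3 \<and> 0 < x $ 2 \<and> \<bar>(x $ 2)\<^sup>2 - 1 / 3\<bar> < 1 / 9}"

definition slope_coords :: "complex \<times> complex \<Rightarrow> real^2" where
  "slope_coords p = vector [Im (fst p) / slope_denom p, Re (snd p)]"

definition slope_region :: "(complex \<times> complex) set" where
  "slope_region = {p. 0 < Re (snd p) \<and> \<bar>(Re (snd p))\<^sup>2 - 1 / 3\<bar> < 1 / 9 \<and> 0 < 1 + Re (fst p) \<and> 0 < slope_denom p \<and>
     \<bar>Im (fst p)\<bar> < 3 * slope_denom p}"

lemma slope_local_param:
  "local_param blowup_disc (slope_domain, \<lambda>x. slope_chart (x $ 1) (x $ 2), slope_coords)"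
  "(\<lambda>x. slope_chart (x $ 1) (x $ 2)) ` slope_domain = blowup_disc \<inter> slope_region"
proof -
  let ?f = "\<lambda>x :: real^2. slope_chart (x $ 1) (x $ 2)"
  have A: "open {x :: real^2. \<bar>x $ 1\<bar> < 3 \<and> 0 < x $ 2 \<and> \<bar>(x $ 2)\<^sup>2 - 1 / 3\<bar> < 1 / 9}"
    by (intro open_Collect_conj open_Collect_less continuous_intros)
  have V: "slope_domain = half_plane \<inter> {x :: real^2. \<bar>x $ 1\<bar> < 3 \<and> 0 < x $ 2 \<and> \<bar>(x $ 2)\<^sup>2 - 1 / 3\<bar> < 1 / 9}"
    by (auto simp: slope_domain_def half_plane_def)
  have U: "open slope_region"
    unfolding slope_region_def slope_denom_def bdist_def
    by (intro open_Collect_conj open_Collect_less continuous_intros)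
  have fV: "?f x \<in> blowup_disc \<inter> slope_region \<and> slope_coords (?f x) = x" if x: "x \<in> slope_domain" for x
  proof -
    define m where "m = x $ 1"
    define \<xi> where "\<xi> = x $ 2"
    have h: "\<bar>m\<bar> < 3" "0 < \<xi>" "\<bar>\<xi>\<^sup>2 - 1 / 3\<bar> < 1 / 9" using x by (auto simp: slope_domain_def m_def \<xi>_def)
    note b = slope_point_bounds[OF h(1,3)]
    note d = slope_denom_chart[OF b(1)]
    have N: "(1 + m * Im (slope_point m \<xi>))\<^sup>2 + (bdist (slope_point m \<xi>) * m)\<^sup>2 > 0"
      using b(2) by (intro add_pos_nonneg) auto
    have "slope_denom (slope_chart m \<xi>) * ((1 + m * Im (slope_point m \<xi>))\<^sup>2 + (bdist (slope_point m \<xi>) * m)\<^sup>2) > 0"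
      unfolding d(2) using b by simp
    then have pos: "slope_denom (slope_chart m \<xi>) > 0" using N by (simp add: zero_less_mult_iff)
    have "(1 + Re (fst (slope_chart m \<xi>))) * ((1 + m * Im (slope_point m \<xi>))\<^sup>2 + (bdist (slope_point m \<xi>) * m)\<^sup>2) > 0"
      unfolding d(3) using b by simp
    then have "1 + Re (fst (slope_chart m \<xi>)) > 0" using N by (simp add: zero_less_mult_iff)
    moreover have "Re (snd (slope_chart m \<xi>)) = \<xi>" by (simp add: slope_chart_def slope_point_def)
    moreover have "\<bar>Im (fst (slope_chart m \<xi>))\<bar> < 3 * slope_denom (slope_chart m \<xi>)"
      unfolding d(1) abs_mult using pos h(1) by simp
    ultimately have "slope_chart m \<xi> \<in> slope_region" using h pos by (simp add: slope_region_def)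
    moreover have "slope_coords (slope_chart m \<xi>) = x"
      unfolding slope_coords_def vector2_eq_iff d(1) using pos \<open>Re (snd (slope_chart m \<xi>)) = \<xi>\<close> by (simp add: m_def \<xi>_def)
    moreover have "slope_chart m \<xi> \<in> blowup_disc" using slope_chart_mem b(1) by simp
    ultimately show ?thesis by (simp add: m_def \<xi>_def)
  qed
  have gU: "slope_coords p \<in> slope_domain \<and> ?f (slope_coords p) = p" if p: "p \<in> blowup_disc \<inter> slope_region" for p
  proof -
    obtain w z where wz: "p = (w, z)" by (cases p)
    have mem: "(w, z) \<in> blowup_disc" and r: "0 < Re z" "\<bar>(Re z)\<^sup>2 - 1 / 3\<bar> < 1 / 9" "0 < 1 + Re w" "0 < slope_denom (w, z)"
      "\<bar>Im w\<bar> < 3 * slope_denom (w, z)"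
      using p by (auto simp: wz slope_region_def)
    have "bdist z \<noteq> 0" using blowup_disc_relations(5)[OF mem] r(4) by (auto simp: slope_denom_def)
    moreover have "w \<noteq> - 1" using r(3) by auto
    ultimately have "slope_chart (Im w / slope_denom (w, z)) (Re z) = (w, z)"
      using slope_chart_inverse[OF mem] r(4) by auto
    moreover have "\<bar>Im w / slope_denom (w, z)\<bar> < 3" using r(4,5) by (simp add: divide_less_eq)
    ultimately show ?thesis using r by (simp add: wz slope_coords_def slope_domain_def)
  qed
  have "smooth_on slope_domain ?f"
    unfolding slope_chart_def slope_point_def
  proof (intro smooth_on_intros smooth_on_line_of smooth_on_bdist)
    fix x :: "real^2" assume "x \<in> slope_domain"
    then have "bdist (slope_point (x $ 1) (x $ 2)) \<ge> 0"
      using slope_point_bounds[of "x $ 1" "x $ 2"] by (simp add: slope_domain_def)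
    from slope_chart_direction_nonzero[OF this, unfolded slope_point_def]
    show "Complex (1 + x $ 1 * Im (Complex (x $ 2) (x $ 1 * ((x $ 2)\<^sup>2 - 1 / 3))))
          (bdist (Complex (x $ 2) (x $ 1 * ((x $ 2)\<^sup>2 - 1 / 3))) * x $ 1) \<noteq> 0" .
  qed
  moreover have "smooth_on (blowup_disc \<inter> slope_region) slope_coords"
    unfolding slope_coords_def
  proof (intro smooth_on_intros)
    show "slope_denom p \<noteq> 0" if "p \<in> blowup_disc \<inter> slope_region" for p using that by (auto simp: slope_region_def)
    show "smooth_on (blowup_disc \<inter> slope_region) slope_denom"
      unfolding slope_denom_def by (intro smooth_on_intros smooth_on_bdist)
  qed
  ultimately show "local_param blowup_disc (slope_domain, ?f, slope_coords)" "?f ` slope_domain = blowup_disc \<inter> slope_region"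
    using local_paramI[OF A V U fV gU] by blast+
qed

text \<open>The curve \<open>\<xi>\<^sup>2 = 1 / 3 + n \<eta>\<close>, where \<open>n\<close> is the reciprocal of the parameter \<open>m\<close> of \<open>slope_point\<close>.
  The value \<open>n = 0\<close> is the vertical line through the right zero, which the slopes \<open>m\<close> miss.\<close>

definition strip_point :: "real \<Rightarrow> real \<Rightarrow> complex" where
  "strip_point \<eta> n = Complex (sqrt (1 / 3 + n * \<eta>)) \<eta>"

definition strip_chart :: "real \<Rightarrow> real \<Rightarrow> complex \<times> complex" where
  "strip_chart \<eta> n = (line_of (Complex (n + \<eta>) (bdist (strip_point \<eta> n))), strip_point \<eta> n)"

lemma bdist_strip_point: "1 / 3 + n * \<eta> \<ge> 0 \<Longrightarrow> bdist (strip_point \<eta> n) = 2 / 3 - n * \<eta> - \<eta>\<^sup>2"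
  by (simp add: bdist_def strip_point_def)

lemma strip_chart_direction_nonzero:
  assumes "1 / 3 + n * \<eta> \<ge> 0"
  shows "Complex (n + \<eta>) (bdist (strip_point \<eta> n)) \<noteq> 0"
proof
  assume "Complex (n + \<eta>) (bdist (strip_point \<eta> n)) = 0"
  then have "n = - \<eta>" "2 / 3 - n * \<eta> - \<eta>\<^sup>2 = 0"
    using bdist_strip_point[OF assms] by (simp_all add: complex_eq_iff)
  then show False by (simp add: power2_eq_square)
qed

lemma strip_chart_mem:
  assumes "1 / 3 + n * \<eta> \<ge> 0" "bdist (strip_point \<eta> n) \<ge> 0"
  shows "strip_chart \<eta> n \<in> blowup_disc"
proof -
  define q where "q = bdist (strip_point \<eta> n)"
  have "1 - 3 / 2 * q = 3 / 2 * (n * \<eta> + \<eta>\<^sup>2)" by (simp add: q_def bdist_strip_point[OF assms(1)] field_simps)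
  then have "(1 - 3 / 2 * q) * q = 3 / 2 * q * \<eta> * (n + \<eta>)"
    by (simp only:) (simp add: power2_eq_square algebra_simps)
  then have "Re (blowup_fun (strip_point \<eta> n)) * q = Im (blowup_fun (strip_point \<eta> n)) * (n + \<eta>)"
    by (simp add: blowup_fun_def q_def[symmetric]) (simp add: strip_point_def)
  then show ?thesis
    unfolding strip_chart_def blowup_disc_line_of_iff[OF strip_chart_direction_nonzero[OF assms(1)]]
    using assms(2) by (simp add: q_def)
qed

text \<open>Here the direction is a multiple of \<open>\<i> (1 - \<omega>)\<close>, which represents \<open>\<omega>\<close> as well.\<close>

lemma strip_chart_inverse:
  assumes p: "(\<omega>, \<zeta>) \<in> blowup_disc" and d: "\<omega> \<noteq> 1" "Re \<zeta> > 0"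
  shows "strip_chart (Im \<zeta>) (bdist \<zeta> * Im \<omega> / (1 - Re \<omega>) - Im \<zeta>) = (\<omega>, \<zeta>)"
    "1 / 3 + (bdist \<zeta> * Im \<omega> / (1 - Re \<omega>) - Im \<zeta>) * Im \<zeta> = (Re \<zeta>)\<^sup>2"
proof -
  note r = blowup_disc_relations[OF p]
  have q: "bdist \<zeta> \<noteq> 0" using r(5) d(1) by blast
  have "Re \<omega> \<noteq> 1" using Re_less_1_of_unit[OF r(3) d(1)] by simp
  define n where "n = bdist \<zeta> * Im \<omega> / (1 - Re \<omega>) - Im \<zeta>"
  have "(1 - Re \<omega>) * (n + Im \<zeta>) = bdist \<zeta> * Im \<omega>" using \<open>Re \<omega> \<noteq> 1\<close> by (simp add: n_def)
  then have "(1 - Re \<omega>) * ((n + Im \<zeta>) * Im \<zeta>) = (1 - Re \<omega>) * ((Re \<zeta>)\<^sup>2 + (Im \<zeta>)\<^sup>2 - 1 / 3)"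
    using r(2) by (metis (no_types, opaque_lifting) mult.assoc mult.commute)
  then have "(n + Im \<zeta>) * Im \<zeta> = (Re \<zeta>)\<^sup>2 + (Im \<zeta>)\<^sup>2 - 1 / 3" using \<open>Re \<omega> \<noteq> 1\<close> by simp
  then have sq: "1 / 3 + n * Im \<zeta> = (Re \<zeta>)\<^sup>2" by (simp add: power2_eq_square algebra_simps)
  then show "1 / 3 + (bdist \<zeta> * Im \<omega> / (1 - Re \<omega>) - Im \<zeta>) * Im \<zeta> = (Re \<zeta>)\<^sup>2" by (simp add: n_def)
  have sp: "strip_point (Im \<zeta>) n = \<zeta>" unfolding strip_point_def sq using d(2) by (simp add: complex_eq_iff)
  have "(1 - Re \<omega>) *\<^sub>R Complex (n + Im \<zeta>) (bdist \<zeta>) = bdist \<zeta> *\<^sub>R (\<i> * (1 - \<omega>))"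
    using \<open>(1 - Re \<omega>) * (n + Im \<zeta>) = bdist \<zeta> * Im \<omega>\<close> by (simp add: complex_eq_iff)
  then have "line_of (Complex (n + Im \<zeta>) (bdist \<zeta>)) = line_of (\<i> * (1 - \<omega>))"
    using line_of_scaleR[of "1 - Re \<omega>"] line_of_scaleR[OF q] \<open>Re \<omega> \<noteq> 1\<close> by (metis eq_iff_diff_eq_0)
  also have "\<dots> = \<omega>" using p d by (intro line_of_one_minus) (auto simp: blowup_disc_def)
  finally show "strip_chart (Im \<zeta>) (bdist \<zeta> * Im \<omega> / (1 - Re \<omega>) - Im \<zeta>) = (\<omega>, \<zeta>)"
    unfolding n_def[symmetric] strip_chart_def sp by simp
qed

lemma strip_chart_omega:
  assumes "1 / 3 + n * \<eta> \<ge> 0" "bdist (strip_point \<eta> n) > 0"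
  shows "1 - Re (fst (strip_chart \<eta> n)) > 0"
    "bdist (strip_point \<eta> n) * Im (fst (strip_chart \<eta> n)) / (1 - Re (fst (strip_chart \<eta> n))) - \<eta> = n"
proof -
  define a where "a = n + \<eta>"
  define b where "b = bdist (strip_point \<eta> n)"
  have nz: "Complex a b \<noteq> 0" using strip_chart_direction_nonzero[OF assms(1)] by (simp add: a_def b_def)
  have N: "a\<^sup>2 + b\<^sup>2 > 0" using sum_squares_Re_Im_pos[OF nz] by simp
  have b: "b > 0" using assms by (simp add: b_def)
  have w: "Im (fst (strip_chart \<eta> n)) = 2 * a * b / (a\<^sup>2 + b\<^sup>2)"
    using Im_line_of[of "Complex a b"] by (simp add: strip_chart_def a_def[symmetric] b_def[symmetric])
  have one: "1 - Re (fst (strip_chart \<eta> n)) = 2 * b\<^sup>2 / (a\<^sup>2 + b\<^sup>2)"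
    using one_minus_Re_line_of[OF nz] by (simp add: strip_chart_def a_def[symmetric] b_def[symmetric])
  then show "1 - Re (fst (strip_chart \<eta> n)) > 0" using b N by simp
  have "b * (2 * a * b / (a\<^sup>2 + b\<^sup>2)) = a * (2 * b\<^sup>2 / (a\<^sup>2 + b\<^sup>2))"
    by (simp add: power2_eq_square)
  then have "b * Im (fst (strip_chart \<eta> n)) = a * (1 - Re (fst (strip_chart \<eta> n)))" unfolding one w .
  then show "bdist (strip_point \<eta> n) * Im (fst (strip_chart \<eta> n)) / (1 - Re (fst (strip_chart \<eta> n))) - \<eta> = n"
    using \<open>1 - Re (fst (strip_chart \<eta> n)) > 0\<close> by (simp add: b_def[symmetric]) (simp add: a_def)
qed

text \<open>The second coordinate is \<open>n + 2\<close>, which keeps the domain inside the open half plane.\<close>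

definition strip_domain :: "(real^2) set" where
  "strip_domain = {x. \<bar>x $ 1\<bar> < 1 / 4 \<and> \<bar>x $ 2 - 2\<bar> < 1}"

definition strip_coords :: "complex \<times> complex \<Rightarrow> real^2" where
  "strip_coords p = vector [Im (snd p), bdist (snd p) * Im (fst p) / (1 - Re (fst p)) - Im (snd p) + 2]"

definition strip_region :: "(complex \<times> complex) set" where
  "strip_region = {p. 0 < Re (snd p) \<and> \<bar>Im (snd p)\<bar> < 1 / 4 \<and> 0 < 1 - Re (fst p) \<and>
     \<bar>bdist (snd p) * Im (fst p) - Im (snd p) * (1 - Re (fst p))\<bar> < 1 - Re (fst p)}"

lemma strip_point_bounds:
  assumes "\<bar>\<eta>\<bar> < 1 / 4" "\<bar>n\<bar> < 1"
  shows "1 / 3 + n * \<eta> > 0" "bdist (strip_point \<eta> n) > 0"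
proof -
  have nh: "\<bar>n * \<eta>\<bar> < 1 / 4" using mult_strict_mono'[OF assms(2,1)] by (simp add: abs_mult)
  then show pos: "1 / 3 + n * \<eta> > 0" by (simp add: abs_less_iff)
  have "\<bar>\<eta>\<bar>\<^sup>2 < (1 / 4)\<^sup>2" by (rule power_strict_mono[OF assms(1)]) auto
  then have "\<eta>\<^sup>2 < 1 / 16" by (simp add: power2_eq_square)
  then show "bdist (strip_point \<eta> n) > 0" using nh pos by (simp add: bdist_strip_point abs_less_iff)
qed

lemma strip_local_param:
  "local_param blowup_disc (strip_domain, \<lambda>x. strip_chart (x $ 1) (x $ 2 - 2), strip_coords)"
  "(\<lambda>x. strip_chart (x $ 1) (x $ 2 - 2)) ` strip_domain = blowup_disc \<inter> strip_region"
proof -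
  let ?f = "\<lambda>x :: real^2. strip_chart (x $ 1) (x $ 2 - 2)"
  have A: "open strip_domain" unfolding strip_domain_def
    by (intro open_Collect_conj open_Collect_less continuous_intros)
  have V: "strip_domain = half_plane \<inter> strip_domain"
    by (auto simp: strip_domain_def half_plane_def)
  have U: "open strip_region"
    unfolding strip_region_def bdist_def
    by (intro open_Collect_conj open_Collect_less continuous_intros)
  have fV: "?f x \<in> blowup_disc \<inter> strip_region \<and> strip_coords (?f x) = x" if x: "x \<in> strip_domain" for x
  proof -
    define \<eta> where "\<eta> = x $ 1"
    define n where "n = x $ 2 - 2"
    have h: "\<bar>\<eta>\<bar> < 1 / 4" "\<bar>n\<bar> < 1" using x by (auto simp: strip_domain_def \<eta>_def n_def)
    note b = strip_point_bounds[OF h]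
    note o = strip_chart_omega[OF less_imp_le[OF b(1)] b(2)]
    have s: "snd (strip_chart \<eta> n) = strip_point \<eta> n" by (simp add: strip_chart_def)
    have sI: "Im (strip_point \<eta> n) = \<eta>" "Re (strip_point \<eta> n) > 0" using b by (simp_all add: strip_point_def)
    have "bdist (strip_point \<eta> n) * Im (fst (strip_chart \<eta> n)) = (n + \<eta>) * (1 - Re (fst (strip_chart \<eta> n)))"
      using o by (simp add: field_simps)
    then have "bdist (strip_point \<eta> n) * Im (fst (strip_chart \<eta> n)) - \<eta> * (1 - Re (fst (strip_chart \<eta> n))) =
        n * (1 - Re (fst (strip_chart \<eta> n)))"
      by (simp add: algebra_simps)
    then have "\<bar>bdist (strip_point \<eta> n) * Im (fst (strip_chart \<eta> n)) - \<eta> * (1 - Re (fst (strip_chart \<eta> n)))\<bar> =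
        \<bar>n\<bar> * (1 - Re (fst (strip_chart \<eta> n)))"
      using o(1) by (simp add: abs_mult)
    also have "\<dots> < 1 - Re (fst (strip_chart \<eta> n))" using o(1) h by simp
    finally have "strip_chart \<eta> n \<in> strip_region" unfolding strip_region_def mem_Collect_eq s sI using o(1) sI(2) h by simp
    moreover have "strip_coords (strip_chart \<eta> n) = x"
      unfolding strip_coords_def vector2_eq_iff s sI o(2) by (simp add: \<eta>_def n_def)
    moreover have "strip_chart \<eta> n \<in> blowup_disc" using strip_chart_mem b by simp
    ultimately show ?thesis by (simp add: \<eta>_def n_def)
  qed
  have gU: "strip_coords p \<in> strip_domain \<and> ?f (strip_coords p) = p" if p: "p \<in> blowup_disc \<inter> strip_region" for p
  proof -
    obtain w z where wz: "p = (w, z)" by (cases p)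
    have mem: "(w, z) \<in> blowup_disc" and r: "0 < Re z" "\<bar>Im z\<bar> < 1 / 4" "0 < 1 - Re w"
      "\<bar>bdist z * Im w - Im z * (1 - Re w)\<bar> < 1 - Re w"
      using p by (auto simp: wz strip_region_def)
    have "strip_chart (Im z) (bdist z * Im w / (1 - Re w) - Im z) = (w, z)"
    proof (rule strip_chart_inverse(1)[OF mem _ r(1)])
      show "w \<noteq> 1" using r(3) by auto
    qed
    moreover have "bdist z * Im w / (1 - Re w) - Im z = (bdist z * Im w - Im z * (1 - Re w)) / (1 - Re w)"
      using r(3) by (simp add: diff_divide_distrib)
    then have "\<bar>bdist z * Im w / (1 - Re w) - Im z\<bar> < 1" using r(3,4) by (simp add: divide_less_eq)
    ultimately show ?thesis using r by (simp add: wz strip_coords_def strip_domain_def)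
  qed
  have "smooth_on strip_domain ?f"
    unfolding strip_chart_def strip_point_def
  proof (intro smooth_on_intros smooth_on_line_of smooth_on_bdist)
    fix x :: "real^2" assume "x \<in> strip_domain"
    then have pos: "1 / 3 + (x $ 2 - 2) * x $ 1 > 0"
      using strip_point_bounds[of "x $ 1" "x $ 2 - 2"] by (simp add: strip_domain_def)
    then show "0 < 1 / 3 + (x $ 2 - 2) * x $ 1" "0 < 1 / 3 + (x $ 2 - 2) * x $ 1" by simp_all
    from strip_chart_direction_nonzero[OF less_imp_le[OF pos], unfolded strip_point_def]
    show "Complex (x $ 2 - 2 + x $ 1) (bdist (Complex (sqrt (1 / 3 + (x $ 2 - 2) * x $ 1)) (x $ 1))) \<noteq> 0" .
  qed
  moreover have "smooth_on (blowup_disc \<inter> strip_region) strip_coords"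
    unfolding strip_coords_def
    by (intro smooth_on_intros smooth_on_bdist) (auto simp: strip_region_def)
  ultimately show "local_param blowup_disc (strip_domain, ?f, strip_coords)" "?f ` strip_domain = blowup_disc \<inter> strip_region"
    using local_paramI[OF A V U fV gU] by blast+
qed

section \<open>The blown-up disc as a surface\<close>

text \<open>The reflection of the disc in its vertical diameter lifts to the blow-up, since \<open>blowup_fun\<close> depends
  on \<open>Im \<zeta>\<close> and \<open>bdist \<zeta>\<close> only. It exchanges the two exceptional circles.\<close>

definition mirror :: "complex \<times> complex \<Rightarrow> complex \<times> complex" where
  "mirror p = (fst p, - cnj (snd p))"

lemma mirror_mirror [simp]: "mirror (mirror p) = p"
  by (simp add: mirror_def)

lemma mirror_mem: "p \<in> blowup_disc \<Longrightarrow> mirror p \<in> blowup_disc"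
  by (cases p) (simp add: mirror_def blowup_disc_def blowup_fun_def bdist_def)

lemma mirror_diffeomorphism: "diffeomorphism blowup_disc blowup_disc mirror mirror"
proof -
  have "smooth_on blowup_disc mirror" unfolding mirror_def by (intro smooth_on_intros)
  moreover have "mirror ` blowup_disc = blowup_disc"
  proof
    show "blowup_disc \<subseteq> mirror ` blowup_disc"
    proof
      fix p assume "p \<in> blowup_disc"
      then show "p \<in> mirror ` blowup_disc" by (intro image_eqI[of _ _ "mirror p"] mirror_mem) simp_all
    qed
  qed (use mirror_mem in blast)
  ultimately show ?thesis unfolding diffeomorphism_def by simp
qed

lemma exceptional_right_covered:
  assumes p: "(w, z) \<in> blowup_disc" and z: "blowup_fun z = 0" "Re z > 0"
  shows "(w, z) \<in> slope_region \<or> (w, z) \<in> strip_region"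
proof -
  have "Im z = 0" "(Re z)\<^sup>2 = 1 / 3" using z(1) by (auto simp: blowup_fun_eq_0_iff)
  then have bd: "bdist z = 2 / 3" by (simp add: bdist_def)
  note r = blowup_disc_relations(3)[OF p]
  have "\<bar>Im w\<bar> \<le> 1" using r abs_square_le_1[of "Im w"] zero_le_power2[of "Re w"] by linarith
  show ?thesis
  \<comment> \<open>At \<open>- 1 / 2\<close> both charts have room to spare.\<close>
  proof (cases "Re w > - 1 / 2")
    case True
    then have "\<bar>Im w\<bar> < 3 * (2 / 3 * (1 + Re w))" using \<open>\<bar>Im w\<bar> \<le> 1\<close> by simp
    then have "(w, z) \<in> slope_region" using True z(2) \<open>Im z = 0\<close> \<open>(Re z)\<^sup>2 = 1 / 3\<close>
      by (simp add: slope_region_def slope_denom_def bd)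
    then show ?thesis ..
  next
    case False
    then have "\<bar>2 / 3 * Im w\<bar> < 1 - Re w" using \<open>\<bar>Im w\<bar> \<le> 1\<close> by (simp add: abs_mult)
    then have "(w, z) \<in> strip_region" using False z(2) \<open>Im z = 0\<close> by (simp add: strip_region_def bd)
    then show ?thesis ..
  qed
qed

lemma exceptional_right_chart:
  assumes p: "p \<in> blowup_disc" and z: "blowup_fun (snd p) = 0" "Re (snd p) > 0"
  obtains V f g x where "local_param blowup_disc (V, f, g)" "x \<in> V" "f x = p" "x $ 2 > 0"
proof -
  obtain w \<zeta> where wz: "p = (w, \<zeta>)" by (cases p)
  have "p \<in> slope_region \<or> p \<in> strip_region" unfolding wz
    by (rule exceptional_right_covered) (use p z wz in simp_all)
  then show thesis
  proof
    assume "p \<in> slope_region"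
    then have "p \<in> (\<lambda>x. slope_chart (x $ 1) (x $ 2)) ` slope_domain" unfolding slope_local_param(2) using p by blast
    then obtain x where "x \<in> slope_domain" "slope_chart (x $ 1) (x $ 2) = p" by auto
    then show thesis using that[OF slope_local_param(1), of x] by (simp add: slope_domain_def)
  next
    assume "p \<in> strip_region"
    then have "p \<in> (\<lambda>x. strip_chart (x $ 1) (x $ 2 - 2)) ` strip_domain" unfolding strip_local_param(2) using p by blast
    then obtain x where "x \<in> strip_domain" "strip_chart (x $ 1) (x $ 2 - 2) = p" by auto
    then show thesis using that[OF strip_local_param(1), of x] by (auto simp: strip_domain_def abs_less_iff)
  qed
qed

lemma exceptional_chart:
  assumes p: "p \<in> blowup_disc" and z: "blowup_fun (snd p) = 0"
  obtains V f g x where "local_param blowup_disc (V, f, g)" "x \<in> V" "f x = p" "x $ 2 > 0"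
proof -
  have "(Re (snd p))\<^sup>2 = 1 / 3" using z by (simp add: blowup_fun_eq_0_iff)
  then have "Re (snd p) \<noteq> 0" by auto
  then consider "Re (snd p) > 0" | "Re (snd (mirror p)) > 0" unfolding mirror_def by force
  then show thesis
  proof cases
    case 1
    then show thesis using exceptional_right_chart[OF p z] that by metis
  next
    case 2
    have "blowup_fun (snd (mirror p)) = 0" using z by (simp add: blowup_fun_eq_0_iff mirror_def)
    then obtain V f g x where "local_param blowup_disc (V, f, g)" "x \<in> V" "f x = mirror p" "x $ 2 > 0"
      using exceptional_right_chart[OF mirror_mem[OF p]] 2 by metis
    then show thesis using that[OF local_param_diffeomorphism[OF mirror_diffeomorphism], of V f g x] by simp
  qed
qed

lemma smooth_surface_blowup_disc: "smooth_surface blowup_disc"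
  unfolding smooth_surface_def
proof
  fix p assume p: "p \<in> blowup_disc"
  show "\<exists>V f g. local_param blowup_disc (V, f, g) \<and> p \<in> f ` V"
  proof (cases "blowup_fun (snd p) = 0")
    case True
    then show ?thesis using exceptional_chart[OF p] by (metis imageI)
  next
    case False
    then have pr: "p \<in> regular_blowup" using p by (simp add: regular_blowup_def)
    have "smooth_surface regular_disc"
      unfolding smooth_surface_def
    proof
      fix z assume z: "z \<in> regular_disc"
      then have "z \<in> cball 0 1" unfolding regular_disc_def by blast
      then obtain V f g where c: "local_param (cball 0 1) (V, f, g)" "z \<in> f ` V"
        using smooth_surface_disc unfolding smooth_surface_def by blast
      then have "z \<in> f ` (V \<inter> f -` regular_disc)" using z by auto
      then show "\<exists>V f g. local_param regular_disc (V, f, g) \<and> z \<in> f ` V"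
        using local_param_restrict[OF c(1) openin_regular_disc] by blast
    qed
    then have "smooth_surface regular_blowup" by (rule smooth_surface_diffeomorphism[OF regular_blowup_diffeomorphism])
    then obtain V f g where "local_param regular_blowup (V, f, g)" "p \<in> f ` V"
      using pr unfolding smooth_surface_def by blast
    then show ?thesis using local_param_of_openin[OF _ openin_regular_blowup] by blast
  qed
qed

lemma surface_boundary_blowup_disc: "surface_boundary blowup_disc = {(\<omega>, \<zeta>). \<omega> = 1 \<and> bdist \<zeta> = 0}"
proof (rule Set.set_eqI)
  fix p :: "complex \<times> complex"
  let ?B = "{(\<omega>, \<zeta>). \<omega> = (1 :: complex) \<and> bdist \<zeta> = 0}"
  have B: "?B \<subseteq> regular_blowup"
    by (auto simp: regular_blowup_def blowup_disc_def blowup_fun_def complex_eq_iff norm_eq_1_iff_Re_Im)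
  show "p \<in> surface_boundary blowup_disc \<longleftrightarrow> p \<in> ?B"
  proof (cases "p \<in> regular_blowup")
    case True
    then have "p \<in> surface_boundary blowup_disc \<longleftrightarrow> p \<in> surface_boundary regular_blowup"
      unfolding surface_boundary_openin[OF openin_regular_blowup] by blast
    also have "\<dots> \<longleftrightarrow> p \<in> (\<lambda>\<zeta>. (line_of (blowup_fun \<zeta>), \<zeta>)) ` (regular_disc \<inter> {\<zeta>. bdist \<zeta> = 0})"
      unfolding surface_boundary_diffeomorphism[OF regular_blowup_diffeomorphism]
        surface_boundary_openin[OF openin_regular_disc] surface_boundary_disc ..
    also have "\<dots> \<longleftrightarrow> bdist (snd p) = 0"
    proof
      assume bd: "bdist (snd p) = 0"
      have "snd p \<in> regular_disc" "(line_of (blowup_fun (snd p)), snd p) = p"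
        using regular_blowup_diffeomorphism True by (auto simp: diffeomorphism_def)
      then show "p \<in> (\<lambda>\<zeta>. (line_of (blowup_fun \<zeta>), \<zeta>)) ` (regular_disc \<inter> {\<zeta>. bdist \<zeta> = 0})"
        using bd by (intro image_eqI[of _ _ "snd p"]) auto
    qed auto
    also have "\<dots> \<longleftrightarrow> p \<in> ?B"
      using True blowup_disc_relations(5)[of "fst p" "snd p"] by (cases p) (auto simp: regular_blowup_def)
    finally show ?thesis .
  next
    case False
    have "p \<notin> surface_boundary blowup_disc"
    proof
      assume b: "p \<in> surface_boundary blowup_disc"
      then have "p \<in> blowup_disc" using surface_boundary_subset by blast
      then have "blowup_fun (snd p) = 0" using False by (simp add: regular_blowup_def)
      with \<open>p \<in> blowup_disc\<close> obtain V f g x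
        where "local_param blowup_disc (V, f, g)" "x \<in> V" "f x = p" "x $ 2 > 0"
        by (rule exceptional_chart)
      then show False using surface_boundary_local_param[of blowup_disc V f g x] b by simp
    qed
    then show ?thesis using False B by blast
  qed
qed

text \<open>In the two charts of the blow-up the coordinates \<open>m\<close> and \<open>n\<close> are reciprocal.\<close>

lemma strip_slope_transition:
  assumes x: "x \<in> slope_domain" "x $ 1 \<noteq> 0"
  shows "strip_coords (slope_chart (x $ 1) (x $ 2)) = vector [x $ 1 * ((x $ 2)\<^sup>2 - 1 / 3), inverse (x $ 1) + 2]"
proof -
  define m where "m = x $ 1"
  define \<xi> where "\<xi> = x $ 2"
  have h: "\<bar>m\<bar> < 3" "0 < \<xi>" "\<bar>\<xi>\<^sup>2 - 1 / 3\<bar> < 1 / 9" "m \<noteq> 0" using x by (auto simp: slope_domain_def m_def \<xi>_def)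
  define q where "q = bdist (slope_point m \<xi>)"
  define \<eta> where "\<eta> = Im (slope_point m \<xi>)"
  have b: "q > 0" "1 + m * \<eta> > 0" using slope_point_bounds[OF h(1,3)] by (auto simp: q_def \<eta>_def)
  define b1 where "b1 = q * m"
  define a where "a = 1 + m * \<eta>"
  have nz: "Complex a b1 \<noteq> 0" using b by (simp add: complex_eq_iff a_def)
  have b1: "b1 \<noteq> 0" using b h by (simp add: b1_def)
  have N: "a\<^sup>2 + b1\<^sup>2 > 0" using sum_squares_Re_Im_pos[OF nz] by simp
  have w: "Im (fst (slope_chart m \<xi>)) = 2 * a * b1 / (a\<^sup>2 + b1\<^sup>2)"
    using Im_line_of[of "Complex a b1"]
    by (simp add: slope_chart_def a_def[symmetric] b1_def[symmetric] q_def[symmetric] \<eta>_def[symmetric])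
  have "1 - Re (fst (slope_chart m \<xi>)) = 2 * b1\<^sup>2 / (a\<^sup>2 + b1\<^sup>2)"
    using one_minus_Re_line_of[OF nz]
    by (simp add: slope_chart_def a_def[symmetric] b1_def[symmetric] q_def[symmetric] \<eta>_def[symmetric])
  then have "q * Im (fst (slope_chart m \<xi>)) / (1 - Re (fst (slope_chart m \<xi>))) = q * a / b1"
    unfolding w using N b1 by (simp add: power2_eq_square)
  also have "\<dots> = inverse m + \<eta>" using b h by (simp add: b1_def a_def field_simps)
  finally have "q * Im (fst (slope_chart m \<xi>)) / (1 - Re (fst (slope_chart m \<xi>))) - \<eta> = inverse m" by simp
  moreover have "snd (slope_chart m \<xi>) = slope_point m \<xi>" by (simp add: slope_chart_def)
  moreover have "\<eta> = m * (\<xi>\<^sup>2 - 1 / 3)" by (simp add: \<eta>_def slope_point_def)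
  ultimately show ?thesis
    unfolding strip_coords_def m_def[symmetric] \<xi>_def[symmetric] by (simp add: q_def[symmetric] \<eta>_def[symmetric])
qed

lemma slope_domain_convex: "convex slope_domain"
proof -
  have eq: "slope_domain = {x. - 3 < x $ 1} \<inter> {x. x $ 1 < 3} \<inter> {x. sqrt 2 / 3 < x $ 2} \<inter> {x. x $ 2 < 2 / 3}"
  proof -
    have key: "0 < t \<and> \<bar>t\<^sup>2 - 1 / 3\<bar> < 1 / 9 \<longleftrightarrow> sqrt 2 / 3 < t \<and> t < 2 / 3" for t :: real
    proof
      assume t: "0 < t \<and> \<bar>t\<^sup>2 - 1 / 3\<bar> < 1 / 9"
      have "(sqrt 2 / 3)\<^sup>2 = (2 / 9 :: real)" "(2 / 3)\<^sup>2 = (4 / 9 :: real)" by (simp_all add: power_divide)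
      then have "(sqrt 2 / 3)\<^sup>2 < t\<^sup>2" "t\<^sup>2 < (2 / 3)\<^sup>2"
        using t abs_ge_self[of "t\<^sup>2 - 1 / 3"] abs_ge_minus_self[of "t\<^sup>2 - 1 / 3"] by linarith+
      then show "sqrt 2 / 3 < t \<and> t < 2 / 3"
        using power_less_imp_less_base[of "sqrt 2 / 3" 2 t] power_less_imp_less_base[of t 2 "2 / 3"] t by simp
    next
      assume t: "sqrt 2 / 3 < t \<and> t < 2 / 3"
      have s: "0 < sqrt 2 / (3 :: real)" by simp
      then have "0 < t" using t by linarith
      moreover have "(sqrt 2 / 3)\<^sup>2 < t\<^sup>2" "t\<^sup>2 < (2 / 3)\<^sup>2"
        using t s \<open>0 < t\<close> by (auto intro!: power_strict_mono)
      moreover have "(sqrt 2 / 3)\<^sup>2 = (2 / 9 :: real)" "(2 / 3)\<^sup>2 = (4 / 9 :: real)" by (simp_all add: power_divide)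
      ultimately have "0 < t" "- (1 / 9) < t\<^sup>2 - 1 / 3" "t\<^sup>2 - 1 / 3 < 1 / 9" by linarith+
      then show "0 < t \<and> \<bar>t\<^sup>2 - 1 / 3\<bar> < 1 / 9" unfolding abs_less_iff by (intro conjI; linarith)
    qed
    have "\<bar>t\<bar> < 3 \<longleftrightarrow> - 3 < t \<and> t < 3" for t :: real by linarith
    with key show ?thesis unfolding slope_domain_def by (intro Set.set_eqI) (simp only: mem_Collect_eq Int_iff conj_assoc)
  qed
  have "convex {x :: real^2. a < x $ i}" "convex {x :: real^2. x $ i < a}" for a i
    using convex_halfspace_gt[of a "axis i 1 :: real^2"] convex_halfspace_lt[of "axis i 1 :: real^2" a]
    by (simp_all add: inner_axis')
  then show ?thesis unfolding eq by (intro convex_Int)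
qed

lemma strip_domain_convex: "convex strip_domain"
proof -
  have eq: "strip_domain = {x. - (1 / 4) < x $ 1} \<inter> {x. x $ 1 < 1 / 4} \<inter> {x. 1 < x $ 2} \<inter> {x. x $ 2 < 3}"
    by (auto simp: strip_domain_def abs_less_iff)
  have "convex {x :: real^2. a < x $ i}" "convex {x :: real^2. x $ i < a}" for a i
    using convex_halfspace_gt[of a "axis i 1 :: real^2"] convex_halfspace_lt[of "axis i 1 :: real^2" a]
    by (simp_all add: inner_axis')
  then show ?thesis unfolding eq by (intro convex_Int)
qed

lemma open_slope_domain: "open slope_domain"
  unfolding slope_domain_def by (intro open_Collect_conj open_Collect_less continuous_intros)

lemma open_strip_domain: "open strip_domain"
  unfolding strip_domain_def by (intro open_Collect_conj open_Collect_less continuous_intros)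

lemma transition_derivative:
  fixes x :: "real^2"
  assumes "x $ 1 \<noteq> 0"
  defines "L \<equiv> (\<lambda>v :: real^2. vector [v $ 1 * ((x $ 2)\<^sup>2 - 1 / 3) + x $ 1 * (2 * x $ 2 * v $ 2),
      - (inverse (x $ 1) * v $ 1 * inverse (x $ 1))] :: real^2)"
  shows "((\<lambda>x. vector [x $ 1 * ((x $ 2)\<^sup>2 - 1 / 3), inverse (x $ 1) + 2] :: real^2) has_derivative L) (at x)"
    "det (matrix L) = 2 * x $ 2 / x $ 1"
proof -
  have vec: "vector [a, b] = a *\<^sub>R axis 1 1 + b *\<^sub>R (axis 2 1 :: real^2)" for a b :: real
    by (simp add: vec_eq_iff forall_2 axis_def)
  have nth: "((\<lambda>x :: real^2. x $ i) has_derivative (\<lambda>v. v $ i)) (at x)" for i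
    by (rule bounded_linear_imp_has_derivative[OF bounded_linear_vec_nth])
  show "((\<lambda>x. vector [x $ 1 * ((x $ 2)\<^sup>2 - 1 / 3), inverse (x $ 1) + 2] :: real^2) has_derivative L) (at x)"
    unfolding L_def vec using assms(1)
    by (auto intro!: derivative_eq_intros nth simp: fun_eq_iff algebra_simps)
  show "det (matrix L) = 2 * x $ 2 / x $ 1"
    using assms(1) by (simp add: det_2 matrix_def L_def axis_def field_simps)
qed

text \<open>The Jacobian of the transition has the sign of \<open>m\<close>. The two charts overlap on the exceptional circle
  both for \<open>m = 2\<close> and for \<open>m = - 2\<close>: a Moebius band.\<close>

lemma not_orientable_blowup_disc: "\<not> orientable blowup_disc"
proof -
  let ?f = "\<lambda>x :: real^2. slope_chart (x $ 1) (x $ 2)" and ?f' = "\<lambda>x :: real^2. strip_chart (x $ 1) (x $ 2 - 2)"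
  let ?T = "\<lambda>x. vector [x $ 1 * ((x $ 2)\<^sup>2 - 1 / 3), inverse (x $ 1) + 2] :: real^2"
  have pt: "\<exists>L. x \<in> slope_domain \<and> ?f x \<in> ?f' ` strip_domain \<and> ((strip_coords \<circ> ?f) has_derivative L) (at x) \<and>
      det (matrix L) = 2 * x $ 2 / x $ 1"
    if x: "x = vector [m, sqrt (1 / 3)]" "m = 2 \<or> m = - 2" for x :: "real^2" and m
  proof -
    have dom: "x \<in> slope_domain" using x by (auto simp: slope_domain_def)
    have m0: "x $ 1 \<noteq> 0" using x by auto
    have img: "?f x \<in> blowup_disc \<inter> slope_region" using dom slope_local_param(2) by blast
    have "strip_coords (?f x) = ?T x" by (rule strip_slope_transition[OF dom m0])
    then have sc: "strip_coords (?f x) $ 1 = 0" "strip_coords (?f x) $ 2 = inverse m + 2" using x by simp_all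
    obtain w z where wz: "?f x = (w, z)" by (cases "?f x")
    have z: "Im z = 0" "Re z = sqrt (1 / 3)" using wz x by (auto simp: slope_chart_def slope_point_def)
    then have bd: "bdist z = 2 / 3" by (simp add: bdist_def)
    have mem: "(w, z) \<in> blowup_disc" using img wz by auto
    have "bdist z * Im w / (1 - Re w) = inverse m" using sc(2) z(1) by (simp add: strip_coords_def wz)
    moreover from this have "w \<noteq> 1" using x(2) by auto
    then have "1 - Re w > 0" using Re_less_1_of_unit[OF blowup_disc_relations(3)[OF mem]] by simp
    ultimately have "bdist z * Im w = inverse m * (1 - Re w)" by (simp add: field_simps)
    then have "(w, z) \<in> strip_region"
      using z \<open>1 - Re w > 0\<close> x(2) by (auto simp: strip_region_def abs_mult)
    then have "?f x \<in> ?f' ` strip_domain" unfolding strip_local_param(2) wz using mem by blast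
    moreover have "open (slope_domain \<inter> {x. x $ 1 \<noteq> 0})"
      by (intro open_Int open_slope_domain open_Collect_neq continuous_intros)
    then have "((strip_coords \<circ> ?f) has_derivative (\<lambda>v :: real^2. vector [v $ 1 * ((x $ 2)\<^sup>2 - 1 / 3) + x $ 1 * (2 * x $ 2 * v $ 2),
      - (inverse (x $ 1) * v $ 1 * inverse (x $ 1))] :: real^2)) (at x)"
      by (rule has_derivative_transform_within_open[OF transition_derivative(1)[OF m0]])
        (use dom m0 strip_slope_transition in auto)
    ultimately show ?thesis using transition_derivative(2)[OF m0] dom by blast
  qed
  from pt[of "vector [2, sqrt (1 / 3)]" 2] obtain L where L: "vector [2, sqrt (1 / 3)] \<in> slope_domain"
    "?f (vector [2, sqrt (1 / 3)]) \<in> ?f' ` strip_domain"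
    "((strip_coords \<circ> ?f) has_derivative L) (at (vector [2, sqrt (1 / 3)]))" "det (matrix L) = sqrt (1 / 3)" by auto
  from pt[of "vector [- 2, sqrt (1 / 3)]" "- 2"] obtain M where M: "vector [- 2, sqrt (1 / 3)] \<in> slope_domain"
    "?f (vector [- 2, sqrt (1 / 3)]) \<in> ?f' ` strip_domain"
    "((strip_coords \<circ> ?f) has_derivative M) (at (vector [- 2, sqrt (1 / 3)]))" "det (matrix M) = - sqrt (1 / 3)" by auto
  show ?thesis
    by (rule not_orientable_if_transition_changes_sign[OF slope_local_param(1) open_slope_domain
          convex_connected[OF slope_domain_convex] strip_local_param(1) open_strip_domain
          convex_connected[OF strip_domain_convex] L(1-3) _ M(1-3)])
      (simp_all add: L(4) M(4))
qed

section \<open>The blown-up disc inside the solid torus\<close>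

text \<open>With \<open>\<zeta> = \<xi> + \<i> \<eta>\<close>, the disc coordinate is \<open>\<xi>/2 + \<i> \<epsilon> \<xi> \<eta>\<close>: on the circle \<open>\<zeta> = sin s + \<i> cos s\<close> this
  is the figure eight \<open>sin s / 2 + \<i> \<epsilon> sin (2 s) / 2\<close> of the pattern. The rotation by \<open>4 \<eta>\<close> spreads the
  figure eight along the solid torus.\<close>

definition torus_map :: "real \<Rightarrow> complex \<times> complex \<Rightarrow> complex \<times> complex" where
  "torus_map \<epsilon> = (\<lambda>(\<omega>, \<zeta>). (\<omega> * cis (4 * Im \<zeta>), Complex (Re \<zeta> / 2) (\<epsilon> * (Re \<zeta> * Im \<zeta>))))"

lemma smooth_on_torus_map: "smooth_on S (torus_map \<epsilon>)"
proof -
  have "smooth_on S (\<lambda>p. (fst p * cis (4 * Im (snd p)), Complex (Re (snd p) * (1 / 2)) (\<epsilon> * (Re (snd p) * Im (snd p)))))"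
    by (intro smooth_on_intros)
  then show ?thesis by (simp add: torus_map_def case_prod_unfold)
qed

lemma torus_map_boundary:
  "torus_map \<epsilon> ` {(\<omega>, \<zeta>). \<omega> = 1 \<and> bdist \<zeta> = 0} = whitehead_pattern \<epsilon>"
proof -
  have eq: "{(\<omega>, \<zeta>). \<omega> = (1 :: complex) \<and> bdist \<zeta> = 0} = range (\<lambda>s :: real. (1 :: complex, Complex (sin s) (cos s)))"
  proof
    show "{(\<omega>, \<zeta>). \<omega> = (1 :: complex) \<and> bdist \<zeta> = 0} \<subseteq> range (\<lambda>s :: real. (1 :: complex, Complex (sin s) (cos s)))"
    proof
      fix p assume "p \<in> {(\<omega>, \<zeta>). \<omega> = (1 :: complex) \<and> bdist \<zeta> = 0}"
      then have p: "fst p = 1" "(Im (snd p))\<^sup>2 + (Re (snd p))\<^sup>2 = 1" by (auto simp: bdist_def)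
      from sincos_total_2pi[OF p(2)] obtain s where "Im (snd p) = cos s" "Re (snd p) = sin s" by metis
      then show "p \<in> range (\<lambda>s :: real. (1 :: complex, Complex (sin s) (cos s)))"
        using p(1) by (intro image_eqI[of _ _ s]) (simp_all add: prod_eq_iff complex_eq_iff)
    qed
    show "range (\<lambda>s :: real. (1 :: complex, Complex (sin s) (cos s))) \<subseteq> {(\<omega>, \<zeta>). \<omega> = (1 :: complex) \<and> bdist \<zeta> = 0}"
      by (auto simp: bdist_def cos_squared_eq)
  qed
  show ?thesis
    unfolding eq whitehead_pattern_def image_image
    by (intro image_cong refl) (simp add: torus_map_def sin_double)
qed

lemma torus_map_mem: "\<epsilon> \<in> {1, - 1} \<Longrightarrow> p \<in> blowup_disc \<Longrightarrow> torus_map \<epsilon> p \<in> S1 \<times> D2"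
proof -
  assume e: "\<epsilon> \<in> {1, - 1}" and "p \<in> blowup_disc"
  obtain w z where p: "p = (w, z)" by (cases p)
  have wz: "cmod w = 1" "(Re z)\<^sup>2 + (Im z)\<^sup>2 \<le> 1"
    using \<open>p \<in> blowup_disc\<close> by (auto simp: p blowup_disc_def bdist_def)
  have "(Re z)\<^sup>2 * (Im z)\<^sup>2 \<le> (Re z)\<^sup>2 * (3 / 4) \<or> (Re z)\<^sup>2 \<le> 1 / 4"
  proof (cases "(Re z)\<^sup>2 \<le> 1 / 4")
    case False
    then have "(Im z)\<^sup>2 \<le> 3 / 4" using wz(2) by linarith
    then show ?thesis by (intro disjI1 mult_left_mono) auto
  qed simp
  then have "(Re z)\<^sup>2 / 4 + (Re z)\<^sup>2 * (Im z)\<^sup>2 \<le> 1"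
  proof
    assume "(Re z)\<^sup>2 \<le> 1 / 4"
    moreover have "(Im z)\<^sup>2 \<le> 1" using wz(2) zero_le_power2[of "Re z"] by linarith
    ultimately have "(Re z)\<^sup>2 * (Im z)\<^sup>2 \<le> 1 / 4 * 1" by (intro mult_mono) auto
    then show ?thesis using \<open>(Re z)\<^sup>2 \<le> 1 / 4\<close> by linarith
  next
    assume "(Re z)\<^sup>2 * (Im z)\<^sup>2 \<le> (Re z)\<^sup>2 * (3 / 4)"
    moreover have "(Re z)\<^sup>2 \<le> 1" using wz(2) zero_le_power2[of "Im z"] by linarith
    ultimately show ?thesis by linarith
  qed
  moreover have "\<epsilon>\<^sup>2 = 1" using e by auto
  ultimately have "cmod (Complex (Re z / 2) (\<epsilon> * (Re z * Im z))) \<le> 1"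
    unfolding norm_le_1_iff_Re_Im by (simp add: power_mult_distrib power_divide)
  then show "torus_map \<epsilon> p \<in> S1 \<times> D2" using wz(1) by (simp add: p torus_map_def norm_mult)
qed

lemma compact_blowup_disc: "compact blowup_disc"
proof -
  have eq: "blowup_disc = {p. cmod (fst p) = 1} \<inter> {p. 0 \<le> bdist (snd p)} \<inter>
      {p. blowup_fun (snd p) = fst p * cnj (blowup_fun (snd p))}"
    by (auto simp: blowup_disc_def)
  have cont: "continuous_on UNIV (\<lambda>p :: complex \<times> complex. blowup_fun (snd p))"
    by (rule smooth_on_continuous[OF smooth_on_blowup_fun]) (intro smooth_on_intros)
  have "closed blowup_disc"
    unfolding eq bdist_def
    by (intro closed_Int closed_Collect_eq closed_Collect_le continuous_intros cont)
  moreover have "blowup_disc \<subseteq> cball 0 1 \<times> cball 0 1"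
  proof
    fix p assume "p \<in> blowup_disc"
    then have "cmod (fst p) = 1" "bdist (snd p) \<ge> 0" by (auto simp: blowup_disc_def)
    then have "fst p \<in> cball 0 1" by simp
    moreover have "snd p \<in> cball 0 1" unfolding cball_iff_bdist by fact
    ultimately show "p \<in> cball 0 1 \<times> cball 0 1" by (simp only: mem_Times_iff)
  qed
  then have "bounded blowup_disc" by (rule bounded_subset[OF bounded_Times[OF bounded_cball bounded_cball]])
  ultimately show ?thesis by (simp add: compact_eq_bounded_closed)
qed

text \<open>Where it is nonzero, the first coordinate of \<open>torus_map\<close> at a point over \<open>\<zeta>\<close> is the line through
  \<open>twisted_fun \<zeta>\<close>.\<close>

definition twisted_fun :: "complex \<Rightarrow> complex" where
  "twisted_fun \<zeta> = cis (2 * Im \<zeta>) * blowup_fun \<zeta>"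

text \<open>The real and imaginary part of \<open>blowup_fun\<close> on the vertical diameter.\<close>

definition axis_re :: "real \<Rightarrow> real" where "axis_re \<eta> = 3 / 2 * \<eta>\<^sup>2 - 1 / 2"
definition axis_im :: "real \<Rightarrow> real" where "axis_im \<eta> = 3 / 2 * (1 - \<eta>\<^sup>2) * \<eta>"

lemma twisted_fun_axis:
  "Re (twisted_fun (Complex 0 \<eta>)) = cos (2 * \<eta>) * axis_re \<eta> - sin (2 * \<eta>) * axis_im \<eta>"
  "Im (twisted_fun (Complex 0 \<eta>)) = sin (2 * \<eta>) * axis_re \<eta> + cos (2 * \<eta>) * axis_im \<eta>"
  by (simp_all add: twisted_fun_def blowup_fun_def bdist_def axis_re_def axis_im_def field_simps)

lemma twisted_fun_axis_even: "Re (twisted_fun (Complex 0 (- \<eta>))) = Re (twisted_fun (Complex 0 \<eta>))"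
  unfolding twisted_fun_axis by (simp add: axis_re_def axis_im_def)

text \<open>On the vertical diameter \<open>twisted_fun\<close> stays in the left half plane. Its real part there is
  \<open>cos (2 \<eta>) axis_re \<eta> - sin (2 \<eta>) axis_im \<eta>\<close>. For small \<open>\<eta>\<close> and for large \<open>\<eta>\<close> the factors \<open>cos (2 \<eta>)\<close> and
  \<open>axis_re \<eta>\<close> have opposite signs. In between, \<open>cos (2 \<eta>) \<le> sin (2 \<eta>)\<close> and \<open>axis_re \<eta> < axis_im \<eta>\<close>.\<close>

lemma twisted_fun_axis_neg_nonneg:
  assumes "0 \<le> \<eta>" "\<eta> \<le> 1"
  shows "Re (twisted_fun (Complex 0 \<eta>)) < 0"
proof -
  have a4: "3 < pi" "pi < 3.1416" using pi_approx by simp_all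
  have sin_pos: "sin (2 * \<eta>) > 0" if "\<eta> > 0" using that assms a4 by (intro sin_gt_zero) auto
  have b_nn: "axis_im \<eta> \<ge> 0" unfolding axis_im_def using assms
    by (intro mult_nonneg_nonneg) (auto simp: power_le_one)
  have e1: "\<eta>\<^sup>2 \<le> 1" using assms by (simp add: power_le_one)
  \<comment> \<open>The first boundary is the zero of \<open>axis_re\<close>, the second the zero of \<open>cos (2 \<eta>)\<close>.\<close>
  consider "\<eta>\<^sup>2 < 1 / 3" | "\<eta>\<^sup>2 \<ge> 1 / 3" "\<eta> < pi / 4" | "\<eta> \<ge> pi / 4" by linarith
  then show ?thesis
  proof cases
    case 1
    have a: "axis_re \<eta> < 0" using 1 by (simp add: axis_re_def)
    have "\<eta> < 0.6"
    proof (rule ccontr)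
      assume "\<not> \<eta> < 0.6"
      then have "0.6\<^sup>2 \<le> \<eta>\<^sup>2" by (intro power_mono) auto
      then show False using 1 by (simp add: power2_eq_square)
    qed
    then have "cos (2 * \<eta>) > 0" using assms a4 by (intro cos_gt_zero_pi) auto
    then have "cos (2 * \<eta>) * axis_re \<eta> < 0" using a by (simp add: mult_pos_neg)
    moreover have "sin (2 * \<eta>) * axis_im \<eta> \<ge> 0"
      using sin_pos b_nn assms by (cases "\<eta> = 0") (auto intro!: mult_nonneg_nonneg)
    ultimately show ?thesis unfolding twisted_fun_axis by linarith
  next
    case 2
    then have pos: "\<eta> > 0" using assms by (cases "\<eta> = 0") auto
    have eta: "\<eta> < 0.7854" using 2 a4 by linarith
    have "\<eta> > 0.5"
    proof (rule ccontr)
      assume "\<not> \<eta> > 0.5"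
      then have "\<eta>\<^sup>2 \<le> 0.5\<^sup>2" using assms by (intro power_mono) auto
      then show False using 2 by (simp add: power2_eq_square)
    qed
    have c: "cos (2 * \<eta>) > 0" using assms 2 by (intro cos_gt_zero_pi) auto
    have "cos (2 * \<eta>) \<le> sin (2 * \<eta>)"
    proof -
      have "sin (2 * \<eta>) = cos (pi / 2 - 2 * \<eta>)" by (simp add: cos_sin_eq[symmetric] sin_cos_eq)
      moreover have "cos (2 * \<eta>) \<le> cos (pi / 2 - 2 * \<eta>)"
        using \<open>\<eta> > 0.5\<close> 2 a4 by (intro cos_monotone_0_pi_le) auto
      ultimately show ?thesis by simp
    qed
    have "\<eta>\<^sup>2 < 0.617" using power_strict_mono[OF eta assms(1), of 2] by (simp add: power2_eq_square)
    have ab: "axis_re \<eta> < axis_im \<eta>"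
    proof -
      have "\<eta> * (\<eta>\<^sup>2 + \<eta> - 1) \<le> \<eta> * 0.4024"
        using \<open>\<eta>\<^sup>2 < 0.617\<close> eta pos by (intro mult_left_mono) auto
      also have "\<dots> < 1 / 3" using eta by simp
      finally have "\<eta> * (\<eta>\<^sup>2 + \<eta> - 1) < 1 / 3" .
      moreover have "axis_im \<eta> - axis_re \<eta> = 1 / 2 - 3 / 2 * (\<eta> * (\<eta>\<^sup>2 + \<eta> - 1))"
        by (simp add: axis_re_def axis_im_def power2_eq_square field_simps)
      ultimately show ?thesis by linarith
    qed
    have "cos (2 * \<eta>) * axis_re \<eta> < sin (2 * \<eta>) * axis_im \<eta>"
    proof -
      have "cos (2 * \<eta>) * axis_re \<eta> < cos (2 * \<eta>) * axis_im \<eta>" using c ab by simp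
      also have "\<dots> \<le> sin (2 * \<eta>) * axis_im \<eta>" by (rule mult_right_mono) fact+
      finally show ?thesis .
    qed
    then show ?thesis unfolding twisted_fun_axis by simp
  next
    case 3
    have "cos (2 * \<eta>) \<le> cos (pi / 2)" using 3 assms a4 by (intro cos_monotone_0_pi_le) auto
    then have c: "cos (2 * \<eta>) \<le> 0" by simp
    have "\<eta> > 0.7" using 3 a4 by linarith
    have a: "axis_re \<eta> > 0"
    proof -
      have "0.7\<^sup>2 < \<eta>\<^sup>2" using \<open>\<eta> > 0.7\<close> by (intro power_strict_mono) auto
      then show ?thesis by (simp add: axis_re_def power2_eq_square)
    qed
    have s: "sin (2 * \<eta>) > 0" using sin_pos \<open>\<eta> > 0.7\<close> by simp
    show ?thesis
    proof (cases "\<eta> = 1")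
      case True
      have "cos (2 :: real) < 0" using cos_two_less_zero by simp
      then show ?thesis unfolding twisted_fun_axis True by (simp add: axis_re_def axis_im_def)
    next
      case False
      then have "\<eta>\<^sup>2 < 1" using assms by (simp add: power_less_one_iff abs_square_less_1)
      then have "axis_im \<eta> > 0" using \<open>\<eta> > 0.7\<close> by (simp add: axis_im_def)
      then have "sin (2 * \<eta>) * axis_im \<eta> > 0" using s by simp
      moreover have "cos (2 * \<eta>) * axis_re \<eta> \<le> 0" using c a by (simp add: mult_nonpos_nonneg)
      ultimately show ?thesis unfolding twisted_fun_axis by linarith
    qed
  qed
qed

lemma twisted_fun_axis_neg: "\<bar>\<eta>\<bar> \<le> 1 \<Longrightarrow> Re (twisted_fun (Complex 0 \<eta>)) < 0"
  using twisted_fun_axis_neg_nonneg[of \<eta>] twisted_fun_axis_neg_nonneg[of "- \<eta>"] twisted_fun_axis_even[of \<eta>]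
  by (cases "\<eta> \<ge> 0") auto

text \<open>The tangent of half the angle of the first coordinate of \<open>torus_map\<close>, see
  \<open>torus_map_first_coordinate\<close>.\<close>

definition half_angle_tan :: "complex \<Rightarrow> real" where
  "half_angle_tan \<zeta> = Im (twisted_fun \<zeta>) / Re (twisted_fun \<zeta>)"

text \<open>The numerator of the derivative is the Wronskian of the two components of \<open>twisted_fun\<close>. The rotation
  contributes twice the squared norm of \<open>blowup_fun\<close>, and with \<open>e = \<eta>\<^sup>2\<close> the total is
  \<open>- (3 e / 2 - 1 / 2)\<^sup>2 - 9 e\<^sup>2 (1 - e) / 2\<close>.\<close>

lemma half_angle_tan_axis_derivative:
  assumes "\<bar>\<eta>\<bar> \<le> 1"
  shows "\<exists>D<0. ((\<lambda>\<eta>. half_angle_tan (Complex 0 \<eta>)) has_real_derivative D) (at \<eta>)"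
proof -
  let ?c = "\<lambda>\<eta>. cos (2 * \<eta>)" and ?s = "\<lambda>\<eta>. sin (2 * \<eta> :: real)"
  define k1 where "k1 \<eta> = ?c \<eta> * axis_re \<eta> - ?s \<eta> * axis_im \<eta>" for \<eta>
  define k2 where "k2 \<eta> = ?s \<eta> * axis_re \<eta> + ?c \<eta> * axis_im \<eta>" for \<eta>
  define a' where "a' = 3 * \<eta>"
  define b' where "b' = 3 / 2 - 9 / 2 * \<eta>\<^sup>2"
  have da: "(axis_re has_real_derivative a') (at \<eta>)"
    unfolding axis_re_def[abs_def] a'_def by (auto intro!: derivative_eq_intros)
  have db: "(axis_im has_real_derivative b') (at \<eta>)"
    unfolding axis_im_def[abs_def] b'_def by (auto intro!: derivative_eq_intros simp: power2_eq_square field_simps)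
  define a where "a = axis_re \<eta>"
  define b where "b = axis_im \<eta>"
  define k1' where "k1' = - 2 * ?s \<eta> * a + ?c \<eta> * a' - (2 * ?c \<eta> * b + ?s \<eta> * b')"
  define k2' where "k2' = 2 * ?c \<eta> * a + ?s \<eta> * a' + (- 2 * ?s \<eta> * b + ?c \<eta> * b')"
  have d1: "(k1 has_real_derivative k1') (at \<eta>)"
    unfolding k1_def[abs_def] k1'_def by (auto intro!: derivative_eq_intros da db simp: a_def b_def)
  have d2: "(k2 has_real_derivative k2') (at \<eta>)"
    unfolding k2_def[abs_def] k2'_def by (auto intro!: derivative_eq_intros da db simp: a_def b_def)
  have nz: "k1 \<eta> \<noteq> 0" using twisted_fun_axis_neg[OF assms] unfolding twisted_fun_axis k1_def by linarith
  have "((\<lambda>\<eta>. k2 \<eta> / k1 \<eta>) has_real_derivative (k2' * k1 \<eta> - k2 \<eta> * k1') / (k1 \<eta> * k1 \<eta>)) (at \<eta>)"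
    by (rule DERIV_divide[OF d2 d1 nz])
  moreover have "half_angle_tan (Complex 0 \<eta>) = k2 \<eta> / k1 \<eta>" for \<eta>
    unfolding half_angle_tan_def twisted_fun_axis k1_def k2_def ..
  ultimately have "((\<lambda>\<eta>. half_angle_tan (Complex 0 \<eta>)) has_real_derivative (k2' * k1 \<eta> - k2 \<eta> * k1') / (k1 \<eta> * k1 \<eta>)) (at \<eta>)"
    by simp
  moreover have "k2' * k1 \<eta> - k2 \<eta> * k1' = (2 * (a\<^sup>2 + b\<^sup>2) + (a * b' - b * a')) * ((?s \<eta>)\<^sup>2 + (?c \<eta>)\<^sup>2)"
  proof -
    have "(2 * c * a + s * a' + (- 2 * s * b + c * b')) * (c * a - s * b) -
        (s * a + c * b) * (- 2 * s * a + c * a' - (2 * c * b + s * b')) =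
        (2 * (a\<^sup>2 + b\<^sup>2) + (a * b' - b * a')) * (s\<^sup>2 + c\<^sup>2)" for s c :: real
      by (simp add: power2_eq_square algebra_simps)
    then show ?thesis unfolding k1_def k2_def k1'_def k2'_def a_def[symmetric] b_def[symmetric] .
  qed
  then have "k2' * k1 \<eta> - k2 \<eta> * k1' = 2 * (a\<^sup>2 + b\<^sup>2) + (a * b' - b * a')" by simp
  moreover have "2 * (a\<^sup>2 + b\<^sup>2) + (a * b' - b * a') < 0"
  proof -
    define e where "e = \<eta>\<^sup>2"
    have e: "0 \<le> e" "e \<le> 1" using assms abs_square_le_1[of \<eta>] by (auto simp: e_def)
    have b2: "b\<^sup>2 = 9 / 4 * (1 - e)\<^sup>2 * e"
    proof -
      have "b\<^sup>2 = (3 / 2)\<^sup>2 * (1 - e)\<^sup>2 * \<eta>\<^sup>2" unfolding b_def axis_im_def e_def by (simp only: power_mult_distrib)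
      moreover have "(3 / 2)\<^sup>2 = (9 / 4 :: real)" by (simp add: power2_eq_square)
      ultimately show ?thesis by (simp only: e_def)
    qed
    have ab: "a = 3 / 2 * e - 1 / 2" "b' = 3 / 2 - 9 / 2 * e" "b * a' = 9 / 2 * (1 - e) * e"
      by (simp_all add: a_def b_def a'_def b'_def axis_re_def axis_im_def e_def power2_eq_square algebra_simps)
    have "2 * (a\<^sup>2 + b\<^sup>2) + (a * b' - b * a') = - (3 / 2 * e - 1 / 2)\<^sup>2 - 9 / 2 * (e\<^sup>2 * (1 - e))"
      unfolding b2 ab(3) unfolding ab(1,2) by (simp add: power2_eq_square field_simps)
    moreover have "(3 / 2 * e - 1 / 2)\<^sup>2 + 9 / 2 * (e\<^sup>2 * (1 - e)) > 0"
    proof (cases "e = 1 / 3")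
      case False
      then have "(3 / 2 * e - 1 / 2)\<^sup>2 > 0" by simp
      then show ?thesis using e by (intro add_pos_nonneg) auto
    next
      case True
      show ?thesis unfolding True by (simp add: power2_eq_square)
    qed
    ultimately show ?thesis by linarith
  qed
  ultimately show ?thesis using nz
    by (intro exI[of _ "(k2' * k1 \<eta> - k2 \<eta> * k1') / (k1 \<eta> * k1 \<eta>)"])
      (auto simp: divide_less_0_iff zero_less_mult_iff linorder_neq_iff)
qed

lemma half_angle_tan_axis_inj:
  assumes "\<bar>\<eta>\<bar> \<le> 1" "\<bar>\<eta>'\<bar> \<le> 1" "half_angle_tan (Complex 0 \<eta>) = half_angle_tan (Complex 0 \<eta>')"
  shows "\<eta> = \<eta>'"
proof -
  have "half_angle_tan (Complex 0 v) < half_angle_tan (Complex 0 u)" if "u < v" "\<bar>u\<bar> \<le> 1" "\<bar>v\<bar> \<le> 1" for u v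
  proof (rule DERIV_neg_imp_decreasing[OF that(1)])
    fix x assume "u \<le> x" "x \<le> v"
    then have "\<bar>x\<bar> \<le> 1" using that by linarith
    then show "\<exists>y. ((\<lambda>\<eta>. half_angle_tan (Complex 0 \<eta>)) has_real_derivative y) (at x) \<and> y < 0"
      using half_angle_tan_axis_derivative by blast
  qed
  then show ?thesis using assms by (metis less_irrefl linorder_neqE_linordered_idom)
qed

lemma line_of_cis_mult: "line_of (cis t * d) = cis (2 * t) * line_of d"
proof (cases "d = 0")
  case False
  have "cis (2 * t) * line_of d * cnj (cis t * d) = cis (2 * t) * cis (- t) * (line_of d * cnj d)"
    by (simp add: cis_cnj)
  also have "\<dots> = cis t * d" by (simp add: line_of_mult_cnj cis_mult)
  finally show ?thesis using False by (intro line_of_unique) auto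
qed (simp add: line_of_def)

lemma torus_map_first_coordinate:
  assumes "(\<omega>, \<zeta>) \<in> blowup_disc" "Re (twisted_fun \<zeta>) \<noteq> 0"
  shows "1 + Re (\<omega> * cis (4 * Im \<zeta>)) > 0"
    "Im (\<omega> * cis (4 * Im \<zeta>)) / (1 + Re (\<omega> * cis (4 * Im \<zeta>))) = half_angle_tan \<zeta>"
proof -
  define k where "k = twisted_fun \<zeta>"
  have k: "Re k \<noteq> 0" "k \<noteq> 0" using assms(2) by (auto simp: k_def)
  have C: "blowup_fun \<zeta> \<noteq> 0" using k(2) by (auto simp: k_def twisted_fun_def)
  then have "line_of (blowup_fun \<zeta>) = \<omega>" using assms(1) by (intro line_of_unique) (auto simp: blowup_disc_def)
  moreover have "line_of k = cis (2 * (2 * Im \<zeta>)) * line_of (blowup_fun \<zeta>)"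
    unfolding k_def twisted_fun_def by (rule line_of_cis_mult)
  ultimately have z: "\<omega> * cis (4 * Im \<zeta>) = line_of k" by (simp add: mult.commute)
  have N: "(Re k)\<^sup>2 + (Im k)\<^sup>2 > 0" by (rule sum_squares_Re_Im_pos[OF k(2)])
  note one = one_plus_Re_line_of[OF k(2)]
  show "1 + Re (\<omega> * cis (4 * Im \<zeta>)) > 0" unfolding z one using k N by (simp add: zero_less_divide_iff)
  have "Im (line_of k) / (1 + Re (line_of k)) = Im k / Re k"
    unfolding one Im_line_of using k N by (simp add: power2_eq_square)
  then show "Im (\<omega> * cis (4 * Im \<zeta>)) / (1 + Re (\<omega> * cis (4 * Im \<zeta>))) = half_angle_tan \<zeta>"
    unfolding z by (simp add: half_angle_tan_def k_def)
qed

lemma torus_map_right_inverse: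
  assumes "\<epsilon> \<in> {1, - 1}" "torus_map \<epsilon> (\<omega>, \<zeta>) = (z, w)" "Re \<zeta> \<noteq> 0"
  shows "\<zeta> = Complex (2 * Re w) (\<epsilon> * Im w / (2 * Re w))"
proof -
  have "2 * Re w = Re \<zeta>" "Im w = \<epsilon> * (Re \<zeta> * Im \<zeta>)" using assms(2) by (auto simp: torus_map_def)
  moreover have "\<epsilon> * (\<epsilon> * x) = x" for x using assms(1) by auto
  ultimately show ?thesis using assms(3) by (simp only: complex_eq_iff complex.sel) simp
qed

lemma torus_map_omega: "torus_map \<epsilon> (\<omega>, \<zeta>) = (z, w) \<Longrightarrow> \<omega> = z * cis (- 4 * Im \<zeta>)"
  by (auto simp: torus_map_def mult.assoc cis_mult)

lemma blowup_disc_axis: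
  assumes "(\<omega>, \<zeta>) \<in> blowup_disc" "Re \<zeta> = 0"
  shows "\<zeta> = Complex 0 (Im \<zeta>)" "\<bar>Im \<zeta>\<bar> \<le> 1" "Re (twisted_fun \<zeta>) \<noteq> 0"
proof -
  show z: "\<zeta> = Complex 0 (Im \<zeta>)" using assms(2) by (simp add: complex_eq_iff)
  have "(Im \<zeta>)\<^sup>2 \<le> 1" using assms by (simp add: blowup_disc_def bdist_def)
  then show i: "\<bar>Im \<zeta>\<bar> \<le> 1" by (simp add: abs_square_le_1)
  show "Re (twisted_fun \<zeta>) \<noteq> 0" using twisted_fun_axis_neg[OF i] z by simp
qed

text \<open>Off the core of the solid torus, \<open>\<xi>\<close> and \<open>\<eta>\<close> can be read off from the disc coordinate. Over the core
  \<open>\<xi> = 0\<close>, and \<open>\<eta>\<close> is determined by the first coordinate, along which the angle is monotone.\<close>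

lemma inj_on_torus_map:
  assumes "\<epsilon> \<in> {1, - 1}"
  shows "inj_on (torus_map \<epsilon>) blowup_disc"
proof (rule inj_onI)
  fix p p' assume p: "p \<in> blowup_disc" "p' \<in> blowup_disc" and eq: "torus_map \<epsilon> p = torus_map \<epsilon> p'"
  obtain w z where wz: "p = (w, z)" by (cases p)
  obtain w' z' where wz': "p' = (w', z')" by (cases p')
  obtain a b where ab: "torus_map \<epsilon> (w, z) = (a, b)" by (cases "torus_map \<epsilon> (w, z)")
  have ab': "torus_map \<epsilon> (w', z') = (a, b)" using eq ab by (simp add: wz wz')
  have "Re b = Re z / 2" "Re b = Re z' / 2" using ab ab' by (auto simp: torus_map_def)
  then have Re: "Re z = Re z'" by simp
  have "z = z'"
  proof (cases "Re z = 0")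
    case False
    then show ?thesis using torus_map_right_inverse[OF assms ab] torus_map_right_inverse[OF assms ab'] Re by metis
  next
    case True
    note x = blowup_disc_axis[OF p(1)[unfolded wz] True]
    note x' = blowup_disc_axis[OF p(2)[unfolded wz'] True[unfolded Re]]
    have "w * cis (4 * Im z) = w' * cis (4 * Im z')" using ab ab' by (auto simp: torus_map_def)
    then have "half_angle_tan z = half_angle_tan z'"
      using torus_map_first_coordinate(2)[OF p(1)[unfolded wz] x(3)]
        torus_map_first_coordinate(2)[OF p(2)[unfolded wz'] x'(3)] by simp
    then have "Im z = Im z'" using half_angle_tan_axis_inj[OF x(2) x'(2)] x(1) x'(1) by simp
    then show ?thesis using Re by (simp add: complex_eq_iff)
  qed
  then show "p = p'" using torus_map_omega[OF ab] torus_map_omega[OF ab'] by (simp add: wz wz')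
qed

text \<open>The inverse is continuous by compactness. Off the core it is given by a formula. Near the core the
  first coordinate and \<open>\<xi>\<close> determine \<open>\<eta>\<close> smoothly by the inverse function theorem; continuity of the
  inverse ensures that all points of the image near the core come from the neighbourhood where the
  theorem applies.\<close>

lemma torus_map_diffeomorphism:
  assumes e: "\<epsilon> \<in> {1, - 1}"
  shows "\<exists>g. diffeomorphism blowup_disc (torus_map \<epsilon> ` blowup_disc) (torus_map \<epsilon>) g"
proof -
  define f where "f = torus_map \<epsilon>"
  define P where "P = f ` blowup_disc"
  define g where "g = inv_into blowup_disc f"
  have inj: "inj_on f blowup_disc" unfolding f_def by (rule inj_on_torus_map[OF e])
  have gf: "g (f p) = p" if "p \<in> blowup_disc" for p unfolding g_def using inv_into_f_f[OF inj that] .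
  have smf: "smooth_on blowup_disc f" unfolding f_def by (rule smooth_on_torus_map)
  have cg: "continuous_on P g" unfolding P_def
    by (rule continuous_on_inv[OF smooth_on_continuous[OF smf] compact_blowup_disc]) (simp add: gf)
  have "smooth_on P g"
  proof (rule smooth_on_local)
    fix p assume "p \<in> P"
    then obtain w0 z0 where p: "p = f (w0, z0)" and mem: "(w0, z0) \<in> blowup_disc" by (auto simp: P_def)
    show "\<exists>U k. open U \<and> p \<in> U \<and> smooth_on U k \<and> (\<forall>y\<in>P \<inter> U. k y = g y)"
    proof (cases "Re z0 = 0")
      case False
      define U where "U = {q :: complex \<times> complex. Re (snd q) \<noteq> 0}"
      define \<eta> where "\<eta> q = \<epsilon> * Im (snd q) / (2 * Re (snd q))" for q :: "complex \<times> complex"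
      define k where "k q = (fst q * cis (- 4 * \<eta> q), Complex (2 * Re (snd q)) (\<eta> q))" for q
      have "open U" unfolding U_def by (intro open_Collect_neq continuous_intros)
      moreover have "p \<in> U" using False by (simp add: U_def p f_def torus_map_def)
      moreover have "smooth_on U k" unfolding k_def \<eta>_def by (intro smooth_on_intros) (auto simp: U_def)
      moreover have "k y = g y" if y: "y \<in> P \<inter> U" for y
      proof -
        obtain w z where wz: "y = f (w, z)" "(w, z) \<in> blowup_disc" using y by (auto simp: P_def)
        have fy: "torus_map \<epsilon> (w, z) = (fst y, snd y)" using wz by (simp add: f_def)
        have "Re (snd y) \<noteq> 0" using y by (simp add: U_def)
        then have "Re z \<noteq> 0" using fy by (auto simp: torus_map_def)
        have "z = Complex (2 * Re (snd y)) (\<eta> y)"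
          unfolding \<eta>_def by (rule torus_map_right_inverse[OF e fy \<open>Re z \<noteq> 0\<close>])
        moreover have "w = fst y * cis (- 4 * Im z)" by (rule torus_map_omega[OF fy])
        ultimately have "k y = (w, z)" by (simp add: k_def)
        then show ?thesis using gf wz by simp
      qed
      ultimately show ?thesis by blast
    next
      case True
      note ax = blowup_disc_axis[OF mem True]
      define T where "T q = half_angle_tan (Complex (fst q) (snd q))" for q
      define A where "A = {q :: real \<times> real. Re (twisted_fun (Complex (fst q) (snd q))) \<noteq> 0}"
      have smK: "smooth_on S (\<lambda>q. twisted_fun (Complex (fst q) (snd q)))" for S :: "(real \<times> real) set"
        unfolding twisted_fun_def by (intro smooth_on_intros smooth_on_blowup_fun)
      have oA: "open A" unfolding A_def
        by (intro open_Collect_neq continuous_intros smooth_on_continuous[OF smooth_on_Re[OF smK]])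
      have smT: "smooth_on A T" unfolding T_def half_angle_tan_def
        by (intro smooth_on_intros smK) (auto simp: A_def)
      define p0 where "p0 = (0 :: real, Im z0)"
      have p0: "p0 \<in> A" using ax by (simp add: p0_def A_def)
      have dT: "(T has_derivative frechet_derivative T (at p0)) (at p0)"
        by (rule smooth_on_imp_has_derivative[OF oA smT p0])
      obtain D where D: "D < 0" "((\<lambda>\<eta>. half_angle_tan (Complex 0 \<eta>)) has_real_derivative D) (at (Im z0))"
        using half_angle_tan_axis_derivative[OF ax(2)] by blast
      have "((\<lambda>t :: real. (0 :: real, t)) has_derivative (\<lambda>t. (0, t))) (at (Im z0))"
        by (auto intro!: derivative_eq_intros)
      then have "(T \<circ> (\<lambda>t. (0, t)) has_derivative frechet_derivative T (at p0) \<circ> (\<lambda>t. (0, t))) (at (Im z0))"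
        using dT unfolding p0_def by (rule diff_chain_at)
      moreover have "(T \<circ> (\<lambda>t. (0, t)) has_derivative (\<lambda>t. D * t)) (at (Im z0))"
        using D(2) by (simp add: has_field_derivative_def o_def T_def)
      ultimately have "frechet_derivative T (at p0) \<circ> (\<lambda>t. (0, t)) = (\<lambda>t. D * t)" by (rule has_derivative_unique)
      from fun_cong[OF this, of 1] have "frechet_derivative T (at p0) (0, 1) \<noteq> 0" using D(1) by simp
      from smooth_on_implicit_coordinate[OF oA smT p0 this] obtain N V h where
        N: "open N" "p0 \<in> N" "N \<subseteq> A" and V: "open V" "smooth_on V h"
        and h: "\<And>q. q \<in> N \<Longrightarrow> (fst q, T q) \<in> V \<and> h (fst q, T q) = snd q" by metis
      define B where "B = (\<lambda>q :: complex \<times> complex. (Re (snd q), Im (snd q))) -` N"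
      have "open B" unfolding B_def by (intro open_vimage N(1) continuous_intros)
      then obtain O1 where O1: "open O1" "O1 \<inter> P = g -` B \<inter> P"
        using cg unfolding continuous_on_open_invariant by meson
      \<comment> \<open>The pair \<open>(\<xi>, T)\<close>, computed from a point of the solid torus.\<close>
      define c where "c q = (2 * Re (snd q), Im (fst q) / (1 + Re (fst q)))" for q :: "complex \<times> complex"
      define U0 where "U0 = {q :: complex \<times> complex. 1 + Re (fst q) > 0}"
      define U1 where "U1 = U0 \<inter> c -` V"
      have smc: "smooth_on U0 c" unfolding c_def by (intro smooth_on_intros) (auto simp: U0_def)
      have "open U0" unfolding U0_def by (intro open_Collect_less continuous_intros)
      then have "open U1" unfolding U1_def
        using continuous_open_preimage[OF smooth_on_continuous[OF smc]] V(1) by blast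
      define k where "k q = (fst q * cis (- 4 * h (c q)), Complex (2 * Re (snd q)) (h (c q)))" for q
      have smh: "smooth_on U1 (\<lambda>q. h (c q))"
        by (rule smooth_on_compose[OF V(2) smooth_on_subset[OF smc]]) (auto simp: U1_def)
      have "smooth_on (U1 \<inter> O1) k" unfolding k_def
        by (intro smooth_on_intros smooth_on_subset[OF smh]) auto
      moreover have key: "f (w, z) \<in> U1 \<and> k (f (w, z)) = (w, z)"
        if wz: "(w, z) \<in> blowup_disc" "(Re z, Im z) \<in> N" for w z
      proof -
        have "Re (twisted_fun z) \<noteq> 0" using wz(2) N(3) by (auto simp: A_def)
        note fc = torus_map_first_coordinate[OF wz(1) this]
        have "c (f (w, z)) = (Re z, T (Re z, Im z))"
          using fc(2) by (simp add: c_def f_def torus_map_def T_def)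
        then have "c (f (w, z)) \<in> V" "h (c (f (w, z))) = Im z" using h[OF wz(2)] by simp_all
        then show ?thesis
          using fc(1) by (simp add: U1_def U0_def k_def f_def torus_map_def mult.assoc cis_mult complex_eq_iff)
      qed
      have z0: "(Re z0, Im z0) \<in> N" using N(2) True by (simp add: p0_def)
      have "p \<in> U1 \<inter> O1"
      proof
        show "p \<in> U1" using key[OF mem z0] by (simp add: p)
        have "g p \<in> B" using gf[OF mem] z0 by (simp add: p B_def)
        then show "p \<in> O1" using O1(2) \<open>p \<in> P\<close> by blast
      qed
      moreover have "k y = g y" if y: "y \<in> P \<inter> (U1 \<inter> O1)" for y
      proof -
        obtain w z where wz: "y = f (w, z)" "(w, z) \<in> blowup_disc" using y by (auto simp: P_def)
        have "g y \<in> B" using y O1(2) by blast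
        then have "(Re z, Im z) \<in> N" using gf[OF wz(2)] wz(1) by (simp add: B_def)
        then show ?thesis using key[OF wz(2)] gf[OF wz(2)] wz(1) by simp
      qed
      ultimately show ?thesis using \<open>open U1\<close> O1(1) by (intro exI[of _ "U1 \<inter> O1"] exI[of _ k]) auto
    qed
  qed
  then have "diffeomorphism blowup_disc P f g"
    using smf gf by (auto simp: diffeomorphism_def P_def image_image)
  then show ?thesis unfolding P_def f_def by blast
qed

section \<open>Homeomorphisms and contractions by explicit formulas\<close>

lemma continuous_on_open_cover2:
  fixes f g k :: "'a::t2_space \<Rightarrow> 'b::topological_space"
  assumes "open A" "open B" "S \<subseteq> A \<union> B"
    and "continuous_on (S \<inter> A) f" "\<And>x. x \<in> S \<inter> A \<Longrightarrow> k x = f x"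
    and "continuous_on (S \<inter> B) g" "\<And>x. x \<in> S \<inter> B \<Longrightarrow> k x = g x"
  shows "continuous_on S k"
proof -
  have "continuous_on (S \<inter> A) k" "continuous_on (S \<inter> B) k"
    using continuous_on_eq[OF assms(4), of k] continuous_on_eq[OF assms(6), of k] assms(5,7) by simp_all
  note on = this
  show ?thesis unfolding continuous_on_eq_continuous_within
  proof (intro ballI)
    fix x assume x: "x \<in> S"
    have at: "at x within (S \<inter> U) = at x within S" if "open U" "x \<in> U" for U
      by (rule at_within_nhd[OF that(2,1)]) auto
    show "continuous (at x within S) k"
      using assms(1-3) x on at
      unfolding continuous_on_eq_continuous_within by (metis IntI UnE subsetD)
  qed
qed

lemma homeomorphism_by_local_inverses:
  fixes f :: "'a::topological_space \<Rightarrow> 'b::t2_space"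
  assumes f: "continuous_on D f" "f ` D = S" and AB: "open A" "open B" "S \<subseteq> A \<union> B"
    and c: "continuous_on (S \<inter> A) k1" "continuous_on (S \<inter> B) k2"
    and k1: "\<And>x. x \<in> D \<Longrightarrow> f x \<in> A \<Longrightarrow> k1 (f x) = x" and k2: "\<And>x. x \<in> D \<Longrightarrow> f x \<in> B \<Longrightarrow> k2 (f x) = x"
  shows "\<exists>k. homeomorphism D S f k"
proof -
  define k where "k p = (if p \<in> A then k1 p else k2 p)" for p
  have kf: "k (f x) = x" if "x \<in> D" for x
  proof (cases "f x \<in> A")
    case True
    then show ?thesis using k1 that by (simp add: k_def)
  next
    case False
    then have "f x \<in> B" using AB(3) f(2) that by blast
    then show ?thesis using k2 that False by (simp add: k_def)
  qed
  have "continuous_on S k"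
  proof (rule continuous_on_open_cover2[OF AB c(1) _ c(2)])
    show "k p = k1 p" if "p \<in> S \<inter> A" for p using that by (simp add: k_def)
    show "k p = k2 p" if p: "p \<in> S \<inter> B" for p
    proof -
      obtain x where "x \<in> D" "p = f x" using p f(2) by blast
      then show ?thesis using kf k2 p by auto
    qed
  qed
  moreover have "k ` S = D" unfolding f(2)[symmetric] image_image using kf by simp
  moreover have "f (k p) = p" if "p \<in> S" for p using that kf unfolding f(2)[symmetric] by auto
  ultimately have "homeomorphism D S f k" using f kf by (simp add: homeomorphism_def)
  then show ?thesis by blast
qed

text \<open>A linear homotopy from the identity to \<open>r\<close>, followed by a linear homotopy from \<open>r\<close> to a constant.\<close>

lemma contractible_via_linear_homotopies:
  fixes S :: "'a::real_normed_vector set"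
  assumes "continuous_on S r" "\<And>x. x \<in> S \<Longrightarrow> closed_segment x (r x) \<subseteq> S"
    and "\<And>x. x \<in> S \<Longrightarrow> closed_segment (r x) a \<subseteq> S"
  shows "contractible S"
proof -
  have "homotopic_with_canon (\<lambda>x. True) S S id r"
    by (rule homotopic_with_linear) (use assms in \<open>auto intro: continuous_on_id\<close>)
  moreover have "homotopic_with_canon (\<lambda>x. True) S S r (\<lambda>x. a)"
    by (rule homotopic_with_linear) (use assms in auto)
  ultimately show ?thesis unfolding contractible_def using homotopic_with_trans by blast
qed

section \<open>The two bands\<close>

text \<open>The largest domain on which \<open>strip_chart\<close> takes values over the right half of the closed disc. The
  second inequality is \<open>bdist \<zeta> \<ge> 0\<close>.\<close>

definition band_domain :: "(real \<times> real) set" where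
  "band_domain = {(\<eta>, n). 0 < 1 / 3 + n * \<eta> \<and> 0 \<le> 2 / 3 - n * \<eta> - \<eta>\<^sup>2}"

definition band_map :: "real \<times> real \<Rightarrow> complex \<times> complex" where
  "band_map = (\<lambda>(\<eta>, n). strip_chart \<eta> n)"

text \<open>The right half of the blown-up disc, without the points of the horizontal diameter that lie on the
  line \<open>\<omega> = 1\<close>, where the parameter \<open>n\<close> of \<open>strip_chart\<close> becomes infinite.\<close>

definition right_band :: "(complex \<times> complex) set" where
  "right_band = {(\<omega>, \<zeta>) \<in> blowup_disc. Re \<zeta> > 0 \<and> (\<omega> \<noteq> 1 \<or> Im \<zeta> \<noteq> 0)}"

text \<open>For fixed \<open>n\<close>, both \<open>1 / 3 + n \<eta>\<close> and \<open>2 / 3 - n \<eta> - \<eta>\<^sup>2\<close> are positive at \<open>\<eta> = 0\<close> and concave in \<open>\<eta>\<close>.\<close>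

lemma band_domain_segment:
  assumes "(\<eta>, n) \<in> band_domain" "0 \<le> s" "s \<le> 1"
  shows "(s * \<eta>, n) \<in> band_domain"
proof -
  have h: "0 < 1 / 3 + n * \<eta>" "n * \<eta> + \<eta>\<^sup>2 \<le> 2 / 3" using assms(1) by (auto simp: band_domain_def)
  have "0 < 1 / 3 + n * (s * \<eta>)"
  proof (cases "n * \<eta> \<ge> 0")
    case True
    then have "0 \<le> s * (n * \<eta>)" using assms(2) by simp
    then show ?thesis by (simp add: mult.left_commute)
  next
    case False
    then have "n * \<eta> \<le> s * (n * \<eta>)" using assms(2,3) by (simp add: mult_le_cancel_right1)
    then have "n * \<eta> \<le> n * (s * \<eta>)" by (simp add: mult.left_commute)
    then show ?thesis using h by linarith
  qed
  moreover have "n * (s * \<eta>) + (s * \<eta>)\<^sup>2 \<le> 2 / 3"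
  proof -
    have "s\<^sup>2 \<le> s" using assms(2,3) by (simp add: power2_eq_square mult_left_le)
    then have "s\<^sup>2 * \<eta>\<^sup>2 \<le> s * \<eta>\<^sup>2" by (rule mult_right_mono) simp
    then have "n * (s * \<eta>) + (s * \<eta>)\<^sup>2 \<le> s * (n * \<eta> + \<eta>\<^sup>2)"
      by (simp add: power_mult_distrib distrib_left mult.left_commute)
    also have "\<dots> \<le> s * (2 / 3)" using h(2) assms(2) by (rule mult_left_mono)
    also have "\<dots> \<le> 2 / 3" using assms(3) by simp
    finally show ?thesis .
  qed
  ultimately show ?thesis by (simp add: band_domain_def)
qed

text \<open>The segments to the line \<open>\<eta> = 0\<close> keep \<open>n\<close> fixed, so restricting \<open>n\<close> to an interval \<open>J\<close> does no harm.
  This covers the whole band as well as its two halves.\<close>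

lemma contractible_band_part:
  assumes J: "convex J" "n0 \<in> J"
  shows "contractible {p \<in> band_domain. snd p \<in> J}"
proof (rule contractible_via_linear_homotopies)
  let ?S = "{p \<in> band_domain. snd p \<in> J}"
  show "continuous_on ?S (\<lambda>p. (0, snd p))" by (intro continuous_intros)
  show "closed_segment x (0, snd x) \<subseteq> ?S" if "x \<in> ?S" for x
  proof
    fix y assume "y \<in> closed_segment x (0, snd x)"
    then obtain u where u: "0 \<le> u" "u \<le> 1" "y = (1 - u) *\<^sub>R x + u *\<^sub>R (0, snd x)" by (auto simp: closed_segment_def)
    then have "y = ((1 - u) * fst x, snd x)" by (cases x) (simp add: algebra_simps)
    then show "y \<in> ?S" using that band_domain_segment[of "fst x" "snd x" "1 - u"] u(1,2) by simp
  qed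
  show "closed_segment (0, snd x) (0, n0) \<subseteq> ?S" if "x \<in> ?S" for x
  proof
    fix y assume "y \<in> closed_segment (0, snd x) (0 :: real, n0)"
    then obtain u where u: "0 \<le> u" "u \<le> 1" "y = (0, (1 - u) * snd x + u * n0)" by (auto simp: closed_segment_def)
    then have "(1 - u) *\<^sub>R snd x + u *\<^sub>R n0 \<in> J" using J that by (intro convexD) auto
    then show "y \<in> ?S" using u(3) by (simp add: band_domain_def)
  qed
qed

lemma band_map_mem:
  assumes "(\<eta>, n) \<in> band_domain"
  shows "strip_chart \<eta> n \<in> right_band" "Im (snd (strip_chart \<eta> n)) = \<eta>" "(Re (snd (strip_chart \<eta> n)))\<^sup>2 = 1 / 3 + n * \<eta>"
proof -
  have h: "0 < 1 / 3 + n * \<eta>" "bdist (strip_point \<eta> n) \<ge> 0" using assms bdist_strip_point[of n \<eta>] by (auto simp: band_domain_def)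
  have s: "snd (strip_chart \<eta> n) = strip_point \<eta> n" by (simp add: strip_chart_def)
  show im: "Im (snd (strip_chart \<eta> n)) = \<eta>" "(Re (snd (strip_chart \<eta> n)))\<^sup>2 = 1 / 3 + n * \<eta>"
    using h(1) by (simp_all add: s strip_point_def)
  have "fst (strip_chart \<eta> n) \<noteq> 1" if "\<eta> = 0"
  proof -
    have "bdist (strip_point \<eta> n) > 0" using that by (simp add: strip_point_def bdist_def)
    then have "1 - Re (fst (strip_chart \<eta> n)) > 0" using strip_chart_omega(1)[of n \<eta>] h by simp
    then show ?thesis by auto
  qed
  moreover have "strip_chart \<eta> n \<in> blowup_disc" using strip_chart_mem h by simp
  moreover have "Re (snd (strip_chart \<eta> n)) > 0" using h by (simp add: s strip_point_def)
  ultimately show "strip_chart \<eta> n \<in> right_band" using im(1) unfolding right_band_def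
    by (cases "strip_chart \<eta> n") auto
qed

lemma band_map_onto:
  assumes "(\<omega>, \<zeta>) \<in> right_band"
  obtains n where "(Im \<zeta>, n) \<in> band_domain" "strip_chart (Im \<zeta>) n = (\<omega>, \<zeta>)"
proof -
  have mem: "(\<omega>, \<zeta>) \<in> blowup_disc" and r: "Re \<zeta> > 0" "\<omega> \<noteq> 1 \<or> Im \<zeta> \<noteq> 0" using assms by (auto simp: right_band_def)
  note rel = blowup_disc_relations[OF mem]
  have dom: "(Im \<zeta>, n) \<in> band_domain" if n: "1 / 3 + n * Im \<zeta> = (Re \<zeta>)\<^sup>2" for n
  proof -
    have "2 / 3 - n * Im \<zeta> - (Im \<zeta>)\<^sup>2 = bdist \<zeta>" using n unfolding bdist_def by linarith
    then show ?thesis using n r(1) rel(4) by (simp add: band_domain_def)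
  qed
  show thesis
  proof (cases "\<omega> = 1")
    case False
    note inv = strip_chart_inverse[OF mem False r(1)]
    show thesis by (rule that[OF dom[OF inv(2)] inv(1)])
  next
    case True
    then have Im: "Im \<zeta> \<noteq> 0" using r by auto
    then have q: "bdist \<zeta> = 0" using rel(1) True by simp
    define n where "n = ((Re \<zeta>)\<^sup>2 - 1 / 3) / Im \<zeta>"
    have n: "1 / 3 + n * Im \<zeta> = (Re \<zeta>)\<^sup>2" using Im by (simp add: n_def)
    have sp: "strip_point (Im \<zeta>) n = \<zeta>" unfolding strip_point_def n using r(1) by (simp add: complex_eq_iff)
    have "1 / 3 + n * Im \<zeta> \<ge> 0" using n by simp
    then have nz: "Complex (n + Im \<zeta>) 0 \<noteq> 0" using strip_chart_direction_nonzero[of n "Im \<zeta>"] by (simp add: sp q)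
    have "line_of (Complex (n + Im \<zeta>) 0) = 1" by (rule line_of_unique[OF nz]) (simp add: complex_eq_iff)
    then have "strip_chart (Im \<zeta>) n = (\<omega>, \<zeta>)" by (simp add: strip_chart_def sp q True)
    then show thesis by (rule that[OF dom[OF n]])
  qed
qed

lemma continuous_on_band_map: "continuous_on band_domain band_map"
proof -
  have "continuous_on band_domain (\<lambda>p. strip_chart (fst p) (snd p))"
    unfolding strip_chart_def strip_point_def
  proof (intro smooth_on_continuous smooth_on_intros smooth_on_line_of smooth_on_bdist)
    fix p assume "p \<in> band_domain"
    then have pos: "0 < 1 / 3 + snd p * fst p" by (auto simp: band_domain_def)
    then show "0 < 1 / 3 + snd p * fst p" "0 < 1 / 3 + snd p * fst p" by simp_all
    from strip_chart_direction_nonzero[OF less_imp_le[OF pos], unfolded strip_point_def]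
    show "Complex (snd p + fst p) (bdist (Complex (sqrt (1 / 3 + snd p * fst p)) (fst p))) \<noteq> 0" .
  qed
  then show ?thesis by (simp add: band_map_def case_prod_unfold)
qed

text \<open>Two formulas recover \<open>n\<close>: the equation \<open>\<xi>\<^sup>2 = 1 / 3 + n \<eta>\<close> where \<open>\<eta> \<noteq> 0\<close>, and the direction \<open>\<omega>\<close> where
  \<open>\<omega> \<noteq> 1\<close>.\<close>

lemma band_map_homeomorphism: "\<exists>k. homeomorphism band_domain right_band band_map k"
proof -
  have im: "band_map ` band_domain = right_band"
  proof
    show "band_map ` band_domain \<subseteq> right_band" using band_map_mem(1) by (auto simp: band_map_def)
    show "right_band \<subseteq> band_map ` band_domain"
    proof
      fix p assume p: "p \<in> right_band"
      obtain w z where "p = (w, z)" by (cases p)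
      then obtain n where "(Im z, n) \<in> band_domain" "strip_chart (Im z) n = p" using band_map_onto p by metis
      then show "p \<in> band_map ` band_domain" unfolding band_map_def by force
    qed
  qed
  define k1 where "k1 p = (Im (snd p), ((Re (snd p))\<^sup>2 - 1 / 3) / Im (snd p))" for p :: "complex \<times> complex"
  define k2 where "k2 p = (Im (snd p), bdist (snd p) * Im (fst p) / (1 - Re (fst p)) - Im (snd p))" for p :: "complex \<times> complex"
  define A where "A = {p :: complex \<times> complex. Im (snd p) \<noteq> 0}"
  define B where "B = {p :: complex \<times> complex. 1 - Re (fst p) > 0}"
  have k1: "k1 (band_map x) = x" if "x \<in> band_domain" "band_map x \<in> A" for x
  proof -
    obtain \<eta> n where x: "x = (\<eta>, n)" by (cases x)
    show ?thesis using band_map_mem[of \<eta> n] that by (simp add: x band_map_def k1_def A_def)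
  qed
  have k2: "k2 (band_map x) = x" if x: "x \<in> band_domain" "band_map x \<in> B" for x
  proof -
    obtain \<eta> n where xe: "x = (\<eta>, n)" by (cases x)
    have dom: "0 < 1 / 3 + n * \<eta>" using x(1) by (auto simp: xe band_domain_def)
    have s: "snd (strip_chart \<eta> n) = strip_point \<eta> n" by (simp add: strip_chart_def)
    have "(\<eta>, n) \<in> band_domain" using x(1) by (simp add: xe)
    then have "strip_chart \<eta> n \<in> right_band" by (rule band_map_mem(1))
    then have "strip_chart \<eta> n \<in> blowup_disc" by (auto simp: right_band_def)
    then have mem: "(fst (strip_chart \<eta> n), strip_point \<eta> n) \<in> blowup_disc" using s by (metis prod.collapse)
    have "fst (strip_chart \<eta> n) \<noteq> 1" using x(2) by (auto simp: xe band_map_def B_def)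
    then have "bdist (strip_point \<eta> n) > 0"
      using blowup_disc_relations(4,5)[OF mem] by fastforce
    then show ?thesis
      using strip_chart_omega(2)[of n \<eta>] dom band_map_mem(2)[of \<eta> n] x(1)
      by (simp add: xe k2_def band_map_def s)
  qed
  have cov: "right_band \<subseteq> A \<union> B"
  proof
    fix p assume p: "p \<in> right_band"
    obtain w z where wz: "p = (w, z)" by (cases p)
    have mem: "(w, z) \<in> blowup_disc" using p by (auto simp: wz right_band_def)
    have "Re w < 1" if "w \<noteq> 1"
      using Re_less_1_of_unit[OF blowup_disc_relations(3)[OF mem] that] .
    then show "p \<in> A \<union> B" using p by (auto simp: wz right_band_def A_def B_def)
  qed
  show ?thesis
  proof (rule homeomorphism_by_local_inverses[OF continuous_on_band_map im _ _ cov _ _ k1 k2])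
    show "open A" "open B" unfolding A_def B_def
      by (intro open_Collect_neq open_Collect_less continuous_intros)+
    show "continuous_on (right_band \<inter> A) k1" unfolding k1_def
      by (intro continuous_intros) (auto simp: A_def)
    show "continuous_on (right_band \<inter> B) k2" unfolding k2_def bdist_def
      by (intro continuous_intros) (auto simp: B_def)
  qed
qed

section \<open>Cutting the bands\<close>

text \<open>The arc across the right band along which the blown-up disc is cut.\<close>

definition right_cocore :: "(complex \<times> complex) set" where
  "right_cocore = band_map ` {p \<in> band_domain. snd p = 0}"

lemma right_cocore_iff:
  "(\<omega>, \<zeta>) \<in> right_cocore \<longleftrightarrow>
     (\<omega>, \<zeta>) \<in> blowup_disc \<and> Re \<zeta> > 0 \<and> (Re \<zeta>)\<^sup>2 = 1 / 3 \<and> \<omega> = line_of (Complex (Im \<zeta>) (bdist \<zeta>))"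
proof
  assume "(\<omega>, \<zeta>) \<in> right_cocore"
  then obtain \<eta> where e: "(\<eta>, 0) \<in> band_domain" "(\<omega>, \<zeta>) = strip_chart \<eta> 0" by (auto simp: right_cocore_def band_map_def)
  have "(\<omega>, \<zeta>) \<in> right_band" "Im \<zeta> = \<eta>" "(Re \<zeta>)\<^sup>2 = 1 / 3" using band_map_mem[OF e(1)] unfolding e(2)[symmetric] by simp_all
  moreover have "\<zeta> = strip_point \<eta> 0" "\<omega> = line_of (Complex \<eta> (bdist (strip_point \<eta> 0)))" using e(2) by (auto simp: strip_chart_def)
  ultimately show "(\<omega>, \<zeta>) \<in> blowup_disc \<and> Re \<zeta> > 0 \<and> (Re \<zeta>)\<^sup>2 = 1 / 3 \<and> \<omega> = line_of (Complex (Im \<zeta>) (bdist \<zeta>))"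
    by (auto simp: right_band_def)
next
  assume r: "(\<omega>, \<zeta>) \<in> blowup_disc \<and> Re \<zeta> > 0 \<and> (Re \<zeta>)\<^sup>2 = 1 / 3 \<and> \<omega> = line_of (Complex (Im \<zeta>) (bdist \<zeta>))"
  have sp: "strip_point (Im \<zeta>) 0 = \<zeta>"
    using r real_sqrt_unique[of "Re \<zeta>" "1 / 3"] by (simp add: strip_point_def complex_eq_iff)
  have "(Im \<zeta>)\<^sup>2 \<le> 2 / 3" using r by (auto simp: blowup_disc_def bdist_def)
  then have "(Im \<zeta>, 0) \<in> band_domain" by (simp add: band_domain_def)
  moreover have "strip_chart (Im \<zeta>) 0 = (\<omega>, \<zeta>)" using r by (simp add: strip_chart_def sp)
  ultimately show "(\<omega>, \<zeta>) \<in> right_cocore" unfolding right_cocore_def band_map_def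
    by (intro image_eqI[of _ _ "(Im \<zeta>, 0)"]) auto
qed

lemma compact_right_cocore: "compact right_cocore"
  unfolding right_cocore_def
proof (rule compact_continuous_image)
  have eq: "{p \<in> band_domain. snd p = 0} = (\<lambda>\<eta>. (\<eta>, 0)) ` {- sqrt (2 / 3)..sqrt (2 / 3)}"
  proof -
    have "\<eta>\<^sup>2 \<le> 2 / 3 \<longleftrightarrow> \<eta> \<in> {- sqrt (2 / 3)..sqrt (2 / 3)}" for \<eta> :: real
      using real_sqrt_le_iff[of "\<eta>\<^sup>2" "2 / 3"] by (simp add: real_sqrt_abs abs_le_iff) linarith
    then show ?thesis by (auto simp: band_domain_def)
  qed
  show "compact {p \<in> band_domain. snd p = 0}" unfolding eq
    by (intro compact_continuous_image continuous_intros) simp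
  show "continuous_on {p \<in> band_domain. snd p = 0} band_map"
    using continuous_on_subset[OF continuous_on_band_map] by auto
qed

definition body :: "(complex \<times> complex) set" where
  "body = blowup_disc - right_cocore - mirror ` right_cocore"

text \<open>The domain of \<open>slope_chart\<close> with values over the closed disc, for all \<open>\<xi>\<close> and without a bound on \<open>m\<close>.\<close>

definition body_domain :: "(real \<times> real) set" where
  "body_domain = {(m, \<xi>). bdist (slope_point m \<xi>) \<ge> 0}"

definition body_map :: "real \<times> real \<Rightarrow> complex \<times> complex" where
  "body_map = (\<lambda>(m, \<xi>). slope_chart m \<xi>)"

lemma mirror_cocore_iff:
  "(\<omega>, \<zeta>) \<in> mirror ` right_cocore \<longleftrightarrow>
     (\<omega>, \<zeta>) \<in> blowup_disc \<and> Re \<zeta> < 0 \<and> (Re \<zeta>)\<^sup>2 = 1 / 3 \<and> \<omega> = line_of (Complex (Im \<zeta>) (bdist \<zeta>))"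
proof -
  have "(\<omega>, \<zeta>) \<in> mirror ` right_cocore \<longleftrightarrow> mirror (\<omega>, \<zeta>) \<in> right_cocore"
    by (metis (no_types, lifting) image_iff mirror_mirror)
  also have "\<dots> \<longleftrightarrow> (\<omega>, \<zeta>) \<in> blowup_disc \<and> Re \<zeta> < 0 \<and> (Re \<zeta>)\<^sup>2 = 1 / 3 \<and> \<omega> = line_of (Complex (Im \<zeta>) (bdist \<zeta>))"
    using mirror_mem[of "(\<omega>, \<zeta>)"] mirror_mem[of "mirror (\<omega>, \<zeta>)"]
    by (auto simp: mirror_def right_cocore_iff bdist_def)
  finally show ?thesis .
qed

lemma body_iff:
  "(\<omega>, \<zeta>) \<in> body \<longleftrightarrow> (\<omega>, \<zeta>) \<in> blowup_disc \<and> \<not> ((Re \<zeta>)\<^sup>2 = 1 / 3 \<and> \<omega> = line_of (Complex (Im \<zeta>) (bdist \<zeta>)))"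
  unfolding body_def Diff_iff right_cocore_iff mirror_cocore_iff by (auto simp: linorder_neq_iff)

text \<open>Letting \<open>m\<close> tend to \<open>0\<close> retracts the domain onto the horizontal diameter.\<close>

lemma contractible_body_domain: "contractible body_domain"
proof (rule contractible_via_linear_homotopies)
  show "continuous_on body_domain (\<lambda>p. (0, snd p))" by (intro continuous_intros)
  have bd: "(m, \<xi>) \<in> body_domain \<longleftrightarrow> \<xi>\<^sup>2 + (m * (\<xi>\<^sup>2 - 1 / 3))\<^sup>2 \<le> 1" for m \<xi>
    by (auto simp: body_domain_def bdist_def slope_point_def)
  show "closed_segment x (0, snd x) \<subseteq> body_domain" if "x \<in> body_domain" for x
  proof
    fix y assume "y \<in> closed_segment x (0, snd x)"
    then obtain u where u: "0 \<le> u" "u \<le> 1" "y = (1 - u) *\<^sub>R x + u *\<^sub>R (0, snd x)" by (auto simp: closed_segment_def)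
    then have y: "y = ((1 - u) * fst x, snd x)" by (cases x) (simp add: algebra_simps)
    define e where "e = fst x * ((snd x)\<^sup>2 - 1 / 3)"
    have "(1 - u)\<^sup>2 \<le> 1" using u by (simp add: power_le_one)
    then have "(1 - u)\<^sup>2 * e\<^sup>2 \<le> 1 * e\<^sup>2" by (rule mult_right_mono) simp
    then have "((1 - u) * e)\<^sup>2 \<le> e\<^sup>2" by (simp add: power_mult_distrib)
    moreover have "(snd x)\<^sup>2 + e\<^sup>2 \<le> 1" using that bd[of "fst x" "snd x"] by (simp add: e_def)
    ultimately have "(snd x)\<^sup>2 + ((1 - u) * e)\<^sup>2 \<le> 1" by linarith
    then show "y \<in> body_domain" unfolding y bd by (simp add: e_def mult.assoc)
  qed
  show "closed_segment (0, snd x) (0, 0) \<subseteq> body_domain" if "x \<in> body_domain" for x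
  proof
    fix y assume "y \<in> closed_segment (0, snd x) (0 :: real, 0 :: real)"
    then obtain u where u: "0 \<le> u" "u \<le> 1" "y = (0, (1 - u) * snd x)" by (auto simp: closed_segment_def)
    have "(snd x)\<^sup>2 + (fst x * ((snd x)\<^sup>2 - 1 / 3))\<^sup>2 \<le> 1" using that bd[of "fst x" "snd x"] by simp
    then have "(snd x)\<^sup>2 \<le> 1" using zero_le_power2[of "fst x * ((snd x)\<^sup>2 - 1 / 3)"] by linarith
    moreover have "(1 - u)\<^sup>2 \<le> 1" using u by (simp add: power_le_one)
    ultimately have "(1 - u)\<^sup>2 * (snd x)\<^sup>2 \<le> 1 * 1" by (intro mult_mono) auto
    then show "y \<in> body_domain" unfolding u(3) bd by (simp add: power_mult_distrib)
  qed
qed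

lemma body_map_mem:
  assumes "(m, \<xi>) \<in> body_domain"
  shows "slope_chart m \<xi> \<in> body"
proof -
  have q: "bdist (slope_point m \<xi>) \<ge> 0" using assms by (simp add: body_domain_def)
  have "fst (slope_chart m \<xi>) \<noteq> line_of (Complex (Im (slope_point m \<xi>)) (bdist (slope_point m \<xi>)))" if "\<xi>\<^sup>2 = 1 / 3"
  proof -
    have sp: "Im (slope_point m \<xi>) = 0" "bdist (slope_point m \<xi>) = 2 / 3" using that by (auto simp: slope_point_def bdist_def)
    have "line_of (Complex 0 (2 / 3)) = - 1" by (rule line_of_unique) (auto simp: complex_eq_iff)
    moreover have "Re (line_of (Complex 1 (2 / 3 * m))) > - 1"
    proof -
      have "Re (line_of (Complex 1 (2 / 3 * m))) = (1 - (2 / 3 * m)\<^sup>2) / (1 + (2 / 3 * m)\<^sup>2)"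
        by (subst Re_line_of) (auto simp: complex_eq_iff)
      moreover have "1 + (2 / 3 * m)\<^sup>2 > 0" by (intro add_pos_nonneg) auto
      ultimately show ?thesis by (simp add: less_divide_eq)
    qed
    ultimately show ?thesis by (auto simp: slope_chart_def sp)
  qed
  moreover have "Re (slope_point m \<xi>) = \<xi>" by (simp add: slope_point_def)
  moreover have "slope_chart m \<xi> = (fst (slope_chart m \<xi>), slope_point m \<xi>)" by (simp add: slope_chart_def)
  ultimately show ?thesis using slope_chart_mem[OF q] by (metis body_iff)
qed

text \<open>Over the vertical lines through the two zeros, cutting leaves only the points of the exceptional
  circles with \<open>\<omega> \<noteq> - 1\<close>.\<close>

lemma body_vertical:
  assumes "(\<omega>, \<zeta>) \<in> body" "(Re \<zeta>)\<^sup>2 = 1 / 3"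
  shows "Im \<zeta> = 0" "bdist \<zeta> = 2 / 3" "slope_denom (\<omega>, \<zeta>) > 0" "\<omega> \<noteq> - 1"
proof -
  have mem: "(\<omega>, \<zeta>) \<in> blowup_disc" and ne: "\<omega> \<noteq> line_of (Complex (Im \<zeta>) (bdist \<zeta>))" using assms by (auto simp: body_iff)
  show Im: "Im \<zeta> = 0"
  proof (rule ccontr)
    assume I: "Im \<zeta> \<noteq> 0"
    have "blowup_fun \<zeta> \<noteq> 0" using I by (simp add: blowup_fun_eq_0_iff)
    then have "line_of (blowup_fun \<zeta>) = \<omega>" using mem by (intro line_of_unique) (auto simp: blowup_disc_def)
    moreover have "1 - 3 / 2 * bdist \<zeta> = 3 / 2 * (Im \<zeta>)\<^sup>2" using assms(2) by (simp add: bdist_def field_simps)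
    then have "blowup_fun \<zeta> = (3 / 2 * Im \<zeta>) *\<^sub>R Complex (Im \<zeta>) (bdist \<zeta>)"
      by (simp add: blowup_fun_def complex_eq_iff power2_eq_square)
    ultimately have "\<omega> = line_of (Complex (Im \<zeta>) (bdist \<zeta>))" using line_of_scaleR[of "3 / 2 * Im \<zeta>"] I by simp
    then show False using ne by simp
  qed
  show bd: "bdist \<zeta> = 2 / 3" using Im assms(2) by (simp add: bdist_def)
  have "line_of (Complex 0 (2 / 3)) = - 1" by (rule line_of_unique) (auto simp: complex_eq_iff)
  then show w: "\<omega> \<noteq> - 1" using ne by (simp add: Im bd)
  then show "slope_denom (\<omega>, \<zeta>) > 0"
    using Re_greater_minus_1_of_unit[OF blowup_disc_relations(3)[OF mem]] by (simp add: slope_denom_def Im bd)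
qed

lemma body_map_onto:
  assumes "(\<omega>, \<zeta>) \<in> body"
  obtains m where "(m, Re \<zeta>) \<in> body_domain" "slope_chart m (Re \<zeta>) = (\<omega>, \<zeta>)"
proof -
  have mem: "(\<omega>, \<zeta>) \<in> blowup_disc" using assms by (auto simp: body_iff)
  have q: "bdist \<zeta> \<ge> 0" using blowup_disc_relations(4)[OF mem] .
  have "\<exists>m. slope_point m (Re \<zeta>) = \<zeta> \<and> slope_chart m (Re \<zeta>) = (\<omega>, \<zeta>)"
  proof (cases "(Re \<zeta>)\<^sup>2 = 1 / 3")
    case True
    note v = body_vertical[OF assms True]
    have "slope_chart (Im \<omega> / slope_denom (\<omega>, \<zeta>)) (Re \<zeta>) = (\<omega>, \<zeta>)"
      using slope_chart_inverse[OF mem] v by simp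
    moreover have "slope_point m (Re \<zeta>) = \<zeta>" if "slope_chart m (Re \<zeta>) = (\<omega>, \<zeta>)" for m
      using that by (simp add: slope_chart_def)
    ultimately show ?thesis by blast
  next
    case False
    define m where "m = Im \<zeta> / ((Re \<zeta>)\<^sup>2 - 1 / 3)"
    have sp: "slope_point m (Re \<zeta>) = \<zeta>" using False by (simp add: slope_point_def m_def complex_eq_iff)
    have "blowup_fun \<zeta> \<noteq> 0" using False by (simp add: blowup_fun_eq_0_iff)
    then have "line_of (blowup_fun \<zeta>) = w" if "(w, \<zeta>) \<in> blowup_disc" for w
      using that by (intro line_of_unique) (auto simp: blowup_disc_def)
    moreover have "slope_chart m (Re \<zeta>) \<in> blowup_disc" using slope_chart_mem[of m "Re \<zeta>"] q by (simp add: sp)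
    then have "(fst (slope_chart m (Re \<zeta>)), \<zeta>) \<in> blowup_disc" by (simp add: slope_chart_def sp)
    ultimately have "fst (slope_chart m (Re \<zeta>)) = \<omega>" using mem by metis
    then show ?thesis by (intro exI[of _ m]) (simp add: sp slope_chart_def)
  qed
  then obtain m where "slope_point m (Re \<zeta>) = \<zeta>" "slope_chart m (Re \<zeta>) = (\<omega>, \<zeta>)" by blast
  then show thesis using that[of m] q by (simp add: body_domain_def)
qed

lemma body_map_homeomorphism: "\<exists>k. homeomorphism body_domain body body_map k"
proof -
  have im: "body_map ` body_domain = body"
  proof
    show "body_map ` body_domain \<subseteq> body" using body_map_mem by (auto simp: body_map_def)
    show "body \<subseteq> body_map ` body_domain"
    proof
      fix p assume p: "p \<in> body"
      obtain w z where "p = (w, z)" by (cases p)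
      then obtain m where "(m, Re z) \<in> body_domain" "slope_chart m (Re z) = p" using body_map_onto p by metis
      then show "p \<in> body_map ` body_domain" unfolding body_map_def by force
    qed
  qed
  define k1 where "k1 p = (Im (snd p) / ((Re (snd p))\<^sup>2 - 1 / 3), Re (snd p))" for p :: "complex \<times> complex"
  define k2 where "k2 p = (Im (fst p) / slope_denom p, Re (snd p))" for p :: "complex \<times> complex"
  define A where "A = {p :: complex \<times> complex. (Re (snd p))\<^sup>2 \<noteq> 1 / 3}"
  define B where "B = {p :: complex \<times> complex. bdist (snd p) > 0 \<and> slope_denom p \<noteq> 0}"
  have k1: "k1 (body_map x) = x" if "body_map x \<in> A" for x
    using that by (cases x) (simp add: body_map_def k1_def A_def slope_chart_def slope_point_def)
  have k2: "k2 (body_map x) = x" if "body_map x \<in> B" for x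
  proof -
    obtain m \<xi> where x: "x = (m, \<xi>)" by (cases x)
    have s: "snd (slope_chart m \<xi>) = slope_point m \<xi>" by (simp add: slope_chart_def)
    have "bdist (slope_point m \<xi>) > 0" "slope_denom (slope_chart m \<xi>) \<noteq> 0" using that by (auto simp: x body_map_def B_def s)
    then show ?thesis using slope_denom_chart(1)[of m \<xi>] by (simp add: x body_map_def k2_def s slope_point_def)
  qed
  have cov: "body \<subseteq> A \<union> B"
  proof
    fix p assume p: "p \<in> body"
    obtain w z where wz: "p = (w, z)" by (cases p)
    show "p \<in> A \<union> B" using body_vertical[of w z] p by (auto simp: wz A_def B_def)
  qed
  have cont: "continuous_on body_domain body_map"
  proof -
    have "continuous_on body_domain (\<lambda>p. slope_chart (fst p) (snd p))"
      unfolding slope_chart_def slope_point_def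
    proof (intro smooth_on_continuous smooth_on_intros smooth_on_line_of smooth_on_bdist)
      fix p assume "p \<in> body_domain"
      then have "bdist (slope_point (fst p) (snd p)) \<ge> 0" by (auto simp: body_domain_def)
      from slope_chart_direction_nonzero[OF this, unfolded slope_point_def]
      show "Complex (1 + fst p * Im (Complex (snd p) (fst p * ((snd p)\<^sup>2 - 1 / 3))))
          (bdist (Complex (snd p) (fst p * ((snd p)\<^sup>2 - 1 / 3))) * fst p) \<noteq> 0" .
    qed
    then show ?thesis by (simp add: body_map_def case_prod_unfold)
  qed
  show ?thesis
  proof (rule homeomorphism_by_local_inverses[OF cont im _ _ cov _ _ k1 k2])
    show "open A" unfolding A_def by (intro open_Collect_neq continuous_intros)
    show "open B" unfolding B_def slope_denom_def bdist_def
      by (intro open_Collect_conj open_Collect_neq open_Collect_less continuous_intros)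
    show "continuous_on (body \<inter> A) k1" unfolding k1_def
      by (intro continuous_intros) (auto simp: A_def)
    show "continuous_on (body \<inter> B) k2" unfolding k2_def slope_denom_def bdist_def
      by (intro continuous_intros) (auto simp: B_def slope_denom_def bdist_def)
  qed
qed

lemma contractible_body: "contractible body"
  using body_map_homeomorphism contractible_body_domain homeomorphic_contractible_eq homeomorphic_def by metis

lemma contractible_right_band: "contractible right_band"
proof -
  have "contractible {p \<in> band_domain. snd p \<in> UNIV}" by (rule contractible_band_part[of _ 0]) auto
  then have "contractible band_domain" by simp
  then show ?thesis using band_map_homeomorphism homeomorphic_contractible_eq homeomorphic_def by metis
qed

definition band_half :: "real set \<Rightarrow> (complex \<times> complex) set" where
  "band_half J = band_map ` {p \<in> band_domain. snd p \<in> J}"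

lemma openin_right_band: "openin (top_of_set blowup_disc) right_band"
proof -
  have "right_band = blowup_disc \<inter> {p. Re (snd p) > 0 \<and> (fst p \<noteq> 1 \<or> Im (snd p) \<noteq> 0)}" by (auto simp: right_band_def)
  moreover have "open {p :: complex \<times> complex. Re (snd p) > 0 \<and> (fst p \<noteq> 1 \<or> Im (snd p) \<noteq> 0)}"
    by (intro open_Collect_conj open_Collect_disj open_Collect_less open_Collect_neq continuous_intros)
  ultimately show ?thesis by (auto simp: openin_open)
qed

lemma band_half_properties:
  assumes "open J" "convex J" "n0 \<in> J"
  shows "openin (top_of_set blowup_disc) (band_half J)" "path_connected (band_half J)" "band_map (0, n0) \<in> band_half J"
proof -
  obtain k where k: "homeomorphism band_domain right_band band_map k" using band_map_homeomorphism by blast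
  have "openin (top_of_set band_domain) {p \<in> band_domain. snd p \<in> J}"
  proof -
    have "{p \<in> band_domain. snd p \<in> J} = band_domain \<inter> snd -` J" by auto
    then show ?thesis using open_vimage[OF assms(1) continuous_on_snd[OF continuous_on_id]] by (auto simp: openin_open)
  qed
  then have "openin (top_of_set right_band) (band_half J)" unfolding band_half_def
    using homeomorphism_imp_open_map[OF k] by blast
  then show "openin (top_of_set blowup_disc) (band_half J)" using openin_right_band openin_trans by blast
  have "path_connected {p \<in> band_domain. snd p \<in> J}"
    by (rule contractible_imp_path_connected[OF contractible_band_part[OF assms(2,3)]])
  then show "path_connected (band_half J)" unfolding band_half_def
    using path_connected_continuous_image continuous_on_subset[OF continuous_on_band_map] by (metis (no_types, lifting) mem_Collect_eq subsetI)
  show "band_map (0, n0) \<in> band_half J" unfolding band_half_def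
    using assms(3) by (intro imageI) (simp add: band_domain_def)
qed

lemma band_minus_cocore:
  "band_half {0<..} \<union> band_half {..<0} = right_band - right_cocore" "disjnt (band_half {0<..}) (band_half {..<0})"
  "right_cocore \<subseteq> right_band"
proof -
  obtain k where k: "homeomorphism band_domain right_band band_map k" using band_map_homeomorphism by blast
  then have im: "right_band = band_map ` band_domain" and inj: "inj_on band_map band_domain"
    by (auto simp: homeomorphism_def intro: inj_on_inverseI)
  show "right_cocore \<subseteq> right_band" unfolding im right_cocore_def by blast
  have "right_band - right_cocore = band_map ` (band_domain - {p \<in> band_domain. snd p = 0})"
    unfolding im right_cocore_def by (rule inj_on_image_set_diff[symmetric, OF inj]) auto
  also have "band_domain - {p \<in> band_domain. snd p = 0} =
      {p \<in> band_domain. snd p \<in> {0<..}} \<union> {p \<in> band_domain. snd p \<in> {..<0}}" by auto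
  finally show "band_half {0<..} \<union> band_half {..<0} = right_band - right_cocore"
    unfolding band_half_def by (simp add: image_Un)
  have "{p \<in> band_domain. snd p \<in> {0<..}} \<inter> {p \<in> band_domain. snd p \<in> {..<0}} = {}" by auto
  then show "disjnt (band_half {0<..}) (band_half {..<0})"
    unfolding disjnt_def band_half_def using inj_on_image_Int[OF inj, of "{p \<in> band_domain. snd p \<in> {0<..}}" "{p \<in> band_domain. snd p \<in> {..<0}}"]
    by auto
qed

lemma mirror_homeomorphism: "homeomorphism blowup_disc blowup_disc mirror mirror"
  by (rule diffeomorphism_homeomorphism[OF mirror_diffeomorphism])

lemma right_band_Re: "p \<in> right_band \<Longrightarrow> Re (snd p) > 0" "p \<in> mirror ` right_band \<Longrightarrow> Re (snd p) < 0"
  "right_band \<subseteq> blowup_disc"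
  by (auto simp: right_band_def mirror_def)

lemma blowup_disc_decomposition:
  "blowup_disc - right_cocore \<union> right_band = blowup_disc"
  "body \<union> mirror ` right_band = blowup_disc - right_cocore"
  "(blowup_disc - right_cocore) \<inter> right_band = band_half {0<..} \<union> band_half {..<0}"
  "body \<inter> mirror ` right_band = mirror ` band_half {0<..} \<union> mirror ` band_half {..<0}"
proof -
  note c = band_minus_cocore
  note m = right_band_Re
  have inj: "inj mirror" by (metis injI mirror_mirror)
  have mB: "mirror ` right_band \<subseteq> blowup_disc" using m(3) mirror_mem by blast
  have "p \<notin> right_cocore" if "p \<in> mirror ` right_band" for p
    using m(1)[of p] m(2)[OF that] subsetD[OF c(3), of p] by linarith
  then have dis: "mirror ` right_band \<inter> right_cocore = {}" by blast
  show "blowup_disc - right_cocore \<union> right_band = blowup_disc" using c(3) m(3) by auto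
  show "body \<union> mirror ` right_band = blowup_disc - right_cocore"
    unfolding body_def using mB dis c(3) by auto
  show "(blowup_disc - right_cocore) \<inter> right_band = band_half {0<..} \<union> band_half {..<0}"
    unfolding c(1) using m(3) by auto
  have "body \<inter> mirror ` right_band = mirror ` right_band - mirror ` right_cocore"
    unfolding body_def using mB dis by auto
  also have "\<dots> = mirror ` (right_band - right_cocore)" using inj by (simp add: image_set_diff)
  finally show "body \<inter> mirror ` right_band = mirror ` band_half {0<..} \<union> mirror ` band_half {..<0}"
    unfolding c(1)[symmetric] image_Un .
qed

lemma contractible_mirror_band: "contractible (mirror ` right_band)"
proof -
  have "homeomorphism right_band (mirror ` right_band) mirror mirror"
    using homeomorphism_of_subsets[OF mirror_homeomorphism right_band_Re(3), of "mirror ` right_band"]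
      right_band_Re(3) mirror_mem by blast
  then show ?thesis using contractible_right_band homeomorphic_contractible_eq homeomorphic_def by metis
qed

lemma connected_blowup_disc: "connected blowup_disc"
proof -
  have con: "connected body" "connected right_band" "connected (mirror ` right_band)"
    using contractible_body contractible_right_band contractible_mirror_band
    by (auto intro: path_connected_imp_connected contractible_imp_path_connected)
  note h = band_half_properties(3)[of "{0<..}" 1, simplified]
  note d = blowup_disc_decomposition
  have "mirror (band_map (0, 1)) \<in> body \<inter> mirror ` right_band" unfolding d(4) using h by blast
  then have "connected (blowup_disc - right_cocore)"
    unfolding d(2)[symmetric] using con(1,3) by (intro connected_Un) auto
  moreover have "band_map (0, 1) \<in> (blowup_disc - right_cocore) \<inter> right_band" unfolding d(3) using h by blast
  ultimately have "connected (blowup_disc - right_cocore \<union> right_band)"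
    using con(2) by (intro connected_Un) auto
  then show ?thesis unfolding d(1) .
qed

lemma betti_number_blowup_disc:
  assumes "Y homeomorphic_space top_of_set blowup_disc"
  shows "betti_number 1 Y \<le> 2"
proof -
  let ?X = "top_of_set blowup_disc"
  note d = blowup_disc_decomposition
  note h = band_half_properties
  have sub: "right_band \<subseteq> blowup_disc" "mirror ` right_band \<subseteq> blowup_disc" "body \<subseteq> blowup_disc"
    "blowup_disc - right_cocore \<subseteq> blowup_disc"
    using right_band_Re(3) mirror_mem by (auto simp: body_def)
  have st: "subtopology ?X S = top_of_set S" if "S \<subseteq> blowup_disc" for S
    using that by (simp add: subtopology_subtopology Int_absorb1)
  have pc: "path_connectedin ?X S" if "S \<subseteq> blowup_disc" "path_connected S" for S
    using that by (simp add: path_connectedin_subtopology)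
  have mo: "openin ?X (mirror ` S)" if "openin ?X S" for S
    using homeomorphism_imp_open_map[OF mirror_homeomorphism that] .
  have mp: "path_connected (mirror ` S)" if "path_connected S" "S \<subseteq> blowup_disc" for S
    by (rule path_connected_continuous_image[OF continuous_on_subset[OF homeomorphism_cont1[OF mirror_homeomorphism] that(2)] that(1)])
  have o1: "openin ?X (blowup_disc - right_cocore)"
    unfolding openin_open using compact_imp_closed[OF compact_right_cocore]
    by (intro exI[of _ "- right_cocore"]) auto
  have o2: "openin ?X body"
  proof -
    have "compact (mirror ` right_cocore)"
      by (rule compact_continuous_image[OF continuous_on_subset[OF homeomorphism_cont1[OF mirror_homeomorphism]
          order_trans[OF band_minus_cocore(3) right_band_Re(3)]] compact_right_cocore])
    then have "closed (right_cocore \<union> mirror ` right_cocore)" using compact_right_cocore by (simp add: compact_imp_closed closed_Un)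
    moreover have "body = blowup_disc - (right_cocore \<union> mirror ` right_cocore)" by (auto simp: body_def)
    ultimately show ?thesis unfolding openin_open
      by (intro exI[of _ "- (right_cocore \<union> mirror ` right_cocore)"]) (simp only: open_Compl Diff_eq)
  qed
  have hb: "band_half {0<..} \<subseteq> blowup_disc" "band_half {..<0} \<subseteq> blowup_disc"
    using band_minus_cocore(1) sub(1) by auto
  have p: "openin ?X (band_half {0<..})" "path_connected (band_half {0<..})" "band_map (0, 1) \<in> band_half {0<..}"
    "openin ?X (band_half {..<0})" "path_connected (band_half {..<0})" "band_map (0, - 1) \<in> band_half {..<0}"
    using h[of "{0<..}" 1] h[of "{..<0}" "- 1"] by auto
  have dj: "disjnt (mirror ` band_half {0<..}) (mirror ` band_half {..<0})"
    using band_minus_cocore(2) by (auto simp: disjnt_def) (metis disjoint_iff mirror_mirror)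
  show ?thesis
  proof (rule betti_number_two_bands[OF assms o1 openin_right_band _ _ p(1,4) band_minus_cocore(2) d(3)[symmetric]
        pc[OF hb(1) p(2)] pc[OF hb(2) p(5)] p(3,6) o2 mo[OF openin_right_band] d(2) _ _
        mo[OF p(1)] mo[OF p(4)] dj d(4)[symmetric] pc[OF _ mp[OF p(2) hb(1)]] pc[OF _ mp[OF p(5) hb(2)]]
        imageI[OF p(3)] imageI[OF p(6)]])
    show "blowup_disc - right_cocore \<union> right_band = topspace ?X" using d(1) by simp
    show "contractible_space (subtopology ?X right_band)" by (simp add: st[OF sub(1)] contractible_right_band)
    show "contractible_space (subtopology ?X (mirror ` right_band))" by (simp add: st[OF sub(2)] contractible_mirror_band)
    show "contractible_space (subtopology ?X body)" by (simp add: st[OF sub(3)] contractible_body)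
    show "mirror ` band_half {0<..} \<subseteq> blowup_disc" "mirror ` band_half {..<0} \<subseteq> blowup_disc"
      using hb mirror_mem by blast+
  qed
qed

section \<open>Twisted satellites\<close>

text \<open>On the unit circle the inverse is the conjugate, so \<open>z powi t\<close> extends to a polynomial in \<open>z\<close> and
  \<open>cnj z\<close> for either sign of \<open>t\<close>.\<close>

lemma full_twists_smooth: "smooth_on (S1 \<times> D2) (full_twists t)"
proof -
  define u where "u p = (if t \<ge> 0 then fst p ^ nat t else cnj (fst p) ^ nat (- t)) * snd p" for p :: "complex \<times> complex"
  have "smooth_on (S1 \<times> D2) (\<lambda>p. (fst p, u p))"
    unfolding u_def by (cases "t \<ge> 0") (simp_all, (intro smooth_on_intros)+)
  moreover have "full_twists t p = (fst p, u p)" if "p \<in> S1 \<times> D2" for p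
  proof -
    have "inverse (fst p) = cnj (fst p)" using that complex_norm_square[of "fst p"]
      by (intro inverse_unique) auto
    then show ?thesis by (simp add: full_twists_def u_def power_int_def case_prod_unfold)
  qed
  ultimately show ?thesis using smooth_on_cong[of "S1 \<times> D2" "full_twists t" "\<lambda>p. (fst p, u p)"] by blast
qed

lemma full_twists_mem: "p \<in> S1 \<times> D2 \<Longrightarrow> full_twists t p \<in> S1 \<times> D2"
  by (auto simp: full_twists_def norm_mult norm_power_int)

lemma full_twists_inverse: "p \<in> S1 \<times> D2 \<Longrightarrow> full_twists (- t) (full_twists t p) = p"
proof -
  assume "p \<in> S1 \<times> D2"
  then have "fst p \<noteq> 0" by auto
  then show ?thesis by (simp add: full_twists_def case_prod_unfold power_int_minus mult.assoc[symmetric])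
qed

lemma full_twists_diffeomorphism:
  "diffeomorphism (S1 \<times> D2) (S1 \<times> D2) (full_twists t) (full_twists (- t))"
proof -
  have "full_twists s ` (S1 \<times> D2) = S1 \<times> D2" for s
  proof
    show "S1 \<times> D2 \<subseteq> full_twists s ` (S1 \<times> D2)"
    proof
      fix p assume p: "p \<in> S1 \<times> D2"
      show "p \<in> full_twists s ` (S1 \<times> D2)"
        using full_twists_inverse[OF p, of "- s"] full_twists_mem[OF p, of "- s"] by (intro image_eqI[of _ _ "full_twists (- s) p"]) simp_all
    qed
  qed (use full_twists_mem in blast)
  then show ?thesis
    using full_twists_smooth full_twists_inverse[of _ t] full_twists_inverse[of _ "- t"]
    unfolding diffeomorphism_def by simp
qed

lemma homeomorphism_imp_homeomorphic_space:
  assumes "homeomorphism S T f g"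
  shows "top_of_set S homeomorphic_space top_of_set T"
  unfolding homeomorphic_space_def homeomorphic_maps_def
  using assms by (intro exI[of _ f] exI[of _ g]) (auto simp: homeomorphism_def)

text \<open>All properties required of a spanning surface are invariant under diffeomorphisms.\<close>

lemma nonorientable_4_genus_le:
  assumes d: "diffeomorphism blowup_disc F f g" and F: "F \<subseteq> B4"
  shows "nonorientable_4_genus (f ` {(\<omega>, \<zeta>). \<omega> = 1 \<and> bdist \<zeta> = 0}) \<le> 2"
proof -
  note h = diffeomorphism_homeomorphism[OF d]
  have "smooth_surface F" by (rule smooth_surface_diffeomorphism[OF d smooth_surface_blowup_disc])
  moreover have "compact F" using compact_continuous_image[OF homeomorphism_cont1[OF h] compact_blowup_disc] homeomorphism_image1[OF h] by simp
  moreover have "connected F"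
    using connected_continuous_image[OF homeomorphism_cont1[OF h] connected_blowup_disc] homeomorphism_image1[OF h] by simp
  moreover have "\<not> orientable F"
    using orientable_diffeomorphism[OF diffeomorphism_sym[OF d]] not_orientable_blowup_disc by blast
  moreover have "surface_boundary F = f ` {(\<omega>, \<zeta>). \<omega> = 1 \<and> bdist \<zeta> = 0}"
    by (simp only: surface_boundary_diffeomorphism[OF d] surface_boundary_blowup_disc)
  ultimately have "nonorientable_4_genus (f ` {(\<omega>, \<zeta>). \<omega> = 1 \<and> bdist \<zeta> = 0}) \<le> betti_number 1 (top_of_set F)"
    unfolding nonorientable_4_genus_def using F by (intro Inf_lower) blast
  also have "\<dots> \<le> 2"
    by (rule betti_number_blowup_disc[OF homeomorphism_imp_homeomorphic_space[OF homeomorphism_symD[OF h]]])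
  finally show ?thesis .
qed

theorem theorem1p3:
  fixes K W :: "(real^4) set" and t :: int and \<epsilon> :: real
  assumes "knot K"
    and "\<epsilon> \<in> {1, -1}"
    and "whitehead_double \<epsilon> t K W"
  shows "nonorientable_4_genus W \<le> 2"
proof -
  obtain \<phi> where \<phi>: "seifert_framed_nbhd K \<phi>" and W: "W = \<phi> ` full_twists t ` whitehead_pattern \<epsilon>"
    using assms(3) unfolding whitehead_double_def by blast
  obtain \<psi> where \<psi>: "diffeomorphism (S1 \<times> D2) (\<phi> ` (S1 \<times> D2)) \<phi> \<psi>" and S3: "\<phi> ` (S1 \<times> D2) \<subseteq> S3"
    using \<phi> unfolding seifert_framed_nbhd_def by blast
  define \<Phi> where "\<Phi> = \<phi> \<circ> full_twists t"
  define P where "P = torus_map \<epsilon> ` blowup_disc"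
  have P: "P \<subseteq> S1 \<times> D2" unfolding P_def using torus_map_mem[OF assms(2)] by blast
  have "diffeomorphism (S1 \<times> D2) (\<phi> ` (S1 \<times> D2)) \<Phi> (full_twists (- t) \<circ> \<psi>)"
    unfolding \<Phi>_def by (rule diffeomorphism_compose[OF full_twists_diffeomorphism \<psi>])
  note d\<Phi> = diffeomorphism_restrict[OF this P]
  obtain g where g: "diffeomorphism blowup_disc P (torus_map \<epsilon>) g"
    using torus_map_diffeomorphism[OF assms(2)] unfolding P_def by blast
  have "\<Phi> ` P \<subseteq> B4"
  proof
    fix p assume "p \<in> \<Phi> ` P"
    then obtain q where "q \<in> S1 \<times> D2" "p = \<phi> (full_twists t q)" using P by (auto simp: \<Phi>_def)
    then have "p \<in> S3" using S3 full_twists_mem by blast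
    then show "p \<in> B4" by simp
  qed
  from nonorientable_4_genus_le[OF diffeomorphism_compose[OF g d\<Phi>] this]
  have "nonorientable_4_genus (\<Phi> ` torus_map \<epsilon> ` {(\<omega>, \<zeta>). \<omega> = 1 \<and> bdist \<zeta> = 0}) \<le> 2"
    by (simp only: image_comp)
  then show ?thesis unfolding torus_map_boundary W \<Phi>_def by (simp only: image_comp)
qed

end
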